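(* Let $M=\mathbb CP^n$ be the complex projective $n$-space, $n\ge1$, and let $L$ be the hyperplane bundle over $M$, i.e. the dual of the tautological line bundle. For every integer $\mu\ge1$ the log-term vanishes in the Szegő kernel of the circle bundle $S(L^{*\mu})$; and if $\mu>1$, then $S(L^{*\mu})$ is not diffeomorphic to the sphere $S^{2n+1}$.
   Context: $L^*$ is the tautological line bundle over $\mathbb CP^n$ with the Hermitian metric induced from the standard one on $\mathbb C^{n+1}$ (each fiber being a line in $\mathbb C^{n+1}$), and $L^{*\mu}$ is its $\mu$-th tensor power with the induced metric. $D_\mu=\{\xi\in L^{*\mu}:\|\xi\|<1\}$ is the unit disc bundle, a strictly pseudoconvex domain with smooth boundary in the complex manifold $L^{*\mu}$ of dimension $n+1$, and $S(L^{*\mu})=\partial D_\mu$ is the unit circle bundle, with projection $\pi:S(L^{*\mu})\to M$. Szegő kernel. $S(L^{*\mu})$ carries the invariant probability measure $d\sigma=\pi^*(\omega^n)\wedge\frac{d\theta}{2\pi}$, where $\omega$ is the $U(n+1)$-invariant Kähler form on $\mathbb CP^n$ normalized so that $\int_M\omega^n=1$ and $S^1=\{e^{i\theta}\}$ acts fiberwise. The Hardy space $H^2(D_\mu)$ is the closure in $L^2(S(L^{*\mu}),d\sigma)$ of the boundary values of functions holomorphic in $D_\mu$ and continuous on $\overline{D_\mu}$, identified with holomorphic functions on $D_\mu$; the Szegő kernel $K$ of $S(L^{*\mu})$ (equivalently, of $D_\mu$) is the reproducing kernel of $H^2(D_\mu)$. Log term. Let $\rho$ be a smooth defining function ($\rho<0$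 in $D_\mu$, $\rho=0$ and $d\rho\ne0$ on the boundary). Near the boundary the kernel on the diagonal has the form $K(\xi,\xi)=\phi(\xi)\rho(\xi)^{-n-1}+\psi(\xi)\log(-\rho(\xi))$ with $\phi,\psi$ smooth up to the boundary. The log-term vanishes if $\psi$ vanishes to infinite order at the boundary, i.e. if $K(\xi,\xi)\rho(\xi)^{n+1}$ extends smoothly up to the boundary. *)

theory Defs
  imports "HOL-Analysis.Analysis"
begin

section \<open>Smooth maps between subsets of manifolds\<close>

text \<open>For open sets \<open>S\<close> in Euclidean spaces, \<open>Ck_on k S f\<close> means that \<open>f\<close> is of class \<open>C\<^sup>k\<close> on \<open>S\<close>.\<close>

primrec Ck_on :: "nat \<Rightarrow> 'a::euclidean_space set \<Rightarrow> ('a \<Rightarrow> 'b::euclidean_space) \<Rightarrow> bool" where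
  "Ck_on 0 S f \<longleftrightarrow> continuous_on S f"
| "Ck_on (Suc k) S f \<longleftrightarrow> (\<forall>x\<in>S. f differentiable (at x)) \<and>
     (\<forall>v. Ck_on k S (\<lambda>x. frechet_derivative f (at x) v))"

definition smooth_on :: "'a::euclidean_space set \<Rightarrow> ('a \<Rightarrow> 'b::euclidean_space) \<Rightarrow> bool" where
  "smooth_on S f \<longleftrightarrow> (\<forall>k. Ck_on k S f)"

text \<open>A manifold is presented by a family \<open>c\<close> of injective parametrizations \<open>c i\<close>, each defined
  on a whole Euclidean space, with open images and smooth transition maps. Its topology is the
  final one for \<open>c\<close>.\<close>

definition chart_open :: "('i \<Rightarrow> 'a::euclidean_space \<Rightarrow> 'p) \<Rightarrow> 'p set \<Rightarrow> bool" where
  "chart_open c U \<longleftrightarrow> (\<forall>i. open (c i -` U))"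

text \<open>A map on an arbitrary subset \<open>A\<close> of a manifold is smooth if near every point of \<open>A\<close> it is the
  restriction of a smooth map defined on an open subset of the manifold. For open \<open>A\<close> this is
  ordinary smoothness, for embedded submanifolds \<open>A\<close> it is smoothness of maps on \<open>A\<close>, and for a closed
  domain \<open>A\<close> with smooth boundary it is smoothness up to the boundary.\<close>

definition smooth_map ::
  "('i \<Rightarrow> 'a::euclidean_space \<Rightarrow> 'p) \<Rightarrow> 'p set \<Rightarrow> ('j \<Rightarrow> 'b::euclidean_space \<Rightarrow> 'q) \<Rightarrow> ('p \<Rightarrow> 'q) \<Rightarrow> bool" where
  "smooth_map c A d f \<longleftrightarrow>
     (\<forall>i x. c i x \<in> A \<longrightarrow> (\<exists>j V h. open V \<and> x \<in> V \<and> smooth_on V h \<and>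
        (\<forall>y\<in>V. c i y \<in> A \<longrightarrow> f (c i y) = d j (h y))))"

definition diffeomorphic ::
  "('i \<Rightarrow> 'a::euclidean_space \<Rightarrow> 'p) \<Rightarrow> 'p set \<Rightarrow> ('j \<Rightarrow> 'b::euclidean_space \<Rightarrow> 'q) \<Rightarrow> 'q set \<Rightarrow> bool" where
  "diffeomorphic c A d B \<longleftrightarrow>
     (\<exists>f g. smooth_map c A d f \<and> smooth_map d B c g \<and> f ` A \<subseteq> B \<and> g ` B \<subseteq> A \<and>
        (\<forall>x\<in>A. g (f x) = x) \<and> (\<forall>y\<in>B. f (g y) = y))"

definition euclidean_chart :: "unit \<Rightarrow> 'a::euclidean_space \<Rightarrow> 'a" where
  "euclidean_chart i x = x"


section \<open>Powers of the tautological bundle of complex projective space\<close>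

text \<open>With \<open>n = CARD('n)\<close>, the space \<open>\<complex>\<^sup>n\<^sup>+\<^sup>1\<close> is \<open>complex ^ 'n option\<close>, and the points of
  projective space are its one-dimensional complex subspaces.\<close>

definition projective_space :: "(complex ^ 'n::finite option) set set" where
  "projective_space = {l. vec.subspace l \<and> vec.dim l = 1}"

text \<open>The pure tensor of a list of \<open>\<mu>\<close> vectors, given by its coordinates in the standard basis of
  the \<open>\<mu>\<close>-th tensor power; this basis is indexed by the lists of length \<open>\<mu>\<close>.\<close>

definition tensor :: "(complex ^ 'm::finite) list \<Rightarrow> 'm list \<Rightarrow> complex" where
  "tensor vs ix = (if length ix = length vs then \<Prod>k<length vs. (vs ! k) $ (ix ! k) else 0)"

text \<open>As \<open>l\<close> is a line, every element of its tensor power is a multiple of a pure tensor.\<close>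

definition tensor_power :: "nat \<Rightarrow> (complex ^ 'm::finite) set \<Rightarrow> ('m list \<Rightarrow> complex) set" where
  "tensor_power \<mu> l = {\<lambda>ix. a * tensor vs ix | a vs. length vs = \<mu> \<and> set vs \<subseteq> l}"

type_synonym 'n bundle_point = "(complex ^ 'n option) set \<times> ('n option list \<Rightarrow> complex)"

text \<open>The total space of the \<open>\<mu>\<close>-th power of the tautological bundle (the dual of the hyperplane
  bundle), and the norm of the metric induced from the standard one on \<open>\<complex>\<^sup>n\<^sup>+\<^sup>1\<close>.\<close>

definition total_space :: "nat \<Rightarrow> ('n::finite) bundle_point set" where
  "total_space \<mu> = {(l, T). l \<in> projective_space \<and> T \<in> tensor_power \<mu> l}"

definition bundle_norm :: "nat \<Rightarrow> ('n::finite) bundle_point \<Rightarrow> real" where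
  "bundle_norm \<mu> \<xi> = sqrt (\<Sum>ix | length ix = \<mu>. (cmod (snd \<xi> ix))\<^sup>2)"

definition disc_bundle :: "nat \<Rightarrow> ('n::finite) bundle_point set" where
  "disc_bundle \<mu> = {\<xi> \<in> total_space \<mu>. bundle_norm \<mu> \<xi> < 1}"

definition closed_disc_bundle :: "nat \<Rightarrow> ('n::finite) bundle_point set" where
  "closed_disc_bundle \<mu> = {\<xi> \<in> total_space \<mu>. bundle_norm \<mu> \<xi> \<le> 1}"

definition circle_bundle :: "nat \<Rightarrow> ('n::finite) bundle_point set" where
  "circle_bundle \<mu> = {\<xi> \<in> total_space \<mu>. bundle_norm \<mu> \<xi> = 1}"

text \<open>The vector with \<open>j\<close>-th homogeneous coordinate 1 and the other homogeneous coordinates given by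
  \<open>w\<close>; for \<open>j = Some k\<close>, the free slot \<open>w $ k\<close> holds the coordinate \<open>None\<close>. The bundle is
  trivialized over the \<open>j\<close>-th affine chart by the \<open>\<mu>\<close>-th tensor power of this vector.\<close>

definition homogeneous :: "'n option \<Rightarrow> complex ^ 'n \<Rightarrow> complex ^ 'n::finite option" where
  "homogeneous j w =
     (\<chi> i. if i = j then 1 else case i of None \<Rightarrow> w $ the j | Some k \<Rightarrow> w $ k)"

definition bundle_chart ::
  "nat \<Rightarrow> 'n option \<Rightarrow> (complex ^ 'n) \<times> complex \<Rightarrow> ('n::finite) bundle_point" where
  "bundle_chart \<mu> j = (\<lambda>(w, t).
     (vec.span {homogeneous j w}, \<lambda>ix. t * tensor (replicate \<mu> (homogeneous j w)) ix))"


section \<open>The invariant measure\<close>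

definition wirtinger :: "(complex ^ 'n \<Rightarrow> complex) \<Rightarrow> 'n::finite \<Rightarrow> complex ^ 'n \<Rightarrow> complex" where
  "wirtinger f k x =
     (frechet_derivative f (at x) (axis k 1) - \<i> * frechet_derivative f (at x) (axis k \<i>)) / 2"

definition wirtinger_bar :: "(complex ^ 'n \<Rightarrow> complex) \<Rightarrow> 'n::finite \<Rightarrow> complex ^ 'n \<Rightarrow> complex" where
  "wirtinger_bar f k x =
     (frechet_derivative f (at x) (axis k 1) + \<i> * frechet_derivative f (at x) (axis k \<i>)) / 2"

text \<open>The invariant Kaehler form with \<open>\<integral> \<omega>\<^sup>n = 1\<close> is the Fubini-Study form, which in the
  affine chart is \<open>\<omega> = (\<i>/2\<pi>) \<partial>\<partial>' log (1 + |w|\<^sup>2) = (\<i>/2) \<Sum>j k. g\<^sub>j\<^sub>k dw\<^sub>j \<and> dw'\<^sub>k\<close> (the prime is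
  conjugation), where \<open>g\<close> is the matrix below. Since \<open>(\<i>/2) dw\<^sub>j \<and> dw'\<^sub>j\<close> is the area form of the
  \<open>j\<close>-th coordinate, \<open>\<omega>\<^sup>n\<close> is \<open>n! det g\<close> times Lebesgue measure.\<close>

definition fubini_study :: "complex ^ 'n \<Rightarrow> complex ^ 'n ^ 'n::finite" where
  "fubini_study w = (\<chi> j k.
     wirtinger (wirtinger_bar (\<lambda>w. of_real (ln (1 + (norm w)\<^sup>2))) k) j w / of_real pi)"

definition omega_power :: "(complex ^ 'n::finite) measure" where
  "omega_power = density lborel (\<lambda>w. ennreal (fact CARD('n) * Re (det (fubini_study w))))"

definition circle_borel :: "nat \<Rightarrow> ('n::finite) bundle_point measure" where
  "circle_borel \<mu> =
     sigma (circle_bundle \<mu>) {U \<inter> circle_bundle \<mu> | U. chart_open (bundle_chart \<mu>) U}"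

text \<open>The measure \<open>\<pi>\<^sup>*(\<omega>\<^sup>n) \<and> d\<theta>/2\<pi>\<close>; the affine chart \<open>None\<close> omits only a null set.\<close>

definition circle_measure :: "nat \<Rightarrow> ('n::finite) bundle_point measure" where
  "circle_measure \<mu> =
     distr (omega_power \<Otimes>\<^sub>M uniform_measure lborel {0..2 * pi}) (circle_borel \<mu>)
       (\<lambda>(w, \<theta>). bundle_chart \<mu> None (w, cis \<theta> / of_real (norm (homogeneous None w) ^ \<mu>)))"


section \<open>Hardy space and Szegoe kernel\<close>

definition holomorphic_on_disc :: "nat \<Rightarrow> (('n::finite) bundle_point \<Rightarrow> complex) \<Rightarrow> bool" where
  "holomorphic_on_disc \<mu> f \<longleftrightarrow>
     (\<forall>j x. bundle_chart \<mu> j x \<in> disc_bundle \<mu> \<longrightarrow>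
        (\<exists>A. ((\<lambda>y. f (bundle_chart \<mu> j y)) has_derivative A) (at x) \<and>
           (\<forall>a v s. A (a *s v, a * s) = a * A (v, s))))"

definition disc_algebra :: "nat \<Rightarrow> (('n::finite) bundle_point \<Rightarrow> complex) set" where
  "disc_algebra \<mu> = {f. holomorphic_on_disc \<mu> f \<and>
     (\<forall>j. continuous_on (bundle_chart \<mu> j -` closed_disc_bundle \<mu>) (\<lambda>y. f (bundle_chart \<mu> j y)))}"

text \<open>\<open>hardy \<mu> F g\<close>: the class of \<open>g\<close> in \<open>L\<^sup>2\<close> of the circle bundle lies in the closure of the boundary
  values of \<open>disc_algebra \<mu>\<close>, and \<open>F\<close> is the holomorphic function on the disc bundle identified
  with it.\<close>

definition hardy ::
  "nat \<Rightarrow> (('n::finite) bundle_point \<Rightarrow> complex) \<Rightarrow> ('n bundle_point \<Rightarrow> complex) \<Rightarrow> bool" where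
  "hardy \<mu> F g \<longleftrightarrow>
     g \<in> borel_measurable (circle_measure \<mu>) \<and>
     integrable (circle_measure \<mu>) (\<lambda>\<xi>. (cmod (g \<xi>))\<^sup>2) \<and>
     (\<exists>f. (\<forall>k. f k \<in> disc_algebra \<mu>) \<and>
        (\<lambda>k. \<integral>\<^sup>+\<xi>. ennreal ((cmod (f k \<xi> - g \<xi>))\<^sup>2) \<partial>circle_measure \<mu>) \<longlonglongrightarrow> 0 \<and>
        (\<forall>r<1. uniform_limit {\<xi> \<in> total_space \<mu>. bundle_norm \<mu> \<xi> \<le> r} f F sequentially))"

definition is_szego_kernel ::
  "nat \<Rightarrow> (('n::finite) bundle_point \<Rightarrow> 'n bundle_point \<Rightarrow> complex) \<Rightarrow> bool" where
  "is_szego_kernel \<mu> K \<longleftrightarrow>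
     (\<forall>\<xi>\<in>disc_bundle \<mu>. \<exists>b. hardy \<mu> (\<lambda>\<eta>. K \<eta> \<xi>) b \<and>
        (\<forall>F g. hardy \<mu> F g \<longrightarrow> F \<xi> = (\<integral>\<eta>. g \<eta> * cnj (b \<eta>) \<partial>circle_measure \<mu>))) \<and>
     (\<forall>\<eta> \<xi>. \<eta> \<notin> disc_bundle \<mu> \<or> \<xi> \<notin> disc_bundle \<mu> \<longrightarrow> K \<eta> \<xi> = 0)"

definition szego_kernel :: "nat \<Rightarrow> ('n::finite) bundle_point \<Rightarrow> 'n bundle_point \<Rightarrow> complex" where
  "szego_kernel \<mu> = (THE K. is_szego_kernel \<mu> K)"


section \<open>The log-term\<close>

definition defining_function :: "nat \<Rightarrow> (('n::finite) bundle_point \<Rightarrow> real) \<Rightarrow> bool" where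
  "defining_function \<mu> \<rho> \<longleftrightarrow>
     (\<exists>U. chart_open (bundle_chart \<mu>) U \<and> closed_disc_bundle \<mu> \<subseteq> U \<and>
        smooth_map (bundle_chart \<mu>) U euclidean_chart \<rho>) \<and>
     (\<forall>\<xi>\<in>disc_bundle \<mu>. \<rho> \<xi> < 0) \<and>
     (\<forall>\<xi>\<in>circle_bundle \<mu>. \<rho> \<xi> = 0) \<and>
     (\<forall>j x. bundle_chart \<mu> j x \<in> circle_bundle \<mu> \<longrightarrow>
        frechet_derivative (\<lambda>y. \<rho> (bundle_chart \<mu> j y)) (at x) \<noteq> (\<lambda>_. 0))"

definition vanishes_to_infinite_order ::
  "nat \<Rightarrow> (('n::finite) bundle_point \<Rightarrow> real) \<Rightarrow> ('n bundle_point \<Rightarrow> real) \<Rightarrow> bool" where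
  "vanishes_to_infinite_order \<mu> \<rho> \<psi> \<longleftrightarrow>
     (\<forall>N. \<exists>C W. chart_open (bundle_chart \<mu>) W \<and> circle_bundle \<mu> \<subseteq> W \<and>
        (\<forall>\<xi>\<in>disc_bundle \<mu> \<inter> W. \<bar>\<psi> \<xi>\<bar> \<le> C * \<bar>\<rho> \<xi>\<bar> ^ N))"

text \<open>The functions \<open>\<phi>\<close> and \<open>\<psi>\<close> are smooth up to the boundary on the part of the closed disc
  bundle in a neighbourhood \<open>V\<close> of its boundary, and \<open>\<psi>\<close> is unique up to functions vanishing to
  infinite order.\<close>

definition log_term_vanishes ::
  "nat \<Rightarrow> (('n::finite) bundle_point \<Rightarrow> 'n bundle_point \<Rightarrow> complex) \<Rightarrow> bool" where
  "log_term_vanishes \<mu> K \<longleftrightarrow>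
     (\<forall>\<rho>. defining_function \<mu> \<rho> \<longrightarrow>
        (\<exists>V \<phi> \<psi>. chart_open (bundle_chart \<mu>) V \<and> circle_bundle \<mu> \<subseteq> V \<and>
           smooth_map (bundle_chart \<mu>) (closed_disc_bundle \<mu> \<inter> V) euclidean_chart \<phi> \<and>
           smooth_map (bundle_chart \<mu>) (closed_disc_bundle \<mu> \<inter> V) euclidean_chart \<psi> \<and>
           (\<forall>\<xi>\<in>disc_bundle \<mu> \<inter> V. K \<xi> \<xi> =
              of_real (\<phi> \<xi> / \<rho> \<xi> ^ (CARD('n) + 1) + \<psi> \<xi> * ln (- \<rho> \<xi>))) \<and>
           vanishes_to_infinite_order \<mu> \<rho> \<psi>))"

end

theory Submission
  imports Defs "HOL-Probability.Distributions" "HOL-Complex_Analysis.Cauchy_Integral_Formula"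
begin

text \<open>Send a nonzero vector \<open>z\<close> to the point \<open>z \<otimes> \<dots> \<otimes> z\<close> of the \<open>\<mu>\<close>-th power of its line. This
  exhibits the circle bundle as the quotient of the unit sphere of \<open>\<complex>\<^sup>n\<^sup>+\<^sup>1\<close> by the \<open>\<mu>\<close>-th roots
  of unity, and the invariant measure as the image of the Gaussian measure, which makes its invariance
  under unitary maps visible. As the quotient map is a covering with \<open>\<mu>\<close> sheets and the sphere is
  simply connected and connected, the circle bundle cannot be a sphere when \<open>\<mu> > 1\<close>.

  For the Szegoe kernel, fix a line and average a holomorphic function \<open>f\<close> over the rotations that
  fix this line: the mean value property leaves the restriction \<open>g\<close> of \<open>f\<close> to the disc over
  the line, and the integral of \<open>f\<close> against the conjugate of \<open>\<langle>\<cdot>, \<xi>\<rangle>\<^sup>k\<close> is the \<open>k\<close>-th term of the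
  Taylor series of \<open>g\<close> at \<open>\<xi>\<close> divided by the binomial coefficient \<open>n + \<mu> k\<close> over \<open>n\<close>. Hence the
  kernel is the sum over \<open>k\<close> of these binomial coefficients times \<open>\<langle>\<eta>, \<xi>\<rangle>\<^sup>k\<close>. They are
  polynomials of degree \<open>n\<close> in \<open>k\<close>, so on the diagonal the kernel is a polynomial in \<open>r = \<parallel>\<xi>\<parallel>\<^sup>2\<close>
  divided by \<open>(1 - r)\<^sup>n\<^sup>+\<^sup>1\<close>, and \<open>\<rho> / (1 - r)\<close> is smooth up to the boundary for every
  defining function \<open>\<rho>\<close>.\<close>

section \<open>Calculus of functions of class C^k\<close>

text \<open>Topology, measure and complex structure of the bundle are given only through charts, and
  \<open>circle_measure\<close> singles out the chart \<open>None\<close>. Pulling back along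
  \<open>line_pt\<close> replaces bundle points by nonzero vectors, where any unit vector
  \<open>v\<close> can stand for its line and no coordinate is preferred. The Gaussian is a
  convenient measure on directions: its density is a product, so its mass is computable, and depends
  on the norm alone, so every linear isometry preserves it. The binomial coefficients are
  reciprocals of moments: the mean of |<u, v>|^(2m) over unit vectors u is n! m! / (n + m)!, used
  with m = \<mu> k. The reproducing identity is obtained on \<open>disc_algebra\<close> and extends
  to L^2 limits because each kernel section is bounded on the circle bundle. Since
  \<open>szego_kernel\<close> is a definite description, uniqueness is needed as well; it holds
  because two reproducing kernels reproduce each other. For an arbitrary \<rho> the smooth quotient
  by 1 - r exists at first only chart by chart, as an integral of a fibre derivative. Its boundary
  values are radial limits, which makes it one function on the bundle; the logarithmic coefficient
  can then be taken to be 0.\<close>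

lemma Ck_on_cong:
  assumes "open S" "\<And>x. x \<in> S \<Longrightarrow> f x = g x" "Ck_on k S f"
  shows "Ck_on k S g"
  using assms(2,3)
proof (induction k arbitrary: f g)
  case 0
  then show ?case by (simp cong: continuous_on_cong)
next
  case (Suc k)
  have der: "(g has_derivative frechet_derivative f (at x)) (at x)" if "x \<in> S" for x
  proof (rule has_derivative_transform_within_open[OF _ assms(1) that])
    show "(f has_derivative frechet_derivative f (at x)) (at x)"
      using Suc.prems(2) that by (simp add: frechet_derivative_works)
  qed (use Suc.prems in auto)
  have "Ck_on k S (\<lambda>x. frechet_derivative g (at x) v)" for v
  proof (rule Suc.IH)
    show "Ck_on k S (\<lambda>x. frechet_derivative f (at x) v)"
      using Suc.prems(2) by simp
    show "frechet_derivative f (at x) v = frechet_derivative g (at x) v" if "x \<in> S" for x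
      using frechet_derivative_at[OF der[OF that]] by simp
  qed
  then show ?case using der by (auto simp: differentiable_def)
qed

text \<open>\<open>Ck_on\<close> speaks of \<open>frechet_derivative\<close>, whereas in
  computations the derivative is known through a formula. Uniqueness of the derivative allows any
  such formula to be used.\<close>

lemma Ck_on_SucI:
  assumes "open S" "\<And>x. x \<in> S \<Longrightarrow> (f has_derivative f' x) (at x)"
    and "\<And>v. Ck_on k S (\<lambda>x. f' x v)"
  shows "Ck_on (Suc k) S f"
proof -
  have "frechet_derivative f (at x) = f' x" if "x \<in> S" for x
    using frechet_derivative_at[OF assms(2)[OF that]] by simp
  then have "Ck_on k S (\<lambda>x. frechet_derivative f (at x) v)" for v
    by (intro Ck_on_cong[OF assms(1) _ assms(3)[of v]]) simp
  then show ?thesis using assms(2) by (auto simp: differentiable_def)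
qed

lemma Ck_on_Suc_has_derivative:
  "Ck_on (Suc k) S f \<Longrightarrow> x \<in> S \<Longrightarrow> (f has_derivative frechet_derivative f (at x)) (at x)"
  by (simp add: frechet_derivative_works)

lemma Ck_on_Suc_imp: "Ck_on (Suc k) S f \<Longrightarrow> Ck_on k S f"
proof (induction k arbitrary: f)
  case 0
  then show ?case
    by (auto intro!: continuous_at_imp_continuous_on differentiable_imp_continuous_within)
next
  case (Suc k)
  from Suc.prems have "\<forall>x\<in>S. f differentiable (at x)"
    and "\<And>v. Ck_on (Suc k) S (\<lambda>x. frechet_derivative f (at x) v)"
    by (simp_all del: Ck_on.simps(2) add: Ck_on.simps(2)[of "Suc k"])
  then show ?case using Suc.IH by (subst Ck_on.simps(2)) blast
qed

lemma Ck_on_continuous: "Ck_on k S f \<Longrightarrow> continuous_on S f"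
proof (induction k)
  case (Suc k)
  then show ?case using Ck_on_Suc_imp by blast
qed simp

lemma Ck_on_subset: "Ck_on k S f \<Longrightarrow> T \<subseteq> S \<Longrightarrow> Ck_on k T f"
proof (induction k arbitrary: f)
  case 0
  then show ?case using continuous_on_subset by auto
qed auto

lemma Ck_on_local:
  assumes "\<And>x. x \<in> S \<Longrightarrow> \<exists>V. open V \<and> x \<in> V \<and> Ck_on k V f"
  shows "Ck_on k S f"
  using assms
proof (induction k arbitrary: f)
  case 0
  then have "continuous (at x) f" if "x \<in> S" for x
    using that by (metis Ck_on.simps(1) continuous_on_eq_continuous_at)
  then show ?case by (simp add: continuous_at_imp_continuous_on)
next
  case (Suc k)
  have "f differentiable (at x)" if "x \<in> S" for x
    using Suc.prems[OF that] by auto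
  moreover have "Ck_on k S (\<lambda>x. frechet_derivative f (at x) v)" for v
    by (rule Suc.IH) (use Suc.prems in fastforce)
  ultimately show ?case by simp
qed

lemma Ck_on_const: "Ck_on k S (\<lambda>x. c)"
proof (induction k arbitrary: c)
  case (Suc k)
  show ?case
    by (simp add: Suc)
qed simp

lemma Ck_on_bounded_linear:
  assumes "open S" "bounded_linear L" "Ck_on k S f"
  shows "Ck_on k S (\<lambda>x. L (f x))"
  using assms(3)
proof (induction k arbitrary: f)
  case 0
  then show ?case using linear_continuous_on[OF assms(2)]
    by (auto intro: continuous_on_compose2)
next
  case (Suc k)
  show ?case
  proof (rule Ck_on_SucI[OF assms(1)])
    show "((\<lambda>x. L (f x)) has_derivative (\<lambda>v. L (frechet_derivative f (at x) v))) (at x)" if "x \<in> S" for x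
      using bounded_linear.has_derivative[OF assms(2) Ck_on_Suc_has_derivative[OF Suc.prems that]] .
    show "Ck_on k S (\<lambda>x. L (frechet_derivative f (at x) v))" for v
      using Suc.IH Suc.prems by simp
  qed
qed

lemma Ck_on_id: "Ck_on k S (\<lambda>x. x)"
proof (cases k)
  case (Suc k')
  have "frechet_derivative (\<lambda>x. x) (at x) = (\<lambda>v::'a. v)" for x :: 'a
    by simp
  then show ?thesis by (simp add: Suc Ck_on_const)
qed simp

lemma Ck_on_linear: "open S \<Longrightarrow> bounded_linear L \<Longrightarrow> Ck_on k S L"
  using Ck_on_bounded_linear[OF _ _ Ck_on_id] .

lemma Ck_on_add:
  assumes "open S" "Ck_on k S f" "Ck_on k S g"
  shows "Ck_on k S (\<lambda>x. f x + g x)"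
  using assms(2,3)
proof (induction k arbitrary: f g)
  case 0
  then show ?case by (simp add: continuous_on_add)
next
  case (Suc k)
  show ?case
    by (rule Ck_on_SucI[OF assms(1) has_derivative_add[OF Ck_on_Suc_has_derivative[OF Suc.prems(1)]
            Ck_on_Suc_has_derivative[OF Suc.prems(2)]] Suc.IH]) (use Suc.prems in auto)
qed

lemma Ck_on_sum:
  assumes "open S" "\<And>i. i \<in> I \<Longrightarrow> Ck_on k S (f i)"
  shows "Ck_on k S (\<lambda>x. \<Sum>i\<in>I. f i x)"
  using assms(2)
proof (induction I rule: infinite_finite_induct)
  case (insert i I)
  then show ?case by (simp add: Ck_on_add[OF assms(1)])
qed (simp_all add: Ck_on_const)

lemma Ck_on_bilinear:
  assumes "open S" "bounded_bilinear B" "Ck_on k S f" "Ck_on k S g"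
  shows "Ck_on k S (\<lambda>x. B (f x) (g x))"
  using assms(3,4)
proof (induction k arbitrary: f g)
  case 0
  then show ?case by (simp add: bounded_bilinear.continuous_on[OF assms(2)])
next
  case (Suc k)
  note * = Ck_on_Suc_imp[OF Suc.prems(1)] Ck_on_Suc_imp[OF Suc.prems(2)]
  show ?case
  proof (rule Ck_on_SucI[OF assms(1)])
    show "((\<lambda>x. B (f x) (g x)) has_derivative
        (\<lambda>v. B (f x) (frechet_derivative g (at x) v) + B (frechet_derivative f (at x) v) (g x))) (at x)"
      if "x \<in> S" for x
      using bounded_bilinear.FDERIV[OF assms(2) Ck_on_Suc_has_derivative[OF Suc.prems(1) that]
        Ck_on_Suc_has_derivative[OF Suc.prems(2) that]] .
    show "Ck_on k S (\<lambda>x. B (f x) (frechet_derivative g (at x) v) + B (frechet_derivative f (at x) v) (g x))" for v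
      by (intro Ck_on_add[OF assms(1)] Suc.IH *) (use Suc.prems in auto)
  qed
qed

lemmas Ck_on_scaleR = Ck_on_bilinear[OF _ bounded_bilinear_scaleR]
lemmas Ck_on_mult = Ck_on_bilinear[OF _ bounded_bilinear_mult]
lemmas Ck_on_inner = Ck_on_bilinear[OF _ bounded_bilinear_inner]

lemma Ck_on_power:
  fixes f :: "_ \<Rightarrow> 'a::{euclidean_space,real_normed_algebra_1}"
  assumes "open S" "Ck_on k S f"
  shows "Ck_on k S (\<lambda>x. f x ^ m)"
  by (induction m) (auto intro: Ck_on_const Ck_on_mult assms)

lemma Ck_on_compose:
  assumes "open S" "open T" "g ` S \<subseteq> T" "Ck_on k S g" "Ck_on k T f"
  shows "Ck_on k S (\<lambda>x. f (g x))"
  using assms(4,5)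
proof (induction k arbitrary: f)
  case 0
  then show ?case using assms(3) by (auto intro: continuous_on_compose2)
next
  case (Suc k)
  \<comment> \<open>The inner derivative is a direction that moves with \<open>x\<close>, but
    \<open>Ck_on\<close> controls derivatives in fixed directions only. Expanding it in the basis
    turns the chain rule into a sum of products to which the induction hypothesis applies.\<close>
  define D where "D = (\<lambda>x v. \<Sum>b\<in>Basis. (frechet_derivative g (at x) v \<bullet> b) *\<^sub>R frechet_derivative f (at (g x)) b)"
  show ?case
  proof (rule Ck_on_SucI[OF assms(1)])
    fix x assume x: "x \<in> S"
    have df: "(f has_derivative frechet_derivative f (at (g x))) (at (g x))"
      using Ck_on_Suc_has_derivative[OF Suc.prems(2)] x assms(3) by blast
    have dg: "(g has_derivative frechet_derivative g (at x)) (at x)"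
      using Ck_on_Suc_has_derivative[OF Suc.prems(1) x] .
    have rep: "frechet_derivative f (at (g x)) u = (\<Sum>b\<in>Basis. (u \<bullet> b) *\<^sub>R frechet_derivative f (at (g x)) b)" for u
    proof -
      interpret bounded_linear "frechet_derivative f (at (g x))"
        using df by (rule has_derivative_bounded_linear)
      have "frechet_derivative f (at (g x)) u = frechet_derivative f (at (g x)) (\<Sum>b\<in>Basis. (u \<bullet> b) *\<^sub>R b)"
        by (simp add: euclidean_representation)
      also have "\<dots> = (\<Sum>b\<in>Basis. (u \<bullet> b) *\<^sub>R frechet_derivative f (at (g x)) b)"
        by (simp add: sum scaleR)
      finally show ?thesis .
    qed
    have "D x = (\<lambda>v. frechet_derivative f (at (g x)) (frechet_derivative g (at x) v))"
      unfolding D_def by (rule ext, rule rep[symmetric])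
    then show "((\<lambda>x. f (g x)) has_derivative D x) (at x)"
      using has_derivative_compose[OF dg df] by simp
  next
    fix v
    show "Ck_on k S (\<lambda>x. D x v)"
      unfolding D_def
    proof (intro Ck_on_sum Ck_on_scaleR Ck_on_inner Ck_on_const assms(1))
      show "Ck_on k S (\<lambda>x. frechet_derivative g (at x) v)"
        using Suc.prems by simp
      show "Ck_on k S (\<lambda>x. frechet_derivative f (at (g x)) b)" for b
        by (rule Suc.IH[of "\<lambda>y. frechet_derivative f (at y) b"])
          (use Suc.prems Ck_on_Suc_imp[OF Suc.prems(1)] in auto)
    qed
  qed
qed

lemma Ck_on_Pair:
  assumes "open S" "Ck_on k S f" "Ck_on k S g"
  shows "Ck_on k S (\<lambda>x. (f x, g x))"
proof -
  have "Ck_on k S (\<lambda>x. (f x, 0) + (0, g x))"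
    by (intro Ck_on_add assms Ck_on_bounded_linear[where L = "\<lambda>u. (u, 0)"]
        Ck_on_bounded_linear[where L = "\<lambda>u. (0, u)"])
      (auto intro!: bounded_linear_Pair bounded_linear_ident bounded_linear_zero)
  then show ?thesis by simp
qed

text \<open>The derivative is a polynomial in \<open>inverse\<close> itself, so the induction feeds
  on its own hypothesis.\<close>

lemma Ck_on_inverse_pos: "Ck_on k {0<..} (inverse :: real \<Rightarrow> real)"
proof (induction k)
  case 0
  show ?case by (simp, intro continuous_intros) auto
next
  case (Suc k)
  show ?case
  proof (rule Ck_on_SucI)
    show "(inverse has_derivative (\<lambda>v. - (inverse x * v * inverse x))) (at x)" if "x \<in> {0<..}" for x :: real
      using that by (intro has_derivative_inverse') auto
    show "Ck_on k {0<..} (\<lambda>x. - (inverse x * v * inverse x))" for v :: real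
      by (intro Ck_on_bounded_linear[where L = uminus] Ck_on_mult Suc Ck_on_const open_greaterThan
          bounded_linear_minus bounded_linear_ident)
  qed simp
qed

text \<open>The derivative is half the reciprocal of \<open>sqrt\<close>, so the induction closes
  once reciprocals of positive functions are available.\<close>

lemma Ck_on_sqrt_pos: "Ck_on k {0<..} sqrt"
proof (induction k)
  case 0
  show ?case by (simp, intro continuous_intros) 
next
  case (Suc k)
  show ?case
  proof (rule Ck_on_SucI)
    show "(sqrt has_derivative (\<lambda>v. v * (inverse (sqrt x) / 2))) (at x)" if "x \<in> {0<..}" for x :: real
    proof -
      have "(sqrt has_derivative (*) (inverse (sqrt x) / 2)) (at x)"
        using DERIV_real_sqrt[of x] that by (simp add: has_field_derivative_def)
      moreover have "(*) (inverse (sqrt x) / 2) = (\<lambda>v. v * (inverse (sqrt x) / 2))" by auto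
      ultimately show ?thesis by (simp only:)
    qed
    show "Ck_on k {0<..} (\<lambda>x. v * (inverse (sqrt x) / 2))" for v :: real
      by (intro Ck_on_mult Ck_on_const open_greaterThan Ck_on_bounded_linear[where L = "\<lambda>x. x / 2"]
          bounded_linear_divide Ck_on_compose[OF _ _ _ Suc Ck_on_inverse_pos]) auto
  qed simp
qed

text \<open>Differentiation under the integral sign: the partial derivatives in the directions
  \<open>(v, 0)\<close> are integrands of the same kind with one order less. The open set
  \<open>W\<close> around the compact product keeps derivatives meaningful at the endpoints of the
  interval.\<close>

lemma Ck_on_parametric_integral:
  fixes G :: "'a::euclidean_space \<times> real \<Rightarrow> 'b::euclidean_space"
  assumes "open W" "open V" "V \<times> {0..1} \<subseteq> W" "Ck_on k W G"
  shows "Ck_on k V (\<lambda>x. integral {0..1} (\<lambda>\<tau>. G (x, \<tau>)))"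
  using assms(4)
proof (induction k arbitrary: G)
  case 0
  have "continuous_on (V \<times> cbox 0 1) (\<lambda>(x, \<tau>). G (x, \<tau>))"
    using 0 assms(3) by (auto intro: continuous_on_subset simp: case_prod_unfold)
  from integral_continuous_on_param[OF this] show ?case by simp
next
  case (Suc k)
  show ?case
  proof (rule Ck_on_SucI[OF assms(2)])
    fix x0 assume "x0 \<in> V"
    then obtain e where e: "e > 0" "ball x0 e \<subseteq> V" using assms(2) open_contains_ball by blast
    have contG: "continuous_on W G" using Suc.prems Ck_on_continuous by blast
    \<comment> \<open>\<open>leibniz_rule\<close> asks for continuity in the operator norm, hence
      \<open>Blinfun\<close>; in finite dimension this follows from continuity on each basis
      vector.\<close>
    define D where "D = (\<lambda>x \<tau>. Blinfun (\<lambda>v. frechet_derivative G (at (x, \<tau>)) (v, 0)))"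
    have bl: "bounded_linear (\<lambda>v. frechet_derivative G (at (x, \<tau>)) (v, 0))" if "(x, \<tau>) \<in> W" for x \<tau>
      by (rule bounded_linear_compose[OF has_derivative_bounded_linear[OF Ck_on_Suc_has_derivative[OF Suc.prems that]]])
        (auto intro!: bounded_linear_Pair bounded_linear_ident bounded_linear_zero)
    have D: "blinfun_apply (D x \<tau>) v = frechet_derivative G (at (x, \<tau>)) (v, 0)" if "(x, \<tau>) \<in> W" for x \<tau> v
      using bounded_linear_Blinfun_apply[OF bl[OF that]] by (simp add: D_def)
    have inW: "(x, \<tau>) \<in> W" if "x \<in> ball x0 e" "\<tau> \<in> cbox 0 1" for x \<tau>
      using that e(2) by (intro subsetD[OF assms(3)]) auto
    have cont: "continuous_on (ball x0 e \<times> cbox 0 1) (\<lambda>(x, \<tau>). D x \<tau>)"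
    proof (rule continuous_on_blinfun_componentwise)
      fix i :: 'a
      have "continuous_on W (\<lambda>p. frechet_derivative G (at p) (i, 0))"
        using Suc.prems by (auto intro: Ck_on_continuous)
      then have "continuous_on (ball x0 e \<times> cbox 0 1) (\<lambda>p. frechet_derivative G (at p) (i, 0))"
        by (rule continuous_on_subset) (use inW in auto)
      then show "continuous_on (ball x0 e \<times> cbox 0 1) (\<lambda>p. blinfun_apply (case p of (x, \<tau>) \<Rightarrow> D x \<tau>) i)"
        by (rule continuous_on_eq) (use inW D in auto)
    qed
    have der: "((\<lambda>x. integral (cbox 0 1) (\<lambda>\<tau>. G (x, \<tau>))) has_derivative integral (cbox 0 1) (D x0)) (at x0 within ball x0 e)"
    proof (rule leibniz_rule[OF _ _ cont])
      fix x and \<tau> :: real assume x: "x \<in> ball x0 e" and "\<tau> \<in> cbox 0 1"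
      then have W: "(x, \<tau>) \<in> W" by (rule inW)
      have "((\<lambda>x. (x, \<tau>)) has_derivative (\<lambda>v. (v, 0))) (at x)"
        by (auto intro!: derivative_eq_intros)
      from has_derivative_compose[OF this Ck_on_Suc_has_derivative[OF Suc.prems W]]
      show "((\<lambda>x. G (x, \<tau>)) has_derivative blinfun_apply (D x \<tau>)) (at x within ball x0 e)"
        unfolding D[OF W, abs_def] by (rule has_derivative_at_withinI)
    next
      fix x assume x: "x \<in> ball x0 e"
      show "(\<lambda>\<tau>. G (x, \<tau>)) integrable_on cbox 0 1"
        by (intro integrable_continuous continuous_on_compose2[OF contG] continuous_intros)
          (use inW x in auto)
    qed (use e in auto)
    have contD: "continuous_on (cbox 0 1) (D x0)"
    proof -
      have "continuous_on (cbox 0 1) (Pair x0)" "Pair x0 ` cbox (0::real) 1 \<subseteq> ball x0 e \<times> cbox 0 1"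
        using e by (auto intro!: continuous_intros)
      from continuous_on_compose2[OF cont this] show ?thesis by simp
    qed
    have "blinfun_apply (integral (cbox 0 1) (D x0)) v = integral {0..1} (\<lambda>\<tau>. frechet_derivative G (at (x0, \<tau>)) (v, 0))" for v
    proof -
      have "blinfun_apply (integral (cbox 0 1) (D x0)) v = integral (cbox 0 1) (\<lambda>\<tau>. blinfun_apply (D x0 \<tau>) v)"
        using integrable_continuous[OF contD] by (rule blinfun_apply_integral)
      also have "\<dots> = integral (cbox 0 1) (\<lambda>\<tau>. frechet_derivative G (at (x0, \<tau>)) (v, 0))"
        by (rule integral_cong) (use D inW e in auto)
      finally show ?thesis by simp
    qed
    then have "blinfun_apply (integral (cbox 0 1) (D x0)) = (\<lambda>v. integral {0..1} (\<lambda>\<tau>. frechet_derivative G (at (x0, \<tau>)) (v, 0)))"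
      by blast
    with der show "((\<lambda>x. integral {0..1} (\<lambda>\<tau>. G (x, \<tau>))) has_derivative
        (\<lambda>v. integral {0..1} (\<lambda>\<tau>. frechet_derivative G (at (x0, \<tau>)) (v, 0)))) (at x0)"
      using e by (simp add: at_within_open[of x0 "ball x0 e"])
  next
    fix v
    show "Ck_on k V (\<lambda>x. integral {0..1} (\<lambda>\<tau>. frechet_derivative G (at (x, \<tau>)) (v, 0)))"
      by (rule Suc.IH) (use Suc.prems in auto)
  qed
qed

section \<open>Powers of the tautological bundle\<close>

definition hprod :: "complex ^ 'm::finite \<Rightarrow> complex ^ 'm \<Rightarrow> complex" where
  "hprod u v = (\<Sum>i\<in>UNIV. u $ i * cnj (v $ i))"

text \<open>The element \<open>\<tau>\<close> times the \<open>\<mu>\<close>-th tensor power of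
  \<open>v\<close>, over the line of \<open>v\<close>. Compared with \<open>bundle_chart\<close>,
  any spanning vector is allowed and no coordinate is normalized.\<close>

definition line_pt :: "nat \<Rightarrow> complex ^ 'n::finite option \<Rightarrow> complex \<Rightarrow> 'n bundle_point" where
  "line_pt \<mu> v \<tau> = (vec.span {v}, \<lambda>ix. \<tau> * tensor (replicate \<mu> v) ix)"

text \<open>Points over different lines can be paired because all fibres sit in one tensor power of
  the ambient space. The form is linear in \<open>\<eta>\<close> and antilinear in
  \<open>\<xi>\<close>.\<close>

definition tpair :: "nat \<Rightarrow> ('n::finite) bundle_point \<Rightarrow> 'n bundle_point \<Rightarrow> complex" where
  "tpair \<mu> \<eta> \<xi> = (\<Sum>ix | length ix = \<mu>. snd \<eta> ix * cnj (snd \<xi> ix))"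

text \<open>Inverse of \<open>homogeneous j\<close> up to scale; as there, the free slot
  \<open>k\<close> with \<open>j = Some k\<close> holds the coordinate \<open>None\<close>.\<close>

definition affine_coord :: "'n option \<Rightarrow> complex ^ 'n::finite option \<Rightarrow> complex ^ 'n" where
  "affine_coord j z = (\<chi> k. z $ (if j = Some k then None else Some k) / z $ j)"

section \<open>The Hermitian form and its tensor powers\<close>

lemma norm_smult [simp]: "norm (c *s (z :: complex ^ 'm::finite)) = cmod c * norm z"
  by (simp add: norm_vec_def L2_set_def norm_mult power_mult_distrib flip: sum_distrib_left)
     (simp add: real_sqrt_mult)

lemma hprod_self: "hprod z z = of_real ((norm z)\<^sup>2)"
  by (simp add: hprod_def norm_vec_def L2_set_def sum_nonneg of_real_sum del: of_real_power)
     (simp add: complex_norm_square del: of_real_power)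

lemma hprod_smult_left: "hprod (c *s u) v = c * hprod u v"
  by (simp add: hprod_def sum_distrib_left mult.assoc)

lemma hprod_smult_right: "hprod u (c *s v) = cnj c * hprod u v"
  by (simp add: hprod_def sum_distrib_left mult_ac)

lemma hprod_scaleR_left: "hprod (r *\<^sub>R u) v = of_real r * hprod u v"
proof -
  have "(r *\<^sub>R u) $ i = of_real r * u $ i" for i
    by (simp only: vector_scaleR_component scaleR_conv_of_real[of r "u $ i"])
  then show ?thesis by (simp add: hprod_def sum_distrib_left mult.assoc)
qed

lemma hprod_add_left: "hprod (u + u') v = hprod u v + hprod u' v"
  by (simp add: hprod_def distrib_right sum.distrib)

lemma hprod_diff_left: "hprod (u - u') v = hprod u v - hprod u' v"
  by (simp add: hprod_def left_diff_distrib sum_subtractf)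

lemma hprod_diff_right: "hprod u (v - v') = hprod u v - hprod u v'"
  by (simp add: hprod_def right_diff_distrib sum_subtractf)

lemma hprod_add_right: "hprod u (v + v') = hprod u v + hprod u v'"
  by (simp add: hprod_def distrib_left sum.distrib)

lemma hprod_commute: "hprod v u = cnj (hprod u v)"
  by (simp add: hprod_def mult.commute)

lemma hprod_axis: "hprod u (axis i 1) = u $ i"
proof -
  have "hprod u (axis i 1) = (\<Sum>k\<in>UNIV. if k = i then u $ i else 0)"
    unfolding hprod_def by (rule sum.cong) (auto simp: axis_def)
  then show ?thesis by simp
qed

lemma norm_hprod_le: "cmod (hprod u v) \<le> norm u * norm v"
proof -
  have "cmod (hprod u v) \<le> (\<Sum>i\<in>UNIV. \<bar>cmod (u $ i)\<bar> * \<bar>cmod (v $ i)\<bar>)"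
    unfolding hprod_def by (rule norm_sum[THEN order_trans]) (simp add: norm_mult)
  also have "\<dots> \<le> norm u * norm v"
    unfolding norm_vec_def by (rule L2_set_mult_ineq)
  finally show ?thesis .
qed

lemma span_smult: "c \<noteq> 0 \<Longrightarrow> vec.span {c *s z} = vec.span {z :: complex ^ 'm::finite}"
proof (rule vec.span_unique)
  assume c: "c \<noteq> 0"
  have "z = (1 / c) *s (c *s z)" using c by simp
  then have "z \<in> vec.span {c *s z}" by (metis vec.span_base vec.span_scale singletonI)
  then show "\<And>T. {c *s z} \<subseteq> T \<Longrightarrow> vec.subspace T \<Longrightarrow> vec.span {z} \<subseteq> T"
    by (metis (no_types) c insert_subset empty_subsetI vec.span_minimal vec.subspace_scale
        \<open>z = (1 / c) *s (c *s z)\<close>)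
qed (auto intro: vec.span_scale vec.span_base)

lemma finite_lists_length [simp]: "finite {ix :: 'm::finite list. length ix = \<mu>}"
  using finite_lists_length_eq[of "UNIV :: 'm set" \<mu>] by simp

text \<open>Distributivity: expanding the power of a sum gives one product per word of length
  \<open>\<mu>\<close>. This is why pairings of pure tensor powers are powers of pairings.\<close>

lemma sum_lists_prod:
  fixes a :: "'m::finite \<Rightarrow> 'b::comm_semiring_1"
  shows "(\<Sum>ix | length ix = \<mu>. \<Prod>k<\<mu>. a (ix ! k)) = (\<Sum>i\<in>UNIV. a i) ^ \<mu>"
proof (induction \<mu>)
  case (Suc \<mu>)
  have eq: "{ix :: 'm list. length ix = Suc \<mu>} = (\<lambda>(x, xs). x # xs) ` (UNIV \<times> {ix. length ix = \<mu>})"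
    by (auto simp: length_Suc_conv image_iff)
  have "(\<Sum>ix | length ix = Suc \<mu>. \<Prod>k<Suc \<mu>. a (ix ! k)) =
        (\<Sum>(x, xs)\<in>UNIV \<times> {ix. length ix = \<mu>}. \<Prod>k<Suc \<mu>. a ((x # xs) ! k))"
    unfolding eq by (subst sum.reindex) (auto simp: inj_on_def case_prod_unfold)
  also have "\<dots> = (\<Sum>(x, xs)\<in>UNIV \<times> {ix. length ix = \<mu>}. a x * (\<Prod>k<\<mu>. a (xs ! k)))"
    by (intro sum.cong) (auto simp: prod.lessThan_Suc_shift simp del: prod.lessThan_Suc)
  also have "\<dots> = (\<Sum>i\<in>UNIV. a i) * (\<Sum>i\<in>UNIV. a i) ^ \<mu>"
    by (simp add: sum.cartesian_product[symmetric] sum_distrib_left[symmetric] sum_distrib_right Suc)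
  finally show ?case by simp
qed simp

lemma tensor_replicate:
  "tensor (replicate \<mu> z) ix = (if length ix = \<mu> then \<Prod>k<\<mu>. z $ (ix ! k) else 0)"
  by (simp add: tensor_def)

lemma tensor_replicate_smult:
  "tensor (replicate \<mu> (c *s z)) ix = c ^ \<mu> * tensor (replicate \<mu> z) ix"
  by (simp add: tensor_replicate prod.distrib)

lemma line_pt_smult: "c \<noteq> 0 \<Longrightarrow> line_pt \<mu> (c *s v) \<tau> = line_pt \<mu> v (\<tau> * c ^ \<mu>)"
  by (simp add: line_pt_def span_smult tensor_replicate_smult mult.assoc)

lemma tpair_line_pt: "tpair \<mu> (line_pt \<mu> u \<sigma>) (line_pt \<mu> v \<tau>) = \<sigma> * cnj \<tau> * hprod u v ^ \<mu>"
proof -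
  have "tpair \<mu> (line_pt \<mu> u \<sigma>) (line_pt \<mu> v \<tau>) =
     (\<Sum>ix | length ix = \<mu>. \<sigma> * cnj \<tau> * (\<Prod>k<\<mu>. u $ (ix ! k) * cnj (v $ (ix ! k))))"
    unfolding tpair_def line_pt_def by (rule sum.cong) (auto simp: tensor_replicate prod.distrib)
  then show ?thesis
    by (simp add: sum_distrib_left[symmetric] sum_lists_prod[of "\<lambda>i. u $ i * cnj (v $ i)"] hprod_def)
qed

lemma tpair_self: "tpair \<mu> \<xi> \<xi> = of_real ((bundle_norm \<mu> \<xi>)\<^sup>2)"
  by (simp add: tpair_def bundle_norm_def sum_nonneg complex_norm_square of_real_sum del: of_real_power)

lemma bundle_norm_nonneg [simp]: "0 \<le> bundle_norm \<mu> \<xi>"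
  by (simp add: bundle_norm_def sum_nonneg)

lemma bundle_norm_line_pt: "bundle_norm \<mu> (line_pt \<mu> v \<tau>) = cmod \<tau> * norm v ^ \<mu>"
proof -
  have "complex_of_real ((bundle_norm \<mu> (line_pt \<mu> v \<tau>))\<^sup>2) = of_real ((cmod \<tau> * norm v ^ \<mu>)\<^sup>2)"
    unfolding tpair_self[symmetric] tpair_line_pt hprod_self complex_norm_square[symmetric]
    by (simp add: power_mult_distrib power_mult[symmetric] mult.commute)
  then have "(bundle_norm \<mu> (line_pt \<mu> v \<tau>))\<^sup>2 = (cmod \<tau> * norm v ^ \<mu>)\<^sup>2"
    by (simp only: of_real_eq_iff)
  then show ?thesis by (simp add: power2_eq_iff_nonneg)
qed

lemma norm_tpair_le: "cmod (tpair \<mu> \<eta> \<xi>) \<le> bundle_norm \<mu> \<eta> * bundle_norm \<mu> \<xi>"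
proof -
  have "cmod (tpair \<mu> \<eta> \<xi>) \<le> (\<Sum>ix | length ix = \<mu>. \<bar>cmod (snd \<eta> ix)\<bar> * \<bar>cmod (snd \<xi> ix)\<bar>)"
    unfolding tpair_def by (rule norm_sum[THEN order_trans]) (simp add: norm_mult)
  also have "\<dots> \<le> bundle_norm \<mu> \<eta> * bundle_norm \<mu> \<xi>"
    using L2_set_mult_ineq[of "\<lambda>ix. cmod (snd \<eta> ix)" "\<lambda>ix. cmod (snd \<xi> ix)" "{ix. length ix = \<mu>}"]
    by (simp add: L2_set_def bundle_norm_def)
  finally show ?thesis .
qed

lemma tpair_commute: "tpair \<mu> \<eta> \<xi> = cnj (tpair \<mu> \<xi> \<eta>)"
  by (simp add: tpair_def mult.commute)

lemma homogeneous_nth_self [simp]: "homogeneous j w $ j = 1"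
  by (simp add: homogeneous_def)

lemma homogeneous_nonzero [simp]: "homogeneous j w \<noteq> 0"
  by (metis homogeneous_nth_self zero_index zero_neq_one)

lemma bundle_chart_line_pt: "bundle_chart \<mu> j (w, t) = line_pt \<mu> (homogeneous j w) t"
  by (simp add: bundle_chart_def line_pt_def)

lemma homogeneous_affine_coord:
  assumes "z $ j \<noteq> 0"
  shows "homogeneous j (affine_coord j z) = (1 / z $ j) *s z"
  using assms
  by (auto simp: vec_eq_iff homogeneous_def affine_coord_def split: option.split)

lemma line_pt_chart:
  assumes "z $ j \<noteq> 0"
  shows "line_pt \<mu> z \<tau> = bundle_chart \<mu> j (affine_coord j z, \<tau> * z $ j ^ \<mu>)"
  using assms by (simp add: bundle_chart_line_pt homogeneous_affine_coord line_pt_smult power_one_over)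

lemma span_in_projective_space: "v \<noteq> 0 \<Longrightarrow> vec.span {v} \<in> projective_space"
  unfolding projective_space_def by simp

lemma projective_space_cases:
  assumes "l \<in> projective_space"
  obtains v where "norm v = 1" "l = vec.span {v}"
proof -
  have l: "vec.subspace l" "vec.dim l = 1" using assms by (auto simp: projective_space_def)
  obtain B where B: "B \<subseteq> l" "vec.independent B" "l \<subseteq> vec.span B" "card B = 1"
    using vec.basis_exists[of l] l by metis
  then obtain u where u: "B = {u}" by (auto simp: card_1_singleton_iff)
  have "u \<noteq> 0" using B(2) u vec.dependent_zero by blast
  have "l = vec.span {u}" using B u l(1) vec.span_minimal[of "{u}" l] by blast
  also have "\<dots> = vec.span {of_real (1 / norm u) *s u}"
    using \<open>u \<noteq> 0\<close> by (subst span_smult) auto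
  finally have "l = vec.span {of_real (1 / norm u) *s u}" .
  moreover have "norm (complex_of_real (1 / norm u) *s u) = 1"
    using \<open>u \<noteq> 0\<close> by (simp add: norm_divide)
  ultimately show ?thesis using that by blast
qed

lemma line_pt_in_total_space: "v \<noteq> 0 \<Longrightarrow> line_pt \<mu> v \<tau> \<in> total_space \<mu>"
  unfolding total_space_def line_pt_def tensor_power_def
  by (auto simp: span_in_projective_space intro!: exI[of _ \<tau>] exI[of _ "replicate \<mu> v"] vec.span_base
      split: if_splits)

lemma bundle_chart_in_total_space: "bundle_chart \<mu> j x \<in> total_space \<mu>"
  by (cases x) (simp add: bundle_chart_line_pt line_pt_in_total_space)

lemma total_space_cases:
  assumes "\<xi> \<in> total_space \<mu>"
  obtains v \<tau> where "norm v = 1" "\<xi> = line_pt \<mu> v \<tau>"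
proof -
  obtain l T where \<xi>: "\<xi> = (l, T)" "l \<in> projective_space" "T \<in> tensor_power \<mu> l"
    using assms by (auto simp: total_space_def)
  obtain v where v: "norm v = 1" "l = vec.span {v}" using \<xi> by (auto elim: projective_space_cases)
  obtain a vs where T: "T = (\<lambda>ix. a * tensor vs ix)" "length vs = \<mu>" "set vs \<subseteq> l"
    using \<xi>(3) by (auto simp: tensor_power_def)
  have "\<exists>c. vs ! k = c *s v" if "k < \<mu>" for k
    proof -
    have "vs ! k \<in> vec.span {v}" using T that v(2) nth_mem[of k vs] by blast
    then show ?thesis by (auto simp: vec.span_singleton)
  qed
  then obtain c where c: "\<And>k. k < \<mu> \<Longrightarrow> vs ! k = c k *s v" by metis
  have "tensor vs ix = (\<Prod>k<\<mu>. c k) * tensor (replicate \<mu> v) ix" for ix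
    using T(2) c by (auto simp: tensor_def simp flip: prod.distrib)
  then have "\<xi> = line_pt \<mu> v (a * (\<Prod>k<\<mu>. c k))"
    by (simp add: \<xi>(1) T(1) v(2) line_pt_def mult.assoc)
  then show ?thesis using that v(1) by blast
qed

lemma circle_bundle_cases:
  assumes "\<xi> \<in> circle_bundle \<mu>" "\<mu> \<ge> 1"
  obtains z where "norm z = 1" "\<xi> = line_pt \<mu> z 1"
proof -
  have "\<xi> \<in> total_space \<mu>" "bundle_norm \<mu> \<xi> = 1" using assms by (auto simp: circle_bundle_def)
  then obtain v \<tau> where v: "norm v = 1" "\<xi> = line_pt \<mu> v \<tau>" by (auto elim: total_space_cases)
  then have \<tau>: "cmod \<tau> = 1" using \<open>bundle_norm \<mu> \<xi> = 1\<close> by (simp add: bundle_norm_line_pt)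
  then obtain \<theta> where "\<tau> = cis \<theta>" by (metis rcis_cmod_Arg rcis_def mult_1 of_real_1)
  \<comment> \<open>A \<open>\<mu>\<close>-th root of the fibre coordinate is moved into the vector,
    which is where \<open>\<mu> \<ge> 1\<close> enters.\<close>
  define c where "c = cis (\<theta> / \<mu>)"
  have c: "c ^ \<mu> = \<tau>" "cmod c = 1" "c \<noteq> 0"
    using assms(2) \<open>\<tau> = cis \<theta>\<close> by (simp_all add: c_def Complex.DeMoivre)
  then have "\<xi> = line_pt \<mu> (c *s v) 1" using v by (simp add: line_pt_smult)
  moreover have "norm (c *s v) = 1" using c v by simp
  ultimately show ?thesis using that by blast
qed

lemma line_pt_in_circle_bundle: "norm z = 1 \<Longrightarrow> line_pt \<mu> z 1 \<in> circle_bundle \<mu>"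
  using line_pt_in_total_space[of z \<mu> 1] by (force simp: circle_bundle_def bundle_norm_line_pt)

lemma line_pt_eq_imp:
  assumes "line_pt \<mu> z 1 = line_pt \<mu> z' 1" "z \<noteq> 0"
  obtains c where "c ^ \<mu> = 1" "z' = c *s z"
proof -
  have "z' \<in> vec.span {z}" using assms(1) by (auto simp: line_pt_def intro: vec.span_base)
  then obtain c where c: "z' = c *s z" by (auto simp: vec.span_singleton)
  obtain i where i: "z $ i \<noteq> 0" using assms(2) by (auto simp: vec_eq_iff)
  \<comment> \<open>The coordinate at the constant word in \<open>i\<close> is the
    \<open>\<mu>\<close>-th power of \<open>z $ i\<close>, hence nonzero; comparing it isolates
    \<open>c ^ \<mu>\<close>.\<close>
  have "tensor (replicate \<mu> z) (replicate \<mu> i) = c ^ \<mu> * tensor (replicate \<mu> z) (replicate \<mu> i)"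
    using assms(1) unfolding line_pt_def c tensor_replicate_smult by (metis (no_types) Pair_inject mult_1)
  moreover have "tensor (replicate \<mu> z) (replicate \<mu> i) \<noteq> 0"
    using i by (simp add: tensor_replicate)
  ultimately have "c ^ \<mu> = 1" by simp
  then show ?thesis using that c by blast
qed

lemma line_pt_root_of_unity: "c ^ \<mu> = 1 \<Longrightarrow> c \<noteq> 0 \<Longrightarrow> line_pt \<mu> (c *s z) 1 = line_pt \<mu> z 1"
  by (simp add: line_pt_smult)

section \<open>The chart topology seen from nonzero vectors\<close>

lemma continuous_on_affine_coord: "continuous_on {z. z $ j \<noteq> 0} (affine_coord j)"
  unfolding affine_coord_def by (intro continuous_intros) auto

lemma continuous_on_chart_coord:
  "continuous_on {z. z $ j \<noteq> 0} (\<lambda>z. (affine_coord j z, z $ j ^ \<mu>))"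
  by (intro continuous_intros continuous_on_affine_coord)

lemma open_nth_nonzero: "open {z :: complex ^ 'm::finite. z $ j \<noteq> 0}"
  by (intro open_Collect_neq continuous_intros)

text \<open>Where \<open>z $ j \<noteq> 0\<close>, the point \<open>line_pt \<mu> z 1\<close> is the
  chart \<open>j\<close> applied to a continuous function of \<open>z\<close>, and these regions
  cover all nonzero vectors. The measurability of \<open>line_pt\<close> rests on this.\<close>

lemma chart_open_vimage:
  fixes U :: "('n::finite) bundle_point set"
  assumes "chart_open (bundle_chart \<mu>) U"
  shows "open {z. z \<noteq> 0 \<and> line_pt \<mu> z 1 \<in> U}"
proof -
  have "{z. z \<noteq> 0 \<and> line_pt \<mu> z 1 \<in> U} =
     (\<Union>j. {z. z $ j \<noteq> 0} \<inter> (\<lambda>z. (affine_coord j z, z $ j ^ \<mu>)) -` (bundle_chart \<mu> j -` U))"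
  proof (intro equalityI subsetI)
    fix z assume z: "z \<in> {z. z \<noteq> 0 \<and> line_pt \<mu> z 1 \<in> U}"
    then obtain j where "z $ j \<noteq> 0" by (auto simp: vec_eq_iff)
    then show "z \<in> (\<Union>j. {z. z $ j \<noteq> 0} \<inter> (\<lambda>z. (affine_coord j z, z $ j ^ \<mu>)) -` (bundle_chart \<mu> j -` U))"
      using z line_pt_chart[of z j \<mu> 1] by auto
  qed (use line_pt_chart[where \<tau> = 1] in fastforce)
  moreover have "open ({z. z $ j \<noteq> 0} \<inter> (\<lambda>z. (affine_coord j z, z $ j ^ \<mu>)) -` (bundle_chart \<mu> j -` U))" for j
    using assms by (intro continuous_open_preimage continuous_on_chart_coord open_nth_nonzero)
      (auto simp: chart_open_def)
  ultimately show ?thesis by (simp only:) auto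
qed

text \<open>Near each parameter some coordinate of \<open>\<alpha>\<close> stays nonzero, and there
  the map is read in the corresponding chart. Continuity is relative to \<open>A\<close>, which is
  not open in the applications.\<close>

lemma continuous_on_line_pt_compose:
  fixes f :: "('n::finite) bundle_point \<Rightarrow> 'a::topological_space" and \<alpha> :: "'b::t2_space \<Rightarrow> _"
  assumes "\<And>j. continuous_on (bundle_chart \<mu> j -` A) (\<lambda>y. f (bundle_chart \<mu> j y))"
    and "\<And>z. z \<in> S \<Longrightarrow> \<alpha> z \<noteq> 0 \<and> line_pt \<mu> (\<alpha> z) (\<tau> z) \<in> A"
    and cont: "continuous_on S \<alpha>" "continuous_on S \<tau>"
  shows "continuous_on S (\<lambda>z. f (line_pt \<mu> (\<alpha> z) (\<tau> z)))"
  unfolding continuous_on_eq_continuous_within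
proof
  fix z assume z: "z \<in> S"
  then obtain j where j: "\<alpha> z $ j \<noteq> 0" using assms(2) by (force simp: vec_eq_iff)
  let ?V = "S \<inter> \<alpha> -` {z. z $ j \<noteq> 0}"
  have chart: "line_pt \<mu> (\<alpha> x) (\<tau> x) = bundle_chart \<mu> j (affine_coord j (\<alpha> x), \<tau> x * \<alpha> x $ j ^ \<mu>)" if "x \<in> ?V" for x
    using that by (intro line_pt_chart) simp
  have "continuous_on ?V (\<lambda>x. affine_coord j (\<alpha> x))"
    by (rule continuous_on_compose2[OF continuous_on_affine_coord continuous_on_subset[OF cont(1)]]) auto
  then have "continuous_on ?V (\<lambda>x. (affine_coord j (\<alpha> x), \<tau> x * \<alpha> x $ j ^ \<mu>))"
    by (intro continuous_intros continuous_on_subset[OF cont(1)] continuous_on_subset[OF cont(2)]) auto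
  then have "continuous_on ?V (\<lambda>x. f (bundle_chart \<mu> j (affine_coord j (\<alpha> x), \<tau> x * \<alpha> x $ j ^ \<mu>)))"
    by (rule continuous_on_compose2[OF assms(1)[of j]]) (use assms(2) chart in fastforce)
  then have "continuous_on ?V (\<lambda>x. f (line_pt \<mu> (\<alpha> x) (\<tau> x)))"
    by (rule continuous_on_eq) (simp only: chart)
  then have "continuous (at z within ?V) (\<lambda>x. f (line_pt \<mu> (\<alpha> x) (\<tau> x)))"
    using z j by (simp add: continuous_on_eq_continuous_within)
  moreover obtain N where N: "open N" "?V = S \<inter> N"
    using continuous_openin_preimage_gen[OF cont(1) open_nth_nonzero[of j]] by (auto simp: openin_open)
  moreover have "z \<in> N" using N z j by blast
  ultimately show "continuous (at z within S) (\<lambda>x. f (line_pt \<mu> (\<alpha> x) (\<tau> x)))"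
    by (simp add: continuous_within at_within_nhd[of z N S "S \<inter> N"])
qed

lemma continuous_on_line_pt:
  fixes f :: "('n::finite) bundle_point \<Rightarrow> 'a::topological_space"
  assumes "\<And>j. continuous_on (bundle_chart \<mu> j -` A) (\<lambda>y. f (bundle_chart \<mu> j y))"
    and "\<And>z. z \<in> S \<Longrightarrow> z \<noteq> 0 \<and> line_pt \<mu> z 1 \<in> A"
  shows "continuous_on S (\<lambda>z. f (line_pt \<mu> z 1))"
  using continuous_on_line_pt_compose[of \<mu> A f S "\<lambda>z. z" "\<lambda>_. 1"] assms
  by (auto intro: continuous_on_id continuous_on_const)

section \<open>The circle bundle is not a sphere\<close>

lemma roots_of_unity_separated:
  assumes "\<mu> \<ge> 1"
  obtains d where "d > 0" "\<And>c::complex. c ^ \<mu> = 1 \<Longrightarrow> cmod (c - 1) < d \<Longrightarrow> c = 1"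
proof -
  have "finite {c::complex. c ^ \<mu> = 1}" using finite_roots_unity[of \<mu>] assms by simp
  then obtain d where "d > 0" "\<forall>x\<in>{c::complex. c ^ \<mu> = 1}. x \<noteq> 1 \<longrightarrow> d \<le> dist 1 x"
    using finite_set_avoid by metis
  then show ?thesis using that[of d] by (metis dist_commute dist_norm mem_Collect_eq not_le)
qed

lemma norm_root_of_unity:
  fixes c :: complex
  assumes "c ^ \<mu> = 1" "\<mu> \<ge> 1"
  shows "cmod c = 1"
  using assms by (metis norm_ge_zero norm_one norm_power not_one_le_zero power_eq_1_iff neq0_conv)

text \<open>A map with these fibres is a covering with more than one sheet. A section over the simply
  connected sphere would select a point of each orbit, by a constant root of unity because the
  sphere is connected, which is absurd.\<close>

lemma no_quotient_of_sphere_by_roots_of_unity: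
  fixes p :: "complex ^ 'm::finite \<Rightarrow> complex ^ 'm"
  assumes \<mu>: "\<mu> > 1" and dim: "CARD('m) \<ge> 2"
    and contp: "continuous_on (sphere 0 1) p" and surj: "p ` sphere 0 1 = sphere 0 1"
    and fib: "\<And>z z'. norm z = 1 \<Longrightarrow> norm z' = 1 \<Longrightarrow> p z = p z' \<longleftrightarrow> (\<exists>c. c ^ \<mu> = 1 \<and> z' = c *s z)"
  shows False
proof -
  define S where "S = (sphere 0 1 :: (complex ^ 'm) set)"
  define R where "R = {c::complex. c ^ \<mu> = 1}"
  have R_norm: "cmod c = 1" if "c \<in> R" for c using norm_root_of_unity[of c \<mu>] that \<mu> by (simp add: R_def)
  have R_mult: "a * b \<in> R" if "a \<in> R" "b \<in> R" for a b using that by (simp add: R_def power_mult_distrib)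
  have R_inv: "inverse a \<in> R" if "a \<in> R" for a using that by (simp add: R_def power_inverse)
  have R0: "a \<noteq> 0" if "a \<in> R" for a using R_norm[OF that] by auto
  have fibS: "p z = p z' \<longleftrightarrow> (\<exists>c\<in>R. z' = c *s z)" if "z \<in> S" "z' \<in> S" for z z'
    using fib[of z z'] that by (auto simp: S_def R_def)
  have contp: "continuous_on S p" and surj: "p ` S = S" using contp surj by (auto simp: S_def)
  have "\<mu> \<ge> 1" using \<mu> by simp
  from roots_of_unity_separated[OF this] obtain d
    where "d > 0" and d': "\<And>c::complex. c ^ \<mu> = 1 \<Longrightarrow> cmod (c - 1) < d \<Longrightarrow> c = 1" by blast
  then have d: "d > 0" "\<And>c. c \<in> R \<Longrightarrow> cmod (c - 1) < d \<Longrightarrow> c = 1"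
    unfolding R_def by simp_all
  have smult_diff: "norm (c *s a - c *s b) = norm (a - b)" if "c \<in> R" for c and a b :: "complex ^ 'm"
    unfolding vector_ssub_ldistrib[symmetric] norm_smult R_norm[OF that] by simp
  have smultS: "c *s z \<in> S" if "z \<in> S" "c \<in> R" for c z using that R_norm by (simp add: S_def)
  have compactS: "compact S" by (simp add: S_def)
  \<comment> \<open>The saturation of \<open>U\<close> is the union of its rotated copies, hence
    open. Compactness of \<open>S\<close> makes \<open>p\<close> a quotient map, so the image of
    \<open>U\<close> is open too.\<close>
  have open_map: "openin (top_of_set S) (p ` U)" if U: "openin (top_of_set S) U" for U
  proof -
    have US: "U \<subseteq> S" using U openin_imp_subset by blast
    have pre_eq: "S \<inter> p -` (p ` U) = (\<Union>c\<in>R. S \<inter> (\<lambda>z. c *s z) -` U)"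
    proof (intro equalityI subsetI)
      fix z assume "z \<in> S \<inter> p -` (p ` U)"
      then obtain z' where "z \<in> S" "z' \<in> U" "p z = p z'" by auto
      then show "z \<in> (\<Union>c\<in>R. S \<inter> (\<lambda>z. c *s z) -` U)" using fibS[of z z'] US by blast
    next
      fix z assume "z \<in> (\<Union>c\<in>R. S \<inter> (\<lambda>z. c *s z) -` U)"
      then obtain c where c: "c \<in> R" "z \<in> S" "c *s z \<in> U" by auto
      then have "p z = p (c *s z)" using fibS[of z "c *s z"] US by blast
      then show "z \<in> S \<inter> p -` (p ` U)" using c by auto
    qed
    have pre_open: "openin (top_of_set S) (S \<inter> (\<lambda>z. c *s z) -` U)" if "c \<in> R" for c
    proof (rule continuous_openin_preimage[OF _ _ U])
      show "continuous_on S (\<lambda>z. c *s z)"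
        unfolding vector_scalar_mult_def by (intro continuous_intros)
      show "(\<lambda>z. c *s z) \<in> S \<rightarrow> S" using smultS that by auto
    qed
    have pre: "openin (top_of_set S) (S \<inter> p -` (p ` U))"
      unfolding pre_eq by (rule openin_Union) (use pre_open in auto)
    have "p ` U \<subseteq> S" using US surj by blast
    from Abstract_Topology_2.continuous_imp_quotient_map[OF contp surj compactS this] pre
    show ?thesis by blast
  qed
  have "covering_space S p S"
    unfolding covering_space_def
  proof (intro conjI ballI contp surj)
    fix y assume "y \<in> S"
    then obtain z0 where z0: "z0 \<in> S" "y = p z0" using surj by auto
    \<comment> \<open>The sheets near \<open>y\<close> are caps around the points
      \<open>c *s z0\<close> of the fibre. With radius half the separation \<open>d\<close> of the
      roots, two points of one cap cannot differ by a root other than 1.\<close>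
    define u where "u = (\<lambda>c::complex. S \<inter> ball (c *s z0) (d / 2))"
    define T where "T = p ` u 1"
    have uS: "u c \<subseteq> S" for c by (auto simp: u_def)
    have u1: "c *s z \<in> u (c * b) \<longleftrightarrow> z \<in> u b" if "c \<in> R" "z \<in> S" for c z b
      using smultS[OF that(2,1)] that smult_diff[OF that(1), of "b *s z0" z]
      by (simp add: u_def dist_norm vec.scale_scale)
    have u_img: "p ` u c = T" if c: "c \<in> R" for c
    proof (intro equalityI subsetI)
      fix x assume "x \<in> p ` u c"
      then obtain z where z: "z \<in> u c" "x = p z" "z \<in> S" by (auto simp: u_def)
      then have "inverse c *s z \<in> u 1"
        using u1[of "inverse c" z c] R_inv[OF c] R0[OF c] by simp
      moreover have "p z = p (inverse c *s z)"
        using fibS[of z "inverse c *s z"] z R_inv[OF c] smultS by blast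
      ultimately show "x \<in> T" by (auto simp: T_def z)
    next
      fix x assume "x \<in> T"
      then obtain z where z: "z \<in> u 1" "x = p z" "z \<in> S" by (auto simp: u_def T_def)
      then have "c *s z \<in> u c" using u1[of c z 1] c by simp
      moreover have "p z = p (c *s z)" using fibS[of z "c *s z"] z c smultS by blast
      ultimately show "x \<in> p ` u c" by (auto simp: z)
    qed
    have u_open: "openin (top_of_set S) (u c)" for c
      unfolding u_def by (simp add: openin_open_Int)
    have u_inj: "c = 1" if "z \<in> u b" "c *s z \<in> u b" "c \<in> R" for c b z
    proof (rule d(2)[OF that(3)])
      have z: "norm z = 1" using that(1) by (simp add: u_def S_def)
      have "norm (c *s z - z) < d"
        using that dist_triangle_half_r[of "b *s z0" "c *s z" d z] by (auto simp: u_def dist_norm)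
      moreover have eq: "c *s z - z = (c - 1) *s z" by (simp add: vec_eq_iff left_diff_distrib)
      have "norm (c *s z - z) = cmod (c - 1)" unfolding eq norm_smult z by simp
      ultimately show "cmod (c - 1) < d" by simp
    qed
    show "\<exists>T. y \<in> T \<and> openin (top_of_set S) T \<and> (\<exists>v. \<Union> v = S \<inter> p -` T \<and>
           (\<forall>u\<in>v. openin (top_of_set S) u) \<and> pairwise disjnt v \<and> (\<forall>u\<in>v. \<exists>q. homeomorphism u T p q))"
    proof (rule exI[of _ T], intro conjI exI[of _ "u ` R"] ballI)
      show "y \<in> T" unfolding T_def z0(2) using z0 d(1) by (auto simp: u_def)
      show oT: "openin (top_of_set S) T" unfolding T_def by (intro open_map u_open)
      show "\<Union> (u ` R) = S \<inter> p -` T"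
      proof (intro equalityI subsetI)
        fix x assume "x \<in> \<Union> (u ` R)"
        then obtain c where "c \<in> R" "x \<in> u c" by auto
        then show "x \<in> S \<inter> p -` T" using u_img uS by blast
      next
        fix x assume x: "x \<in> S \<inter> p -` T"
        then have "p x \<in> p ` u 1" by (simp add: T_def)
        then obtain z where z: "z \<in> u 1" "p z = p x" "z \<in> S" using uS by force
        then obtain c where "c \<in> R" "x = c *s z" using fibS x by blast
        then show "x \<in> \<Union> (u ` R)" using u1[of c z 1] z by auto
      qed
      show "openin (top_of_set S) w" if "w \<in> u ` R" for w using that u_open by auto
      show "pairwise disjnt (u ` R)"
      proof (clarsimp simp: pairwise_def disjnt_def)
        fix a b assume ab: "a \<in> R" "b \<in> R" "u a \<noteq> u b"
        show "u a \<inter> u b = {}"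
        proof (rule ccontr)
          assume "u a \<inter> u b \<noteq> {}"
          then obtain z where z: "z \<in> u a" "z \<in> u b" "z \<in> S" using uS by blast
          \<comment> \<open>A common point and its rotation by \<open>b / a\<close> both lie in the
            cap of \<open>b\<close>, which forces \<open>a = b\<close>.\<close>
          define c where "c = b * inverse a"
          have c: "c \<in> R" "c * a = b" using ab R_mult R_inv R0 by (auto simp: c_def)
          then have "c *s z \<in> u b" using u1[of c z a] z by simp
          then have "c = 1" using u_inj z c by blast
          then show False using c ab by simp
        qed
      qed
      fix w assume "w \<in> u ` R"
      then obtain c where c: "c \<in> R" "w = u c" by auto
      have "inj_on p w"
      proof (rule inj_onI)
        fix x x' assume x: "x \<in> w" "x' \<in> w" "p x = p x'"
        then obtain b where "b \<in> R" "x' = b *s x" using fibS[of x x'] c by (auto simp: u_def)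
        then show "x = x'" using u_inj[of x c b] x c by simp
      qed
      moreover have "openin (top_of_set T) (p ` U)" if "openin (top_of_set w) U" for U
      proof -
        have "openin (top_of_set S) U" using that u_open c openin_trans by blast
        from open_map[OF this] show ?thesis
        proof (rule openin_subset_trans)
          show "p ` U \<subseteq> T" using u_img[OF c(1)] openin_imp_subset[OF that] c by auto
          show "T \<subseteq> S" using oT by (rule openin_imp_subset)
        qed
      qed
      moreover have "continuous_on w p" using contp c by (auto simp: u_def intro: continuous_on_subset)
      ultimately show "\<exists>q. homeomorphism w T p q"
        using homeomorphism_injective_open_map[of w p T] u_img c by metis
    qed
  qed
  \<comment> \<open>Real dimension at least 3 makes the sphere simply connected, so the identity
    lifts to a section \<open>s\<close> of \<open>p\<close>.\<close>
  moreover have "DIM(complex ^ 'm) \<ge> 3" using dim by simp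
  ultimately obtain s where s: "continuous_on S s" "s \<in> S \<rightarrow> S" "\<And>y. y \<in> S \<Longrightarrow> p (s y) = y"
    using covering_space_lift[of S p S S "\<lambda>x. x"] simply_connected_sphere[of "0 :: complex ^ 'm" 1]
      locally_path_connected_sphere[of "0 :: complex ^ 'm" 1]
    unfolding S_def by (metis continuous_on_id image_ident Pi_I' id_apply)
  have ps: "p z \<in> S" "s (p z) \<in> S" if "z \<in> S" for z using that s(2) surj by auto
  have root: "\<exists>c\<in>R. s (p z) = c *s z" if z: "z \<in> S" for z
    using fibS[of z "s (p z)"] ps[OF z] s(3) z by auto
  \<comment> \<open>Pairing with \<open>z\<close> reads off the root by which \<open>s (p z)\<close>
    differs from \<open>z\<close>. It is thus a continuous function with finite range, hence
    constant.\<close>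
  have hp: "hprod (c *s z) z = c" if "z \<in> S" for z c
    using that by (simp add: S_def hprod_smult_left hprod_self)
  have "connected S" using dim by (auto simp: S_def intro!: connected_sphere)
  moreover have "continuous_on S (\<lambda>z. hprod (s (p z)) z)"
    unfolding hprod_def
    by (intro continuous_intros continuous_on_compose2[OF s(1) contp]) (use ps in auto)
  moreover have "finite ((\<lambda>z. hprod (s (p z)) z) ` S)"
  proof (rule finite_subset)
    show "(\<lambda>z. hprod (s (p z)) z) ` S \<subseteq> R" using root hp by force
    show "finite R" using finite_roots_unity[of \<mu>] \<mu> by (simp add: R_def)
  qed
  ultimately have "(\<lambda>z. hprod (s (p z)) z) constant_on S"
    by (rule continuous_finite_range_constant)
  then obtain k where k: "\<And>z. z \<in> S \<Longrightarrow> hprod (s (p z)) z = k" by (auto simp: constant_on_def)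
  then have sk: "s (p z) = k *s z" "k \<in> R" if "z \<in> S" for z
    using root[OF that] hp[OF that] that by force+
  \<comment> \<open>A nontrivial root of unity exists as \<open>\<mu> > 1\<close>. The points
    \<open>z\<close> and \<open>\<omega> *s z\<close> have the same image under \<open>p\<close>,
    yet the constant root \<open>k\<close> would make the section take two different values
    there.\<close>
  define \<omega> where "\<omega> = cis (2 * pi / \<mu>)"
  have "\<omega> \<noteq> 1"
  proof
    assume "\<omega> = 1"
    then have "cos (2 * pi / \<mu>) = 1" by (simp add: \<omega>_def complex_eq_iff)
    then obtain m :: int where "2 * pi / \<mu> = m * (2 * pi)" using cos_one_2pi_int by auto
    then have "real_of_int m * \<mu> = 1" using \<mu> by (simp add: field_simps)
    then have "m * int \<mu> = 1" by (metis of_int_1 of_int_eq_iff of_int_mult of_int_of_nat_eq)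
    then have "int \<mu> dvd 1" by (metis dvd_triv_right)
    then show False using \<mu> by simp
  qed
  have "\<omega> \<in> R" using \<mu> by (simp add: R_def \<omega>_def Complex.DeMoivre)
  obtain z where z: "z \<in> S" using sphere_eq_empty[of "0 :: complex ^ 'm" 1] unfolding S_def by fastforce
  have "p z = p (\<omega> *s z)" using fibS[of z "\<omega> *s z"] z smultS \<open>\<omega> \<in> R\<close> by blast
  then have "k *s z = k *s (\<omega> *s z)" using sk(1)[OF z] sk(1)[OF smultS[OF z \<open>\<omega> \<in> R\<close>]] by simp
  then have "z = \<omega> *s z" using R0[OF sk(2)[OF z]] by auto
  then have "hprod z z = \<omega> * hprod z z" by (metis hprod_smult_left)
  then show False using z \<open>\<omega> \<noteq> 1\<close> by (simp add: S_def hprod_self)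
qed

lemma circle_bundle_not_diffeomorphic_sphere:
  assumes "\<mu> > 1"
  shows "\<not> diffeomorphic (bundle_chart \<mu>) (circle_bundle \<mu> :: ('n::finite) bundle_point set)
    euclidean_chart (sphere 0 1 :: (complex ^ 'n option) set)"
proof
  assume "diffeomorphic (bundle_chart \<mu>) (circle_bundle \<mu> :: 'n bundle_point set)
    euclidean_chart (sphere 0 1 :: (complex ^ 'n option) set)"
  then obtain f :: "'n bundle_point \<Rightarrow> complex ^ 'n option" and g where
    f: "smooth_map (bundle_chart \<mu>) (circle_bundle \<mu>) euclidean_chart f"
    and fg: "f ` circle_bundle \<mu> \<subseteq> sphere 0 1" "g ` sphere 0 1 \<subseteq> circle_bundle \<mu>"
    "\<And>x. x \<in> circle_bundle \<mu> \<Longrightarrow> g (f x) = x" "\<And>y. y \<in> sphere 0 1 \<Longrightarrow> f (g y) = y"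
    unfolding diffeomorphic_def by blast
  have contf: "continuous_on (bundle_chart \<mu> j -` circle_bundle \<mu>) (\<lambda>y. f (bundle_chart \<mu> j y))" for j
    unfolding continuous_on_eq_continuous_within
  proof
    fix x assume x: "x \<in> bundle_chart \<mu> j -` circle_bundle \<mu>"
    then obtain V h where V: "open V" "x \<in> V" "smooth_on V h"
      "\<And>y. y \<in> V \<Longrightarrow> bundle_chart \<mu> j y \<in> circle_bundle \<mu> \<Longrightarrow> f (bundle_chart \<mu> j y) = h y"
      using f[unfolded smooth_map_def euclidean_chart_def, rule_format, of j x] by auto
    let ?B = "bundle_chart \<mu> j -` circle_bundle \<mu>"
    have "continuous_on (?B \<inter> V) h"
      using V(3) by (auto simp: smooth_on_def intro: Ck_on_continuous continuous_on_subset)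
    then have "continuous_on (?B \<inter> V) (\<lambda>y. f (bundle_chart \<mu> j y))"
      by (rule continuous_on_eq) (use V(4) in auto)
    then have "continuous (at x within ?B \<inter> V) (\<lambda>y. f (bundle_chart \<mu> j y))"
      using x V(2) by (simp add: continuous_on_eq_continuous_within)
    then show "continuous (at x within ?B) (\<lambda>y. f (bundle_chart \<mu> j y))"
      using V(1,2) by (simp add: continuous_within at_within_nhd[of x V ?B "?B \<inter> V"])
  qed
  let ?p = "\<lambda>z. f (line_pt \<mu> z 1)"
  note circ = line_pt_in_circle_bundle[of _ \<mu>]
  show False
  proof (rule no_quotient_of_sphere_by_roots_of_unity[OF assms, of ?p])
    have "finite (UNIV :: 'n set)" by simp
    then show "CARD('n option) \<ge> 2" using card_gt_0_iff[of "UNIV :: 'n set"] by (simp add: card_UNIV_option)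
    show "continuous_on (sphere 0 1) ?p"
      by (rule continuous_on_line_pt[OF contf]) (auto intro: circ)
    show "?p ` sphere 0 1 = sphere 0 1"
    proof (intro equalityI subsetI)
      fix y :: "complex ^ 'n option" assume y: "y \<in> sphere 0 1"
      then have "g y \<in> circle_bundle \<mu>" using fg by auto
      then obtain z where "norm z = 1" "g y = line_pt \<mu> z 1" using circle_bundle_cases assms by (metis less_imp_le)
      then show "y \<in> ?p ` sphere 0 1" using fg(4)[OF y] by (metis image_eqI mem_sphere_0)
    next
      fix y assume "y \<in> ?p ` sphere 0 1"
      then obtain z where z: "norm z = 1" "y = ?p z" by auto
      have "?p z \<in> f ` circle_bundle \<mu>" using circ[OF z(1)] by (rule imageI)
      then show "y \<in> sphere 0 1" using fg(1) z(2) by auto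
    qed
    fix z z' :: "complex ^ 'n option" assume z: "norm z = 1" "norm z' = 1"
    show "?p z = ?p z' \<longleftrightarrow> (\<exists>c. c ^ \<mu> = 1 \<and> z' = c *s z)"
    proof
      assume "?p z = ?p z'"
      then have "line_pt \<mu> z 1 = line_pt \<mu> z' 1" using fg(3) circ z by metis
      moreover have "z \<noteq> 0" using z by auto
      ultimately show "\<exists>c. c ^ \<mu> = 1 \<and> z' = c *s z" by (rule line_pt_eq_imp) blast
    next
      assume "\<exists>c. c ^ \<mu> = 1 \<and> z' = c *s z"
      then obtain c where c: "c ^ \<mu> = 1" "z' = c *s z" by blast
      then have "c \<noteq> 0" using z by auto
      then show "?p z = ?p z'" using line_pt_root_of_unity[of c \<mu> z] c by simp
    qed
  qed
qed

section \<open>Gaussian integrals\<close>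

lemma nn_integral_lborel_translation:
  fixes f :: "'a::euclidean_space \<Rightarrow> ennreal"
  assumes [measurable]: "f \<in> borel_measurable borel"
  shows "(\<integral>\<^sup>+x. f (c + x) \<partial>lborel) = (\<integral>\<^sup>+x. f x \<partial>lborel)"
proof -
  have "(\<integral>\<^sup>+x. f x \<partial>lborel) = (\<integral>\<^sup>+x. f x \<partial>distr lborel borel ((+) c))"
    by (simp add: lborel_distr_plus)
  also have "\<dots> = (\<integral>\<^sup>+x. f (c + x) \<partial>lborel)"
    by (rule nn_integral_distr) auto
  finally show ?thesis by simp
qed

text \<open>Uniqueness of a translation invariant measure, by exchanging the order of integration.\<close>

lemma nn_integral_lborel_isometry:
  fixes f :: "'a::euclidean_space \<Rightarrow> 'b::euclidean_space" and h :: "'b \<Rightarrow> ennreal"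
  assumes lin: "linear f" and iso: "\<And>x. norm (f x) = norm x" and surj: "surj f"
    and h [measurable]: "h \<in> borel_measurable borel"
  shows "(\<integral>\<^sup>+x. h (f x) \<partial>lborel) = (\<integral>\<^sup>+x. h x \<partial>lborel)"
proof -
  interpret linear f by fact
  have inj: "inj f" by (metis injI iso diff norm_eq_zero eq_iff_diff_eq_0)
  have [measurable]: "f \<in> borel_measurable borel"
    using lin by (intro borel_measurable_continuous_onI linear_continuous_on linear_conv_bounded_linear[THEN iffD1])
  have DIM: "DIM('b) = DIM('a)"
    using dim_image_eq[OF lin, of UNIV] inj surj by (simp add: dim_UNIV)
  define B where "B = ball (0::'b) 1"
  define b where "b = emeasure lborel B"
  have [measurable]: "B \<in> sets borel" by (simp add: B_def)
  have b_eq: "b = ennreal (unit_ball_vol (real DIM('b)))"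
    by (simp add: b_def B_def emeasure_ball)
  have "unit_ball_vol (real DIM('b)) > 0" by simp
  then have b_fin: "b \<noteq> 0" "b \<noteq> top"
    unfolding b_eq ennreal_eq_0_iff by (simp_all only: not_le ennreal_neq_top) auto
  have b': "(\<integral>\<^sup>+x. indicator B (- f x) \<partial>lborel) = b"
  proof -
    have "(\<integral>\<^sup>+x. indicator B (- f x) \<partial>lborel) = (\<integral>\<^sup>+x. indicator (ball (0::'a) 1) x \<partial>lborel)"
      by (rule nn_integral_cong) (auto simp: B_def iso split: split_indicator)
    then show ?thesis using DIM by (simp add: b_def B_def emeasure_ball)
  qed
  have meas: "(\<lambda>(u, y). h (f u) * indicator B (y - f u)) \<in> borel_measurable (lborel \<Otimes>\<^sub>M lborel)"
    "(\<lambda>(u, y). h (f u + y) * indicator B (- f u)) \<in> borel_measurable (lborel \<Otimes>\<^sub>M lborel)"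
    by (measurable)
  \<comment> \<open>The product of \<open>h (f u)\<close> with the indicator of the unit ball around
    \<open>f u\<close> is integrated in both orders. In \<open>y\<close> the ball contributes
    \<open>b\<close>; in \<open>u\<close> a shift by the preimage of \<open>y\<close> moves the
    translation into \<open>h\<close>, and integrating over \<open>y\<close> first then produces the
    integral of \<open>h\<close>.\<close>
  have "(\<integral>\<^sup>+x. h (f x) \<partial>lborel) * b = (\<integral>\<^sup>+u. (\<integral>\<^sup>+y. h (f u) * indicator B (y - f u) \<partial>lborel) \<partial>lborel)"
  proof (subst nn_integral_multc[symmetric], measurable, rule nn_integral_cong)
    fix u
    have "(\<integral>\<^sup>+y. indicator B (y - f u) \<partial>lborel) = b"
      using nn_integral_lborel_translation[of "indicator B" "- f u"] by (simp add: b_def)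
    then show "h (f u) * b = (\<integral>\<^sup>+y. h (f u) * indicator B (y - f u) \<partial>lborel)"
      by (simp add: nn_integral_cmult)
  qed
  also have "\<dots> = (\<integral>\<^sup>+y. (\<integral>\<^sup>+u. h (f u) * indicator B (y - f u) \<partial>lborel) \<partial>lborel)"
    using lborel_pair.Fubini'[OF meas(1)] by simp
  also have "\<dots> = (\<integral>\<^sup>+y. (\<integral>\<^sup>+u. h (f u + y) * indicator B (- f u) \<partial>lborel) \<partial>lborel)"
  proof (rule nn_integral_cong)
    fix y
    obtain x where x: "y = f x" using surj by auto
    show "(\<integral>\<^sup>+u. h (f u) * indicator B (y - f u) \<partial>lborel) = (\<integral>\<^sup>+u. h (f u + y) * indicator B (- f u) \<partial>lborel)"
      using nn_integral_lborel_translation[of "\<lambda>u. h (f u) * indicator B (y - f u)" x]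
      by (simp add: x add add.commute)
  qed
  also have "\<dots> = (\<integral>\<^sup>+u. (\<integral>\<^sup>+y. h (f u + y) * indicator B (- f u) \<partial>lborel) \<partial>lborel)"
    using lborel_pair.Fubini'[OF meas(2)] by simp
  also have "\<dots> = (\<integral>\<^sup>+u. (\<integral>\<^sup>+x. h x \<partial>lborel) * indicator B (- f u) \<partial>lborel)"
    by (intro nn_integral_cong) (simp add: nn_integral_multc nn_integral_lborel_translation)
  also have "\<dots> = (\<integral>\<^sup>+x. h x \<partial>lborel) * b"
    by (simp add: nn_integral_cmult b')
  finally show ?thesis using b_fin by (simp add: mult.commute[of _ b] ennreal_mult_cancel_left)
qed

lemma linear_isometry_surj:
  fixes f :: "'a::euclidean_space \<Rightarrow> 'a"
  assumes "linear f" "\<And>x. norm (f x) = norm x"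
  shows "surj f"
proof -
  have "f x = 0 \<Longrightarrow> x = 0" for x using assms(2)[of x] by simp
  then show ?thesis
    using assms(1) by (intro linear_injective_imp_surjective) (auto simp: linear_injective_0)
qed

lemma linear_borel_measurable:
  "linear f \<Longrightarrow> f \<in> borel_measurable borel" for f :: "'a::euclidean_space \<Rightarrow> 'b::euclidean_space"
  by (intro borel_measurable_continuous_onI linear_continuous_on linear_conv_bounded_linear[THEN iffD1])

lemma nn_integral_lborel_scale:
  fixes h :: "'a::euclidean_space \<Rightarrow> ennreal"
  assumes [measurable]: "h \<in> borel_measurable borel" and "c > 0"
  shows "(\<integral>\<^sup>+x. h x \<partial>lborel) = ennreal (c ^ DIM('a)) * (\<integral>\<^sup>+x. h (c *\<^sub>R x) \<partial>lborel)"
  using assms(2)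
  by (subst lborel_affine[of c 0])
     (simp_all add: nn_integral_density nn_integral_distr nn_integral_cmult)

text \<open>The integrand is a product over an orthonormal basis, and each factor is a multiple of a
  normal density with variance 1 / (2 a).\<close>

lemma nn_integral_gaussian:
  assumes "a > 0"
  shows "(\<integral>\<^sup>+x. ennreal (exp (- a * (norm (x::'a::euclidean_space))\<^sup>2)) \<partial>lborel) = ennreal (sqrt (pi / a) ^ DIM('a))"
proof -
  have one: "(\<integral>\<^sup>+x. ennreal (exp (- a * x\<^sup>2)) \<partial>lborel) = ennreal (sqrt (pi / a))"
  proof -
    define \<sigma> where "\<sigma> = 1 / sqrt (2 * a)"
    have \<sigma>: "\<sigma> > 0" "\<sigma>\<^sup>2 = 1 / (2 * a)" using assms by (auto simp: \<sigma>_def power_divide)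
    have "(\<integral>\<^sup>+x. ennreal (normal_density 0 \<sigma> x) \<partial>lborel) = 1"
      using prob_space.emeasure_space_1[OF prob_space_normal_density[OF \<sigma>(1), of 0]]
      by (simp add: emeasure_density)
    moreover have "ennreal (exp (- a * x\<^sup>2)) = ennreal (sqrt (pi / a)) * ennreal (normal_density 0 \<sigma> x)" for x
      unfolding normal_density_def \<sigma>(2) using assms
      by (subst ennreal_mult[symmetric]) (auto simp: real_sqrt_divide)
    ultimately show ?thesis by (simp add: nn_integral_cmult)
  qed
  have "(\<integral>\<^sup>+x. ennreal (exp (- a * (norm (x::'a))\<^sup>2)) \<partial>lborel) =
        (\<integral>\<^sup>+x. (\<Prod>b\<in>Basis. ennreal (exp (- a * ((x::'a) \<bullet> b)\<^sup>2))) \<partial>lborel)"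
  proof (rule nn_integral_cong)
    fix x :: 'a
    have "(norm x)\<^sup>2 = (\<Sum>b\<in>Basis. (x \<bullet> b)\<^sup>2)"
      unfolding power2_norm_eq_inner by (subst euclidean_inner) (simp add: power2_eq_square)
    then show "ennreal (exp (- a * (norm x)\<^sup>2)) = (\<Prod>b\<in>Basis. ennreal (exp (- a * (x \<bullet> b)\<^sup>2)))"
      by (subst prod_ennreal) (simp_all add: sum_distrib_left exp_sum flip: sum_negf)
  qed
  also have "\<dots> = (\<Prod>b\<in>(Basis::'a set). \<integral>\<^sup>+x. ennreal (exp (- a * x\<^sup>2)) \<partial>lborel)"
    by (rule nn_integral_lborel_prod) auto
  also have "\<dots> = ennreal (sqrt (pi / a) ^ DIM('a))"
    unfolding one prod_constant using assms by (simp add: ennreal_power)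
  finally show ?thesis .
qed

lemma nn_integral_gaussian_complex:
  assumes "a > 0"
  shows "(\<integral>\<^sup>+x. ennreal (exp (- a * (norm (x::complex ^ 'm::finite))\<^sup>2)) \<partial>lborel) = ennreal ((pi / a) ^ CARD('m))"
proof -
  have "DIM(complex ^ 'm) = 2 * CARD('m)" by simp
  moreover have "sqrt (pi / a) ^ (2 * CARD('m)) = (pi / a) ^ CARD('m)"
    unfolding power_mult using assms by simp
  ultimately show ?thesis unfolding nn_integral_gaussian[OF assms] by (simp only:)
qed

text \<open>Normalization of the Erlang density. The integrands may differ at the point 0, which is
  a null set.\<close>

lemma nn_integral_power_exp:
  assumes "a > 0"
  shows "(\<integral>\<^sup>+x. ennreal (x ^ k * exp (- a * x)) * indicator {0<..} x \<partial>lborel) = ennreal (fact k / a ^ (k + 1))"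
proof -
  have "(\<integral>\<^sup>+x. ennreal (erlang_density k a x) \<partial>lborel) = 1"
    using prob_space.emeasure_space_1[OF prob_space_erlang_density[OF assms, of k]]
    by (simp add: emeasure_density)
  moreover have "(\<integral>\<^sup>+x. ennreal (x ^ k * exp (- a * x)) * indicator {0<..} x \<partial>lborel) =
     (\<integral>\<^sup>+x. ennreal (fact k / a ^ (k + 1)) * ennreal (erlang_density k a x) \<partial>lborel)"
  proof (rule nn_integral_cong_AE)
    show "AE x in lborel. ennreal (x ^ k * exp (- a * x)) * indicator {0<..} x =
        ennreal (fact k / a ^ (k + 1)) * ennreal (erlang_density k a x)"
      using AE_lborel_singleton[of "0::real"]
    proof eventually_elim
      fix x :: real assume "x \<noteq> 0"
      then show "ennreal (x ^ k * exp (- a * x)) * indicator {0<..} x =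
        ennreal (fact k / a ^ (k + 1)) * ennreal (erlang_density k a x)"
        using assms by (subst ennreal_mult[symmetric]) (auto simp: erlang_density_def field_simps split: split_indicator)
    qed
  qed
  ultimately show ?thesis by (simp add: nn_integral_cmult)
qed

text \<open>With N = n + m and a = 1 + |w|^2, the function 1 / a^(N+1) is the integral of x^N exp(-a
  x) over x > 0, divided by N!. After exchanging the integrals, the Gaussian in \<open>w\<close>
  contributes (pi / x)^n and the remaining integral in x is m!.\<close>

lemma nn_integral_radial_power:
  "(\<integral>\<^sup>+w. ennreal (1 / (1 + (norm (w::complex ^ 'n::finite))\<^sup>2) ^ (CARD('n) + m + 1)) \<partial>lborel) =
     ennreal (pi ^ CARD('n) * fact m / fact (CARD('n) + m))"
proof -
  let ?n = "CARD('n)"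
  let ?g = "\<lambda>(w::complex ^ 'n) x. ennreal (x ^ (?n + m) * exp (- (1 + (norm w)\<^sup>2) * x)) * indicator {0<..} x"
  have pos: "1 + (norm w)\<^sup>2 > 0" for w :: "complex ^ 'n" by (simp add: add_pos_nonneg)
  have meas: "case_prod ?g \<in> borel_measurable (lborel \<Otimes>\<^sub>M lborel)" by measurable
  have "(\<integral>\<^sup>+w. ennreal (1 / (1 + (norm (w::complex ^ 'n))\<^sup>2) ^ (?n + m + 1)) \<partial>lborel) =
        (\<integral>\<^sup>+w. ennreal (1 / fact (?n + m)) * (\<integral>\<^sup>+x. ?g w x \<partial>lborel) \<partial>lborel)"
    unfolding nn_integral_power_exp[OF pos]
    by (intro nn_integral_cong) (use pos in \<open>simp add: ennreal_mult[symmetric] less_imp_le\<close>)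
  also have "\<dots> = ennreal (1 / fact (?n + m)) * (\<integral>\<^sup>+w. (\<integral>\<^sup>+x. ?g w x \<partial>lborel) \<partial>lborel)"
    by (rule nn_integral_cmult) (use meas in measurable)
  also have "(\<integral>\<^sup>+w. (\<integral>\<^sup>+x. ?g w x \<partial>lborel) \<partial>lborel) = (\<integral>\<^sup>+x. (\<integral>\<^sup>+w. ?g w x \<partial>lborel) \<partial>lborel)"
    using lborel_pair.Fubini'[OF meas] by simp
  also have "\<dots> = (\<integral>\<^sup>+x. ennreal (pi ^ ?n) * (ennreal (x ^ m * exp (- 1 * x)) * indicator {0<..} x) \<partial>lborel)"
  proof (rule nn_integral_cong)
    fix x :: real
    show "(\<integral>\<^sup>+w. ?g w x \<partial>lborel) = ennreal (pi ^ ?n) * (ennreal (x ^ m * exp (- 1 * x)) * indicator {0<..} x)"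
    proof (cases "x > 0")
      case True
      have "(\<integral>\<^sup>+w. ?g w x \<partial>lborel) = (\<integral>\<^sup>+w. ennreal (x ^ (?n + m) * exp (- x)) * ennreal (exp (- x * (norm (w::complex ^ 'n))\<^sup>2)) \<partial>lborel)"
        using True by (intro nn_integral_cong) (simp add: ennreal_mult[symmetric] distrib_right mult.assoc exp_add[symmetric] algebra_simps)
      also have "\<dots> = ennreal (x ^ (?n + m) * exp (- x)) * ennreal ((pi / x) ^ ?n)"
        using True by (subst nn_integral_cmult) (simp_all only: nn_integral_gaussian_complex[OF True], measurable)
      also have "\<dots> = ennreal (pi ^ ?n) * (ennreal (x ^ m * exp (- 1 * x)) * indicator {0<..} x)"
        using True by (simp add: ennreal_mult[symmetric] power_add power_divide)
      finally show ?thesis .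
    qed simp
  qed
  also have "\<dots> = ennreal (pi ^ ?n) * ennreal (fact m / 1 ^ (m + 1))"
    by (subst nn_integral_cmult) (simp_all only: nn_integral_power_exp[OF zero_less_one], measurable)
  finally show ?thesis by (simp add: ennreal_mult[symmetric])
qed

section \<open>Coordinates z = s (1, w) on the ambient space\<close>

definition join :: "complex \<Rightarrow> complex ^ 'n::finite \<Rightarrow> complex ^ 'n option" where
  "join s w = (\<chi> i. case i of None \<Rightarrow> s | Some k \<Rightarrow> w $ k)"

lemma sum_UNIV_option: "(\<Sum>i\<in>UNIV. f i) = f None + (\<Sum>k\<in>UNIV. f (Some (k::'n::finite)))"
  by (simp add: UNIV_option_conv sum.reindex)

lemma power2_norm_vec: "(norm z)\<^sup>2 = (\<Sum>i\<in>UNIV. (cmod (z $ i))\<^sup>2)" for z :: "complex ^ 'm::finite"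
  by (simp add: norm_vec_def L2_set_def sum_nonneg)

lemma power2_norm_join: "(norm (join s w))\<^sup>2 = (cmod s)\<^sup>2 + (norm w)\<^sup>2"
  by (simp add: power2_norm_vec join_def sum_UNIV_option)

lemma homogeneous_None: "homogeneous None w = join 1 w"
  by (auto simp: homogeneous_def join_def vec_eq_iff split: option.split)

lemma power2_norm_homogeneous_None: "(norm (homogeneous None w))\<^sup>2 = 1 + (norm w)\<^sup>2"
  by (simp add: homogeneous_None power2_norm_join)

lemma smult_homogeneous_None: "s *s homogeneous None w = join s (s *s w)"
  by (auto simp: homogeneous_None join_def vec_eq_iff split: option.split)

lemma borel_measurable_join [measurable]:
  assumes [measurable]: "f \<in> borel_measurable M" "g \<in> borel_measurable M"
  shows "(\<lambda>x. join (f x) (g x)) \<in> borel_measurable M"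
proof -
  have "continuous_on UNIV (\<lambda>p. join (fst p) (snd p))"
    unfolding join_def
  proof (intro continuous_on_vec_lambda)
    fix i
    show "continuous_on UNIV (\<lambda>x. case i of None \<Rightarrow> fst x | Some k \<Rightarrow> snd x $ k)"
      by (cases i) (auto intro!: continuous_intros)
  qed
  then have "(\<lambda>p. join (fst p) (snd p)) \<in> borel_measurable borel"
    by (rule borel_measurable_continuous_onI)
  from measurable_compose[OF _ this, of "\<lambda>x. (f x, g x)" M] show ?thesis
    by (simp add: borel_prod[symmetric])
qed

lemma borel_measurable_smult [measurable]:
  fixes g :: "'a \<Rightarrow> complex ^ 'm::finite"
  assumes [measurable]: "f \<in> borel_measurable M" "g \<in> borel_measurable M"
  shows "(\<lambda>x. f x *s g x) \<in> borel_measurable M"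
proof -
  have "continuous_on UNIV (\<lambda>p :: complex \<times> (complex ^ 'm). fst p *s snd p)"
    unfolding vector_scalar_mult_def by (intro continuous_intros)
  then have "(\<lambda>p :: complex \<times> (complex ^ 'm). fst p *s snd p) \<in> borel_measurable borel"
    by (rule borel_measurable_continuous_onI)
  from measurable_compose[OF _ this, of "\<lambda>x. (f x, g x)" M] show ?thesis
    by (simp add: borel_prod[symmetric])
qed

lemma borel_measurable_cis [measurable]:
  assumes [measurable]: "f \<in> borel_measurable M"
  shows "(\<lambda>x. cis (f x)) \<in> borel_measurable M"
proof -
  have "cis \<in> borel_measurable borel"
    by (intro borel_measurable_continuous_onI continuous_intros)
  from measurable_compose[OF assms this] show ?thesis .
qed

lemma borel_measurable_homogeneous_None [measurable]:
  "f \<in> borel_measurable M \<Longrightarrow> (\<lambda>x. homogeneous None (f x)) \<in> borel_measurable M"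
  unfolding homogeneous_None by measurable

text \<open>Splitting off one coordinate is a linear isometry between two different Euclidean
  spaces; this is the case for which \<open>nn_integral_lborel_isometry\<close> allows two
  types.\<close>

lemma nn_integral_join:
  fixes h :: "complex ^ 'n::finite option \<Rightarrow> ennreal"
  assumes [measurable]: "h \<in> borel_measurable borel"
  shows "(\<integral>\<^sup>+z. h z \<partial>lborel) = (\<integral>\<^sup>+s. (\<integral>\<^sup>+w. h (join s w) \<partial>lborel) \<partial>lborel)"
proof -
  let ?f = "\<lambda>p :: complex \<times> (complex ^ 'n). join (fst p) (snd p)"
  have "(\<integral>\<^sup>+z. h z \<partial>lborel) = (\<integral>\<^sup>+p. h (?f p) \<partial>lborel)"
  proof (rule nn_integral_lborel_isometry[symmetric])
    show "linear ?f"
      by (rule linearI) (auto simp: join_def vec_eq_iff split: option.split)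
    fix p :: "complex \<times> (complex ^ 'n)"
    have "(norm (?f p))\<^sup>2 = (norm p)\<^sup>2" by (simp add: power2_norm_join norm_prod_def)
    then show "norm (?f p) = norm p" by (simp add: power2_eq_iff_nonneg)
  next
    show "surj ?f"
    proof (rule surjI)
      fix z :: "complex ^ 'n option"
      show "?f (z $ None, \<chi> k. z $ Some k) = z"
        by (auto simp: join_def vec_eq_iff split: option.split)
    qed
  qed measurable
  also have "\<dots> = (\<integral>\<^sup>+p. h (?f p) \<partial>(lborel \<Otimes>\<^sub>M lborel))" by (simp add: lborel_prod)
  also have "\<dots> = (\<integral>\<^sup>+s. (\<integral>\<^sup>+w. h (join s w) \<partial>lborel) \<partial>lborel)"
    by (subst lborel.nn_integral_fst[symmetric]) (auto simp: borel_prod)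
  finally show ?thesis .
qed

lemma nn_integral_lborel_smult_unit:
  fixes h :: "complex ^ 'm::finite \<Rightarrow> ennreal"
  assumes "cmod c = 1" and [measurable]: "h \<in> borel_measurable borel"
  shows "(\<integral>\<^sup>+z. h (c *s z) \<partial>lborel) = (\<integral>\<^sup>+z. h z \<partial>lborel)"
proof (rule nn_integral_lborel_isometry[OF _ _ linear_isometry_surj])
  show "linear (\<lambda>z. c *s z)"
    by (rule linearI) (simp_all add: vec_eq_iff algebra_simps)
  then show "linear (\<lambda>z. c *s z)" .
qed (use assms in auto)

lemma nn_integral_lborel_mult_unit:
  fixes h :: "complex \<Rightarrow> ennreal"
  assumes "cmod c = 1" and [measurable]: "h \<in> borel_measurable borel"
  shows "(\<integral>\<^sup>+z. h (c * z) \<partial>lborel) = (\<integral>\<^sup>+z. h z \<partial>lborel)"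
proof (rule nn_integral_lborel_isometry[OF _ _ linear_isometry_surj])
  show "linear (\<lambda>z. c * z)" by (rule linearI) (simp_all add: algebra_simps)
  then show "linear (\<lambda>z. c * z)" .
qed (use assms in \<open>auto simp: norm_mult\<close>)

text \<open>The scalar is split into modulus and phase: scaling by \<open>cmod c\<close> contributes
  a power with the real dimension as exponent, and the rotation by \<open>sgn c\<close> preserves
  Lebesgue measure.\<close>

lemma nn_integral_lborel_smult:
  fixes h :: "complex ^ 'm::finite \<Rightarrow> ennreal"
  assumes "c \<noteq> 0" and [measurable]: "h \<in> borel_measurable borel"
  shows "(\<integral>\<^sup>+z. h z \<partial>lborel) = ennreal (cmod c ^ (2 * CARD('m))) * (\<integral>\<^sup>+z. h (c *s z) \<partial>lborel)"
proof -
  have c: "cmod c *\<^sub>R (sgn c *s z) = c *s z" for z :: "complex ^ 'm"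
  proof -
    have "cmod c *\<^sub>R sgn c = c" using assms(1) by (simp add: sgn_div_norm)
    then have "cmod c *\<^sub>R (sgn c * z $ i) = c * z $ i" for i by (metis mult_scaleR_left)
    then show ?thesis by (simp add: vec_eq_iff)
  qed
  have "(\<integral>\<^sup>+z. h z \<partial>lborel) = ennreal (cmod c ^ (2 * CARD('m))) * (\<integral>\<^sup>+z. h (cmod c *\<^sub>R z) \<partial>lborel)"
    using assms(1) by (subst nn_integral_lborel_scale[of _ "cmod c"]) (simp_all add: mult.commute)
  also have "(\<integral>\<^sup>+z. h (cmod c *\<^sub>R z) \<partial>lborel) = (\<integral>\<^sup>+z. h (cmod c *\<^sub>R (sgn c *s z)) \<partial>lborel)"
    by (rule nn_integral_lborel_smult_unit[symmetric]) (use assms(1) in \<open>simp_all add: norm_sgn\<close>)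
  finally show ?thesis unfolding c .
qed

text \<open>For fixed \<open>s \<noteq> 0\<close>, replacing \<open>w\<close> by
  \<open>s *s w\<close> has Jacobian \<open>cmod s ^ (2 * CARD('n))\<close>; the new
  \<open>w\<close> is the affine coordinate of the line of \<open>z\<close> in the chart
  \<open>None\<close>.\<close>

lemma nn_integral_cone:
  fixes h :: "complex ^ 'n::finite option \<Rightarrow> ennreal"
  assumes [measurable]: "h \<in> borel_measurable borel"
  shows "(\<integral>\<^sup>+z. h z \<partial>lborel) =
    (\<integral>\<^sup>+w. (\<integral>\<^sup>+s. ennreal (cmod s ^ (2 * CARD('n))) * h (s *s homogeneous None w) \<partial>lborel) \<partial>lborel)"
proof -
  have meas: "(\<lambda>(s, w :: complex ^ 'n). ennreal (cmod s ^ (2 * CARD('n))) * h (s *s homogeneous None w))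
      \<in> borel_measurable (lborel \<Otimes>\<^sub>M lborel)"
    by measurable
  have "(\<integral>\<^sup>+z. h z \<partial>lborel) = (\<integral>\<^sup>+s. (\<integral>\<^sup>+w. h (join s w) \<partial>lborel) \<partial>lborel)"
    by (rule nn_integral_join) measurable
  also have "\<dots> = (\<integral>\<^sup>+s. (\<integral>\<^sup>+w. ennreal (cmod s ^ (2 * CARD('n))) * h (s *s homogeneous None w) \<partial>lborel) \<partial>lborel)"
  proof (rule nn_integral_cong_AE)
    show "AE s in lborel. (\<integral>\<^sup>+w. h (join s w) \<partial>lborel) =
      (\<integral>\<^sup>+w. ennreal (cmod s ^ (2 * CARD('n))) * h (s *s homogeneous None w) \<partial>lborel)"
      using AE_lborel_singleton[of "0::complex"]
    proof eventually_elim
      fix s :: complex assume "s \<noteq> 0"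
      then have "(\<integral>\<^sup>+w. h (join s w) \<partial>lborel) =
          ennreal (cmod s ^ (2 * CARD('n))) * (\<integral>\<^sup>+w. h (join s (s *s w)) \<partial>lborel)"
        by (rule nn_integral_lborel_smult) measurable
      then show "(\<integral>\<^sup>+w. h (join s w) \<partial>lborel) =
          (\<integral>\<^sup>+w. ennreal (cmod s ^ (2 * CARD('n))) * h (s *s homogeneous None w) \<partial>lborel)"
        by (subst nn_integral_cmult) (auto simp: smult_homogeneous_None)
    qed
  qed
  also have "\<dots> = (\<integral>\<^sup>+w. (\<integral>\<^sup>+s. ennreal (cmod s ^ (2 * CARD('n))) * h (s *s homogeneous None w) \<partial>lborel) \<partial>lborel)"
    using lborel_pair.Fubini'[OF meas] by simp
  finally show ?thesis .
qed

lemma norm_smult_homogeneous_None: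
  "(norm (s *s homogeneous None w))\<^sup>2 = (1 + (norm w)\<^sup>2) * (cmod s)\<^sup>2"
  by (simp add: power_mult_distrib power2_norm_homogeneous_None mult.commute)

text \<open>The constant is determined by comparing the total mass of the Gaussian on \<open>\<complex>\<^sup>n\<^sup>+\<^sup>1\<close> with its
  mass in the coordinates \<open>z = s (1, w)\<close>.\<close>

lemma nn_integral_complex_power_gaussian:
  assumes "a > 0"
  shows "(\<integral>\<^sup>+s. ennreal (cmod s ^ (2 * CARD('n::finite)) * exp (- a * (cmod s)\<^sup>2)) \<partial>lborel) =
    ennreal (pi * fact CARD('n) / a ^ (CARD('n) + 1))"
proof -
  let ?n = "CARD('n)"
  define J where "J = (\<integral>\<^sup>+s. ennreal (cmod s ^ (2 * ?n) * exp (- (cmod s)\<^sup>2)) \<partial>lborel)"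
  \<comment> \<open>Replacing \<open>s\<close> by \<open>s / sqrt a\<close> reduces every exponent
    to the single unknown constant \<open>J\<close>.\<close>
  have J: "(\<integral>\<^sup>+s. ennreal (cmod s ^ (2 * ?n) * exp (- a * (cmod s)\<^sup>2)) \<partial>lborel) = ennreal (1 / a ^ (?n + 1)) * J"
    if "a > 0" for a
  proof -
    have pow: "sqrt a ^ (2 * k) = a ^ k" for k using that by (simp add: power_mult)
    have "(\<integral>\<^sup>+s. ennreal (cmod s ^ (2 * ?n) * exp (- a * (cmod s)\<^sup>2)) \<partial>lborel) =
       ennreal ((1 / sqrt a) ^ 2) * (\<integral>\<^sup>+s. ennreal (cmod ((1 / sqrt a) *\<^sub>R s) ^ (2 * ?n) * exp (- a * (cmod ((1 / sqrt a) *\<^sub>R s))\<^sup>2)) \<partial>lborel)"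
      using that by (subst nn_integral_lborel_scale[of _ "1 / sqrt a"]) simp_all
    also have "(\<integral>\<^sup>+s. ennreal (cmod ((1 / sqrt a) *\<^sub>R s) ^ (2 * ?n) * exp (- a * (cmod ((1 / sqrt a) *\<^sub>R s))\<^sup>2)) \<partial>lborel) =
       (\<integral>\<^sup>+s. ennreal (1 / a ^ ?n) * ennreal (cmod s ^ (2 * ?n) * exp (- (cmod s)\<^sup>2)) \<partial>lborel)"
      using that by (intro nn_integral_cong) (simp add: ennreal_mult[symmetric] power_divide pow)
    also have "\<dots> = ennreal (1 / a ^ ?n) * J"
      unfolding J_def by (rule nn_integral_cmult) measurable
    finally show ?thesis
      using that by (simp add: mult.assoc[symmetric] ennreal_mult[symmetric] power_divide)
  qed
  have pos: "1 + (norm w)\<^sup>2 > 0" for w :: "complex ^ 'n" by (simp add: add_pos_nonneg)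
  have "ennreal (pi ^ (?n + 1)) = (\<integral>\<^sup>+z. ennreal (exp (- 1 * (norm (z :: complex ^ 'n option))\<^sup>2)) \<partial>lborel)"
    by (subst nn_integral_gaussian_complex) (simp_all add: card_UNIV_option)
  also have "\<dots> = (\<integral>\<^sup>+w. (\<integral>\<^sup>+s. ennreal (cmod s ^ (2 * ?n)) *
      ennreal (exp (- 1 * (norm (s *s homogeneous None (w :: complex ^ 'n)))\<^sup>2)) \<partial>lborel) \<partial>lborel)"
    by (rule nn_integral_cone) measurable
  also have "\<dots> = (\<integral>\<^sup>+w. (\<integral>\<^sup>+s. ennreal (cmod s ^ (2 * ?n) * exp (- (1 + (norm (w :: complex ^ 'n))\<^sup>2) * (cmod s)\<^sup>2)) \<partial>lborel) \<partial>lborel)"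
    by (simp only: norm_smult_homogeneous_None) (simp add: ennreal_mult mult.assoc algebra_simps)
  also have "\<dots> = (\<integral>\<^sup>+w. ennreal (1 / (1 + (norm (w :: complex ^ 'n))\<^sup>2) ^ (?n + 0 + 1)) * J \<partial>lborel)"
    unfolding J[OF pos] by simp
  also have "\<dots> = ennreal (pi ^ ?n / fact ?n) * J"
    by (subst nn_integral_multc) (simp_all only: nn_integral_radial_power, simp_all)
  finally have eq: "ennreal (pi ^ (?n + 1)) = ennreal (pi ^ ?n / fact ?n) * J" .
  have "J = ennreal (fact ?n / pi ^ ?n) * (ennreal (pi ^ ?n / fact ?n) * J)"
    by (simp add: mult.assoc[symmetric] ennreal_mult[symmetric])
  also have "\<dots> = ennreal (pi * fact ?n)"
    unfolding eq[symmetric] by (subst ennreal_mult[symmetric]) simp_all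
  finally show ?thesis
    unfolding J[OF assms] using assms by (simp add: ennreal_mult[symmetric])
qed

section \<open>Uniform distribution of phases\<close>

lemma nn_integral_cis_shift:
  fixes k :: "complex \<Rightarrow> ennreal"
  assumes [measurable]: "k \<in> borel_measurable borel"
  shows "(\<integral>\<^sup>+x. k (cis (2 * pi * x) * cis t) * indicator {0..<1} x \<partial>lborel) =
    (\<integral>\<^sup>+x. k (cis (2 * pi * x)) * indicator {0..<1} x \<partial>lborel)"
proof -
  \<comment> \<open>Only the fractional part of \<open>t / (2 * pi)\<close> matters. The shifted
    period sticks out beyond 1 by a piece of length \<open>y\<close>, which periodicity moves back
    to the start of the interval.\<close>
  define y where "y = frac (t / (2 * pi))"
  have y: "0 \<le> y" "y < 1" by (auto simp: y_def frac_lt_1)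
  have per: "cis (2 * pi * (x + of_int m)) = cis (2 * pi * x)" for x m
    by (simp add: distrib_left cis_mult[symmetric] cis_multiple_2pi)
  have "t = 2 * pi * (y + of_int \<lfloor>t / (2 * pi)\<rfloor>)"
    by (simp add: y_def frac_def)
  then have t: "cis t = cis (2 * pi * y)" using per by metis
  let ?k = "\<lambda>x. k (cis (2 * pi * x))"
  have "(\<integral>\<^sup>+x. k (cis (2 * pi * x) * cis t) * indicator {0..<1} x \<partial>lborel) =
    (\<integral>\<^sup>+x. ?k (y + x) * indicator {y..<1 + y} (y + x) \<partial>lborel)"
    by (intro nn_integral_cong) (auto simp: t cis_mult algebra_simps split: split_indicator)
  also have "\<dots> = (\<integral>\<^sup>+x. ?k x * indicator {y..<1 + y} x \<partial>lborel)"
    by (rule nn_integral_lborel_translation) measurable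
  also have "\<dots> = (\<integral>\<^sup>+x. ?k x * indicator {y..<1} x + ?k x * indicator {1..<1 + y} x \<partial>lborel)"
    using y by (intro nn_integral_cong) (auto split: split_indicator)
  also have "\<dots> = (\<integral>\<^sup>+x. ?k x * indicator {y..<1} x \<partial>lborel) + (\<integral>\<^sup>+x. ?k x * indicator {1..<1 + y} x \<partial>lborel)"
    by (rule nn_integral_add) measurable
  also have "(\<integral>\<^sup>+x. ?k x * indicator {1..<1 + y} x \<partial>lborel) = (\<integral>\<^sup>+x. ?k (1 + x) * indicator {1..<1 + y} (1 + x) \<partial>lborel)"
    by (rule nn_integral_lborel_translation[symmetric]) measurable
  also have "\<dots> = (\<integral>\<^sup>+x. ?k x * indicator {0..<y} x \<partial>lborel)"
    using per[of _ 1] by (intro nn_integral_cong) (auto simp: add.commute split: split_indicator)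
  also have "(\<integral>\<^sup>+x. ?k x * indicator {y..<1} x \<partial>lborel) + (\<integral>\<^sup>+x. ?k x * indicator {0..<y} x \<partial>lborel) =
     (\<integral>\<^sup>+x. ?k x * indicator {y..<1} x + ?k x * indicator {0..<y} x \<partial>lborel)"
    by (rule nn_integral_add[symmetric]) measurable
  also have "\<dots> = (\<integral>\<^sup>+x. ?k x * indicator {0..<1} x \<partial>lborel)"
    using y by (intro nn_integral_cong) (auto split: split_indicator)
  finally show ?thesis .
qed

text \<open>Rotating \<open>s\<close> by the angle 2 pi x / \<mu> changes neither Lebesgue measure
  nor \<open>q\<close>, and turns \<open>sgn s ^ \<mu>\<close> by 2 pi x. Averaging over
  \<open>x\<close> and exchanging the integrals shows that this phase is uniform and independent of
  the weight.\<close>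

lemma nn_integral_polar_average:
  fixes k :: "complex \<Rightarrow> ennreal" and q :: "complex \<Rightarrow> ennreal"
  assumes [measurable]: "k \<in> borel_measurable borel" "q \<in> borel_measurable borel"
    and \<mu>: "\<mu> \<ge> 1" and q: "\<And>c s. cmod c = 1 \<Longrightarrow> q (c * s) = q s"
  shows "(\<integral>\<^sup>+s. k (sgn s ^ \<mu>) * q s \<partial>lborel) =
    (\<integral>\<^sup>+s. q s \<partial>lborel) * (\<integral>\<^sup>+x. k (cis (2 * pi * x)) * indicator {0..<1} x \<partial>lborel)"
proof -
  let ?A = "(\<integral>\<^sup>+x. k (cis (2 * pi * x)) * indicator {0..<1} x \<partial>lborel)"
  have [measurable]: "(\<lambda>s::complex. sgn s) \<in> borel_measurable borel"
    unfolding sgn_div_norm by measurable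
  have rot: "(\<integral>\<^sup>+s. k (sgn s ^ \<mu>) * q s \<partial>lborel) = (\<integral>\<^sup>+s. k (cis (2 * pi * x) * sgn s ^ \<mu>) * q s \<partial>lborel)" for x
  proof -
    let ?c = "cis (2 * pi * x / \<mu>)"
    have "(\<integral>\<^sup>+s. k (sgn s ^ \<mu>) * q s \<partial>lborel) = (\<integral>\<^sup>+s. k (sgn (?c * s) ^ \<mu>) * q (?c * s) \<partial>lborel)"
      by (rule nn_integral_lborel_mult_unit[symmetric]) (simp, measurable)
    also have "\<dots> = (\<integral>\<^sup>+s. k (cis (2 * pi * x) * sgn s ^ \<mu>) * q s \<partial>lborel)"
    proof -
      have "?c ^ \<mu> = cis (2 * pi * x)" using \<mu> by (simp add: Complex.DeMoivre)
      then have "sgn (?c * s) ^ \<mu> = cis (2 * pi * x) * sgn s ^ \<mu>" for s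
        by (simp add: sgn_mult power_mult_distrib sgn_div_norm norm_mult)
      then show ?thesis by (simp add: q)
    qed
    finally show ?thesis .
  qed
  have meas: "(\<lambda>(x, s). (k (cis (2 * pi * x) * sgn s ^ \<mu>) * q s) * indicator {0..<1::real} x)
      \<in> borel_measurable (lborel \<Otimes>\<^sub>M lborel)"
    by measurable
  have "(\<integral>\<^sup>+s. k (sgn s ^ \<mu>) * q s \<partial>lborel) = (\<integral>\<^sup>+x. (\<integral>\<^sup>+s. k (sgn s ^ \<mu>) * q s \<partial>lborel) * indicator {0..<1::real} x \<partial>lborel)"
    by (subst nn_integral_cmult) auto
  also have "\<dots> = (\<integral>\<^sup>+x. (\<integral>\<^sup>+s. k (cis (2 * pi * x) * sgn s ^ \<mu>) * q s * indicator {0..<1::real} x \<partial>lborel) \<partial>lborel)"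
    by (intro nn_integral_cong) (subst rot, subst nn_integral_multc, measurable)
  also have "\<dots> = (\<integral>\<^sup>+s. (\<integral>\<^sup>+x. k (cis (2 * pi * x) * sgn s ^ \<mu>) * q s * indicator {0..<1::real} x \<partial>lborel) \<partial>lborel)"
    using lborel_pair.Fubini'[OF meas] by simp
  also have "\<dots> = (\<integral>\<^sup>+s. q s * ?A \<partial>lborel)"
  proof (rule nn_integral_cong_AE)
    show "AE s in lborel. (\<integral>\<^sup>+x. k (cis (2 * pi * x) * sgn s ^ \<mu>) * q s * indicator {0..<1::real} x \<partial>lborel) = q s * ?A"
      using AE_lborel_singleton[of "0::complex"]
    proof eventually_elim
      fix s :: complex assume "s \<noteq> 0"
      then have "sgn s ^ \<mu> = cis (\<mu> * Arg s)" by (simp add: cis_Arg Complex.DeMoivre flip: cis_Arg)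
      moreover have "(\<integral>\<^sup>+x. k (cis (2 * pi * x) * cis (\<mu> * Arg s)) * q s * indicator {0..<1::real} x \<partial>lborel) =
        (\<integral>\<^sup>+x. q s * (k (cis (2 * pi * x) * cis (\<mu> * Arg s)) * indicator {0..<1::real} x) \<partial>lborel)"
        by (intro nn_integral_cong) (simp add: mult_ac)
      moreover have "\<dots> = q s * ?A"
        by (subst nn_integral_cmult) (simp_all only: nn_integral_cis_shift[OF assms(1)], measurable)
      ultimately show "(\<integral>\<^sup>+x. k (cis (2 * pi * x) * sgn s ^ \<mu>) * q s * indicator {0..<1::real} x \<partial>lborel) = q s * ?A"
        by simp
    qed
  qed
  also have "\<dots> = (\<integral>\<^sup>+s. q s \<partial>lborel) * ?A"
    by (rule nn_integral_multc) measurable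
  finally show ?thesis .
qed

section \<open>The invariant measure\<close>

lemma det_replace_row_axis:
  fixes v :: "complex ^ 'n::finite"
  assumes "finite S" "i \<notin> S"
  shows "det (\<chi> j. if j = i then v else if j \<in> S then axis j 1 + u j *s v else axis j 1) = v $ i"
  using assms
proof (induction S)
  case empty
  have "row j (mat 1 :: complex ^ 'n ^ 'n) = axis j 1" for j
    by (auto simp: row_def mat_def axis_def vec_eq_iff)
  then have "det (\<chi> j. if j = i then \<Sum>j\<in>UNIV. v $ j *s axis j 1 else axis j 1) = v $ i * det (mat 1 :: complex ^ 'n ^ 'n)"
    using cramer_lemma_transpose[of i v "mat 1"] by (simp cong: if_cong)
  then show ?case by (simp add: basis_expansion cong: if_cong)
next
  case (insert k S)
  let ?c = "\<lambda>j. if j = i then v else if j \<in> S then axis j 1 + u j *s v else axis j 1"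
  have "det (\<chi> j. if j = i then v else if j \<in> insert k S then axis j 1 + u j *s v else axis j 1) =
    det (\<chi> j. if j = k then axis j 1 + u j *s v else ?c j)"
    using insert.prems by (intro arg_cong[where f = det]) (auto simp: vec_eq_iff)
  also have "\<dots> = det (\<chi> j. if j = k then axis j 1 else ?c j) + det (\<chi> j. if j = k then u j *s v else ?c j)"
    by (rule det_row_add)
  also have "det (\<chi> j. if j = k then u j *s v else ?c j) = u k * det (\<chi> j. if j = k then v else ?c j)"
    using det_row_mul[of k "u k" "\<lambda>_. v" ?c] by (simp cong: if_cong)
  also have "det (\<chi> j. if j = k then v else ?c j) = 0"
    by (rule det_identical_rows[of i k]) (use insert.prems in \<open>auto simp: row_def vec_eq_iff\<close>)
  also have "det (\<chi> j. if j = k then axis j 1 else ?c j) = det (\<chi> j. ?c j)"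
    using insert.hyps insert.prems by (intro arg_cong[where f = det]) (auto simp: vec_eq_iff)
  also have "\<dots> = v $ i" using insert by simp
  finally show ?case by simp
qed

text \<open>The matrix determinant lemma, adding the multiple of \<open>v\<close> to one row at a
  time. By multilinearity each new term has a row equal to \<open>v\<close>; that row clears the
  multiples of \<open>v\<close> in the others, and the coordinate \<open>v $ k\<close>
  remains.\<close>

lemma det_rank_one_update:
  fixes v :: "complex ^ 'n::finite"
  shows "det (\<chi> j. axis j 1 + u j *s v) = 1 + (\<Sum>j\<in>UNIV. u j * v $ j)"
proof -
  have "det (\<chi> j. if j \<in> S then axis j 1 + u j *s v else axis j 1) = 1 + (\<Sum>j\<in>S. u j * v $ j)"
    if "finite S" for S
    using that
  proof (induction S)
    case empty
    have "(\<chi> j. axis j 1) = (mat 1 :: complex ^ 'n ^ 'n)"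
      by (auto simp: mat_def axis_def vec_eq_iff)
    then show ?case by simp
  next
    case (insert k S)
    let ?c = "\<lambda>j. if j \<in> S then axis j 1 + u j *s v else axis j 1"
    have "det (\<chi> j. if j \<in> insert k S then axis j 1 + u j *s v else axis j 1) =
      det (\<chi> j. if j = k then axis j 1 + u j *s v else ?c j)"
      by (intro arg_cong[where f = det]) (auto simp: vec_eq_iff)
    also have "\<dots> = det (\<chi> j. if j = k then axis j 1 else ?c j) + det (\<chi> j. if j = k then u j *s v else ?c j)"
      by (rule det_row_add)
    also have "det (\<chi> j. if j = k then u j *s v else ?c j) = u k * det (\<chi> j. if j = k then v else ?c j)"
      using det_row_mul[of k "u k" "\<lambda>_. v" ?c] by (simp cong: if_cong)
    also have "det (\<chi> j. if j = k then v else ?c j) = v $ k"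
      using insert.hyps by (rule det_replace_row_axis)
    also have "(\<chi> j. if j = k then axis j 1 else ?c j) = (\<chi> j. ?c j)"
      using insert.hyps by (auto simp: vec_eq_iff)
    finally show ?case using insert by simp
  qed
  from this[of UNIV] show ?thesis by simp
qed

lemma inner_axis_one: "(w :: complex ^ 'n::finite) \<bullet> axis k 1 = Re (w $ k)"
  and inner_axis_ii: "w \<bullet> axis k \<i> = Im (w $ k)"
  by (simp_all add: inner_axis inner_complex_def)

lemma has_derivative_one_plus_norm_sq:
  "((\<lambda>w :: complex ^ 'n::finite. 1 + (norm w)\<^sup>2) has_derivative (\<lambda>v. 2 * (w \<bullet> v))) (at w)"
  unfolding power2_norm_eq_inner by (auto intro!: derivative_eq_intros simp: inner_commute)

lemma wirtinger_bar_log: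
  "wirtinger_bar (\<lambda>w. of_real (ln (1 + (norm w)\<^sup>2))) k w = w $ k / of_real (1 + (norm (w :: complex ^ 'n::finite))\<^sup>2)"
proof -
  let ?a = "1 + (norm w)\<^sup>2"
  have pos: "?a > 0" by (simp add: add_pos_nonneg)
  have "((\<lambda>w :: complex ^ 'n. complex_of_real (ln (1 + (norm w)\<^sup>2))) has_derivative
      (\<lambda>v. of_real (2 * (w \<bullet> v) / ?a))) (at w)"
    by (rule has_derivative_of_real) (rule has_derivative_ln[THEN has_derivative_eq_rhs, OF _ has_derivative_one_plus_norm_sq],
      use pos in \<open>auto simp: field_simps\<close>)
  then have der: "frechet_derivative (\<lambda>w :: complex ^ 'n. complex_of_real (ln (1 + (norm w)\<^sup>2))) (at w) =
      (\<lambda>v. of_real (2 * (w \<bullet> v) / ?a))"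
    by (rule frechet_derivative_at[symmetric])
  have alg: "(of_real (2 * Re z / a) + \<i> * of_real (2 * Im z / a)) / 2 = z / of_real a" for z :: complex and a
    by (simp add: complex_eq_iff)
  show ?thesis
    unfolding wirtinger_bar_def der inner_axis_one inner_axis_ii by (rule alg)
qed

text \<open>The antiholomorphic derivative of the potential is w_k / (1 + |w|^2), and the
  holomorphic derivative of |w|^2 in direction \<open>j\<close> is \<open>cnj (w $ j)\<close>; the
  rest is the quotient rule.\<close>

lemma fubini_study_eq:
  "fubini_study w $ j $ k =
    ((if j = k then 1 else 0) - cnj (w $ j) * w $ k / of_real (1 + (norm (w :: complex ^ 'n::finite))\<^sup>2)) /
      of_real (pi * (1 + (norm w)\<^sup>2))"
proof -
  let ?a = "1 + (norm w)\<^sup>2"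
  have pos: "?a > 0" by (simp add: add_pos_nonneg)
  have "((\<lambda>w :: complex ^ 'n. w $ k / of_real (1 + (norm w)\<^sup>2)) has_derivative
      (\<lambda>v. v $ k / of_real ?a - w $ k * of_real (2 * (w \<bullet> v)) / of_real (?a\<^sup>2))) (at w)"
  proof -
    have "((\<lambda>w :: complex ^ 'n. w $ k / of_real (1 + (norm w)\<^sup>2)) has_derivative
      (\<lambda>v. (v $ k * of_real ?a - w $ k * of_real (2 * (w \<bullet> v))) / (of_real ?a * of_real ?a))) (at w)"
      by (rule has_derivative_divide'[OF bounded_linear.has_derivative[OF bounded_linear_vec_nth has_derivative_ident]
            has_derivative_of_real[OF has_derivative_one_plus_norm_sq]])
        (metis of_real_eq_0_iff pos less_irrefl)
    then show ?thesis
      by (rule has_derivative_eq_rhs) (use pos in \<open>auto simp: fun_eq_iff diff_divide_distrib power2_eq_square\<close>)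
  qed
  then have der: "frechet_derivative (\<lambda>w :: complex ^ 'n. w $ k / of_real (1 + (norm w)\<^sup>2)) (at w) =
      (\<lambda>v. v $ k / of_real ?a - w $ k * of_real (2 * (w \<bullet> v)) / of_real (?a\<^sup>2))"
    by (rule frechet_derivative_at[symmetric])
  have "fubini_study w $ j $ k = wirtinger (\<lambda>w. w $ k / of_real (1 + (norm w)\<^sup>2)) j w / of_real pi"
    by (simp add: fubini_study_def wirtinger_bar_log[abs_def])
  also have "wirtinger (\<lambda>w. w $ k / of_real (1 + (norm w)\<^sup>2)) j w =
     (if j = k then 1 else 0) / of_real ?a - w $ k * cnj (w $ j) / of_real (?a\<^sup>2)"
  proof -
    have alg: "((d - W * of_real (2 * r)) - \<i> * (d * \<i> - W * of_real (2 * s))) / 2 = d - W * (of_real r - \<i> * of_real s)"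
      for d W :: complex and r s
    proof -
      have "(d - W * of_real (2 * r)) - \<i> * (d * \<i> - W * of_real (2 * s)) = 2 * (d - W * (of_real r - \<i> * of_real s))"
        by (simp add: algebra_simps)
      then show ?thesis by simp
    qed
    have cnj: "cnj z = of_real (Re z) - \<i> * of_real (Im z)" for z
      by (simp add: complex_eq_iff)
    have ax: "axis j 1 $ k = (if j = k then 1 else 0 :: complex)" "axis j \<i> $ k = (if j = k then 1 else 0) * \<i>"
      by (auto simp: axis_def)
    show ?thesis
      unfolding wirtinger_def der inner_axis_one inner_axis_ii ax cnj
      using alg[of "(if j = k then 1 else 0) / of_real ?a" "w $ k / of_real (?a\<^sup>2)"]
      by (simp only: times_divide_eq_left)
  qed
  also have "\<dots> / of_real pi = ((if j = k then 1 else 0) - cnj (w $ j) * w $ k / of_real ?a) / of_real (pi * ?a)"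
  proof -
    have alg: "(d / A - W * c / A\<^sup>2) / P = (d - c * W / A) / (P * A)" if "A \<noteq> 0" "P \<noteq> 0" for A P W c d :: complex
      using that by (simp add: field_simps power2_eq_square)
    have "complex_of_real ?a \<noteq> 0" using pos by (metis of_real_eq_0_iff less_irrefl)
    from alg[OF this, of "of_real pi"] show ?thesis
      by (simp only: of_real_power of_real_mult) simp
  qed
  finally show ?thesis .
qed

text \<open>Apart from a factor 1 / (pi (1 + |w|^2)) in each of the n rows, the matrix is the
  identity plus a rank one term. The latter determinant is 1 - |w|^2 / (1 + |w|^2), which supplies
  the last factor of the exponent n + 1.\<close>

lemma det_fubini_study:
  "det (fubini_study w) = of_real (1 / (pi ^ CARD('n) * (1 + (norm (w :: complex ^ 'n::finite))\<^sup>2) ^ (CARD('n) + 1)))"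
proof -
  let ?a = "1 + (norm w)\<^sup>2"
  have pos: "?a > 0" by (simp add: add_pos_nonneg)
  define u where "u = (\<lambda>j. - cnj (w $ j) / of_real ?a)"
  have "fubini_study w = (\<chi> j. (1 / of_real (pi * ?a)) *s (axis j 1 + u j *s w))"
  proof -
    have alg: "(d - c * W / A) / B = (1 / B) * (d + (- c / A) * W)" for A B W c d :: complex
      by (simp add: diff_divide_distrib)
    have ax: "axis j 1 $ k = (if j = k then 1 else 0 :: complex)" for j k :: 'n
      by (auto simp: axis_def)
    show ?thesis
      unfolding vec_eq_iff fubini_study_eq alg
      by (simp only: vec_lambda_beta vector_smult_component vector_add_component u_def ax) simp
  qed
  then have "det (fubini_study w) = (1 / of_real (pi * ?a)) ^ CARD('n) * det (\<chi> j. axis j 1 + u j *s w)"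
    by (simp only: det_rows_mul[of "\<lambda>_. 1 / complex_of_real (pi * ?a)"] prod_constant)
  also have "det (\<chi> j. axis j 1 + u j *s w) = 1 - (\<Sum>j\<in>UNIV. of_real ((cmod (w $ j))\<^sup>2)) / of_real ?a"
    unfolding det_rank_one_update u_def
    by (simp add: sum_negf sum_divide_distrib complex_norm_square mult.commute del: of_real_power of_real_add)
  also have "(\<Sum>j\<in>UNIV. of_real ((cmod (w $ j))\<^sup>2)) = complex_of_real ((norm w)\<^sup>2)"
    by (simp only: power2_norm_vec of_real_sum)
  also have "1 - complex_of_real ((norm w)\<^sup>2) / of_real ?a = of_real (1 / ?a)"
  proof -
    have "1 - (norm w)\<^sup>2 / ?a = 1 / ?a" using pos by (simp add: field_simps)
    then show ?thesis by (metis of_real_1 of_real_diff of_real_divide)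
  qed
  finally show ?thesis by (simp add: power_mult_distrib power_divide)
qed

lemma omega_power_eq:
  "(omega_power :: (complex ^ 'n::finite) measure) =
    density lborel (\<lambda>w. ennreal (fact CARD('n) / pi ^ CARD('n) / (1 + (norm w)\<^sup>2) ^ (CARD('n) + 1)))"
  unfolding omega_power_def det_fubini_study by (simp only: Re_complex_of_real) (simp add: divide_simps)

text \<open>The value at 0 is an arbitrary unit vector, so that the result has norm 1 and spans a
  line without exception.\<close>

definition unit_vec :: "complex ^ 'n::finite option \<Rightarrow> complex ^ 'n option" where
  "unit_vec z = (if z = 0 then axis None 1 else sgn z)"

definition gauss :: "(complex ^ 'n::finite option) measure" where
  "gauss = density lborel (\<lambda>z. ennreal (exp (- (norm z)\<^sup>2) / pi ^ (CARD('n) + 1)))"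

lemma sets_gauss [measurable_cong, simp]: "sets gauss = sets borel"
  and space_gauss [simp]: "space gauss = UNIV"
  by (simp_all add: gauss_def)

lemma norm_unit_vec [simp]: "norm (unit_vec z) = 1"
  by (simp add: unit_vec_def norm_sgn)

lemma unit_vec_nonzero [simp]: "unit_vec z \<noteq> 0"
  using norm_unit_vec[of z] by (metis norm_zero zero_neq_one)

lemma borel_measurable_unit_vec [measurable]: "unit_vec \<in> borel_measurable borel"
  unfolding unit_vec_def[abs_def] sgn_div_norm by measurable

lemma nn_integral_gauss:
  fixes h :: "complex ^ 'n::finite option \<Rightarrow> ennreal"
  assumes [measurable]: "h \<in> borel_measurable borel"
  shows "(\<integral>\<^sup>+z. h z \<partial>gauss) =
    (\<integral>\<^sup>+w. (\<integral>\<^sup>+s. h (s *s homogeneous None w) *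
       ennreal (cmod s ^ (2 * CARD('n)) * exp (- (1 + (norm w)\<^sup>2) * (cmod s)\<^sup>2) / pi ^ (CARD('n) + 1)) \<partial>lborel) \<partial>lborel)"
proof -
  have "(\<integral>\<^sup>+z. h z \<partial>gauss) = (\<integral>\<^sup>+z. ennreal (exp (- (norm z)\<^sup>2) / pi ^ (CARD('n) + 1)) * h z \<partial>lborel)"
    unfolding gauss_def by (rule nn_integral_density) auto
  also have "\<dots> = (\<integral>\<^sup>+w. (\<integral>\<^sup>+s. ennreal (cmod s ^ (2 * CARD('n))) *
      (ennreal (exp (- (norm (s *s homogeneous None w))\<^sup>2) / pi ^ (CARD('n) + 1)) * h (s *s homogeneous None w)) \<partial>lborel) \<partial>lborel)"
    by (rule nn_integral_cone) measurable
  also have "\<dots> = (\<integral>\<^sup>+w. (\<integral>\<^sup>+s. h (s *s homogeneous None w) *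
       ennreal (cmod s ^ (2 * CARD('n)) * exp (- (1 + (norm w)\<^sup>2) * (cmod s)\<^sup>2) / pi ^ (CARD('n) + 1)) \<partial>lborel) \<partial>lborel)"
  proof -
    have alg: "ennreal c * (ennreal (e / p) * H) = H * ennreal (c * e / p)" if "0 \<le> c" "0 \<le> e" "0 \<le> p" for c e p H
    proof -
      have "ennreal (c * e / p) = ennreal c * ennreal (e / p)"
        using that by (subst ennreal_mult[symmetric]) auto
      then show ?thesis by (simp only: mult_ac)
    qed
    show ?thesis
      unfolding norm_smult_homogeneous_None minus_mult_left by (intro nn_integral_cong alg) simp_all
  qed
  finally show ?thesis .
qed

text \<open>Integrating out \<open>s\<close> in the Gaussian leaves exactly the density found in
  \<open>omega_power_eq\<close>, constants included; this is what ties the Gaussian to the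
  Fubini-Study volume.\<close>

lemma nn_integral_circle_power_gauss:
  "(\<integral>\<^sup>+s. ennreal (cmod s ^ (2 * CARD('n)) * exp (- (1 + (norm w)\<^sup>2) * (cmod s)\<^sup>2) / pi ^ (CARD('n) + 1)) \<partial>lborel) =
    ennreal (fact CARD('n) / pi ^ CARD('n) / (1 + (norm (w :: complex ^ 'n::finite))\<^sup>2) ^ (CARD('n) + 1))"
proof -
  let ?n = "CARD('n)"
  have pos: "1 + (norm w)\<^sup>2 > 0" by (simp add: add_pos_nonneg)
  have "(\<integral>\<^sup>+s. ennreal (cmod s ^ (2 * ?n) * exp (- (1 + (norm w)\<^sup>2) * (cmod s)\<^sup>2) / pi ^ (?n + 1)) \<partial>lborel) =
    (\<integral>\<^sup>+s. ennreal (1 / pi ^ (?n + 1)) * ennreal (cmod s ^ (2 * ?n) * exp (- (1 + (norm w)\<^sup>2) * (cmod s)\<^sup>2)) \<partial>lborel)"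
    by (intro nn_integral_cong) (simp add: ennreal_mult[symmetric])
  also have "\<dots> = ennreal (1 / pi ^ (?n + 1)) * ennreal (pi * fact ?n / (1 + (norm w)\<^sup>2) ^ (?n + 1))"
    by (subst nn_integral_cmult) (simp_all only: nn_integral_complex_power_gaussian[OF pos], measurable)
  also have "\<dots> = ennreal (fact ?n / pi ^ ?n / (1 + (norm w)\<^sup>2) ^ (?n + 1))"
    using pos by (subst ennreal_mult[symmetric]) (simp_all add: less_imp_le)
  finally show ?thesis .
qed

lemma prob_space_gauss: "prob_space (gauss :: (complex ^ 'n::finite option) measure)"
proof
  have "emeasure gauss (space (gauss :: (complex ^ 'n option) measure)) =
    (\<integral>\<^sup>+z. ennreal (1 / pi ^ (CARD('n) + 1)) * ennreal (exp (- 1 * (norm (z :: complex ^ 'n option))\<^sup>2)) \<partial>lborel)"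
    by (simp add: gauss_def emeasure_density ennreal_mult[symmetric])
  also have "\<dots> = 1"
    by (subst nn_integral_cmult) (simp_all only: nn_integral_gaussian_complex[OF zero_less_one], auto simp: card_UNIV_option ennreal_mult[symmetric])
  finally show "emeasure gauss (space (gauss :: (complex ^ 'n option) measure)) = 1" .
qed

lemma borel_measurable_nth [measurable]:
  fixes f :: "'a \<Rightarrow> complex ^ 'm::finite"
  assumes "f \<in> borel_measurable M"
  shows "(\<lambda>x. f x $ i) \<in> borel_measurable M"
proof -
  have "(\<lambda>z :: complex ^ 'm. z $ i) \<in> borel_measurable borel"
    by (intro borel_measurable_continuous_onI continuous_intros)
  from measurable_compose[OF assms this] show ?thesis .
qed

lemma emeasure_distr_indicator:
  assumes "f \<in> measurable M N" "A \<in> sets N"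
  shows "emeasure (distr M N f) A = (\<integral>\<^sup>+x. indicator A (f x) \<partial>M)"
proof -
  have "(\<integral>\<^sup>+x. indicator A (f x) \<partial>M) = (\<integral>\<^sup>+y. indicator A y \<partial>distr M N f)"
    using assms by (intro nn_integral_distr[symmetric]) auto
  then show ?thesis using assms(2) by simp
qed

lemma borel_measurable_hprod [measurable]:
  assumes "f \<in> borel_measurable M"
  shows "(\<lambda>x. hprod (f x) v) \<in> borel_measurable M"
proof -
  have "(\<lambda>z. hprod z v) \<in> borel_measurable borel"
    unfolding hprod_def by (intro borel_measurable_continuous_onI continuous_intros)
  from measurable_compose[OF assms this] show ?thesis .
qed

lemma borel_measurable_cnj [measurable]:
  assumes "f \<in> borel_measurable M"
  shows "(\<lambda>x. cnj (f x)) \<in> borel_measurable M"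
proof -
  have "cnj \<in> borel_measurable borel"
    by (intro borel_measurable_continuous_onI continuous_intros)
  from measurable_compose[OF assms this] show ?thesis .
qed

text \<open>For z = s (1, w) the direction has squared modulus 1 / (1 + |w|^2) in the coordinate
  \<open>None\<close>. So the exponent of the density rises by \<open>m\<close>, and the radial
  integral gives n! m! / (n + m)!, a reciprocal binomial coefficient.\<close>

lemma nn_integral_gauss_moment:
  "(\<integral>\<^sup>+z. ennreal ((cmod (unit_vec z $ None)) ^ (2 * m)) \<partial>(gauss :: (complex ^ 'n::finite option) measure)) =
    ennreal (1 / real (CARD('n) + m choose CARD('n)))"
proof -
  let ?n = "CARD('n)"
  have "(\<integral>\<^sup>+z. ennreal ((cmod (unit_vec z $ None)) ^ (2 * m)) \<partial>(gauss :: (complex ^ 'n::finite option) measure)) =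
    (\<integral>\<^sup>+w. (\<integral>\<^sup>+s. ennreal ((cmod (unit_vec (s *s homogeneous None w) $ None)) ^ (2 * m)) *
       ennreal (cmod s ^ (2 * CARD('n)) * exp (- (1 + (norm (w :: complex ^ 'n))\<^sup>2) * (cmod s)\<^sup>2) / pi ^ (CARD('n) + 1)) \<partial>lborel) \<partial>lborel)"
    by (rule nn_integral_gauss) measurable
  also have "\<dots> = (\<integral>\<^sup>+w. ennreal (fact ?n / pi ^ ?n) * ennreal (1 / (1 + (norm (w :: complex ^ 'n))\<^sup>2) ^ (?n + m + 1)) \<partial>lborel)"
  proof (rule nn_integral_cong)
    fix w :: "complex ^ 'n"
    let ?a = "1 + (norm w)\<^sup>2"
    have pos: "?a > 0" by (simp add: add_pos_nonneg)
    have "(\<integral>\<^sup>+s. ennreal ((cmod (unit_vec (s *s homogeneous None w) $ None)) ^ (2 * m)) *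
        ennreal (cmod s ^ (2 * ?n) * exp (- ?a * (cmod s)\<^sup>2) / pi ^ (?n + 1)) \<partial>lborel) =
      (\<integral>\<^sup>+s. ennreal (1 / ?a ^ m) * ennreal (cmod s ^ (2 * ?n) * exp (- ?a * (cmod s)\<^sup>2) / pi ^ (?n + 1)) \<partial>lborel)"
    proof (rule nn_integral_cong_AE)
      have "(cmod (unit_vec (s *s homogeneous None w) $ None)) ^ (2 * m) = 1 / ?a ^ m" if "s \<noteq> 0" for s
      proof -
        have "cmod (unit_vec (s *s homogeneous None w) $ None) = 1 / norm (homogeneous None w)"
          using that by (simp add: unit_vec_def sgn_div_norm vec_eq_iff[of "s *s _"] norm_mult) (auto simp: field_simps homogeneous_def)
        then show ?thesis
          by (simp add: power_mult power_divide power2_norm_homogeneous_None)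
      qed
      then show "AE s in lborel. ennreal ((cmod (unit_vec (s *s homogeneous None w) $ None)) ^ (2 * m)) *
        ennreal (cmod s ^ (2 * ?n) * exp (- ?a * (cmod s)\<^sup>2) / pi ^ (?n + 1)) =
        ennreal (1 / ?a ^ m) * ennreal (cmod s ^ (2 * ?n) * exp (- ?a * (cmod s)\<^sup>2) / pi ^ (?n + 1))"
        using AE_lborel_singleton[of "0::complex"] by (auto elim!: eventually_mono)
    qed
    also have "\<dots> = ennreal (1 / ?a ^ m) * ennreal (fact ?n / pi ^ ?n / ?a ^ (?n + 1))"
      by (subst nn_integral_cmult) (simp_all only: nn_integral_circle_power_gauss, measurable)
    also have "\<dots> = ennreal (fact ?n / pi ^ ?n) * ennreal (1 / ?a ^ (?n + m + 1))"
      using pos by (simp add: ennreal_mult[symmetric] less_imp_le power_add)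
    finally show "(\<integral>\<^sup>+s. ennreal ((cmod (unit_vec (s *s homogeneous None w) $ None)) ^ (2 * m)) *
        ennreal (cmod s ^ (2 * ?n) * exp (- ?a * (cmod s)\<^sup>2) / pi ^ (?n + 1)) \<partial>lborel) =
        ennreal (fact ?n / pi ^ ?n) * ennreal (1 / ?a ^ (?n + m + 1))" .
  qed
  also have "\<dots> = ennreal (fact ?n / pi ^ ?n) * ennreal (pi ^ ?n * fact m / fact (?n + m))"
    by (subst nn_integral_cmult) (simp_all only: nn_integral_radial_power, measurable)
  also have "\<dots> = ennreal (1 / real (?n + m choose ?n))"
    by (subst ennreal_mult[symmetric]) (simp_all add: binomial_fact)
  finally show ?thesis .
qed

lemma space_circle_borel [simp]: "space (circle_borel \<mu>) = circle_bundle \<mu>"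
  unfolding circle_borel_def by (rule space_measure_of) auto

lemma sets_circle_measure [measurable_cong, simp]: "sets (circle_measure \<mu>) = sets (circle_borel \<mu>)"
  by (simp add: circle_measure_def)

lemma measurable_circle_borel:
  fixes f :: "'a \<Rightarrow> ('n::finite) bundle_point"
  assumes "\<And>x. x \<in> space M \<Longrightarrow> f x \<in> circle_bundle \<mu>"
    and "\<And>U. chart_open (bundle_chart \<mu>) U \<Longrightarrow> f -` U \<inter> space M \<in> sets M"
  shows "f \<in> measurable M (circle_borel \<mu>)"
  unfolding circle_borel_def
proof (rule measurable_measure_of)
  fix y :: "'n bundle_point set" assume "y \<in> {U \<inter> circle_bundle \<mu> |U. chart_open (bundle_chart \<mu>) U}"
  then obtain U where U: "y = U \<inter> circle_bundle \<mu>" "chart_open (bundle_chart \<mu>) U" by auto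
  have "f -` y \<inter> space M = f -` U \<inter> space M" using assms(1) U by auto
  then show "f -` y \<inter> space M \<in> sets M" using assms(2) U by simp
qed (use assms in auto)

text \<open>A map into \<open>circle_borel\<close> must land in the circle bundle everywhere. This
  is the identity on the unit circle and has modulus 1 at every other argument as well.\<close>

definition circle_unit :: "complex \<Rightarrow> complex" where
  "circle_unit c = (if c = 0 then 1 else sgn c)"

lemma norm_circle_unit [simp]: "cmod (circle_unit c) = 1"
  by (simp add: circle_unit_def norm_sgn)

lemma circle_unit_eq [simp]: "cmod c = 1 \<Longrightarrow> circle_unit c = c"
  by (auto simp: circle_unit_def sgn_div_norm)

lemma bundle_chart_in_circle_bundle:
  "bundle_chart \<mu> None (w, circle_unit c / of_real (norm (homogeneous None w) ^ \<mu>)) \<in> circle_bundle \<mu>"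
  by (simp add: circle_bundle_def bundle_norm_line_pt norm_divide norm_power bundle_chart_line_pt line_pt_in_total_space)

lemma measurable_bundle_chart [measurable]:
  fixes f :: "'a \<Rightarrow> complex ^ 'n::finite"
  assumes [measurable]: "f \<in> borel_measurable M" "g \<in> borel_measurable M"
  shows "(\<lambda>x. bundle_chart \<mu> None (f x, circle_unit (g x) / of_real (norm (homogeneous None (f x)) ^ \<mu>)))
    \<in> measurable M (circle_borel \<mu>)"
proof (rule measurable_circle_borel)
  fix U :: "'n bundle_point set" assume U: "chart_open (bundle_chart \<mu>) U"
  let ?h = "\<lambda>x. (f x, circle_unit (g x) / of_real (norm (homogeneous None (f x)) ^ \<mu>))"
  have [measurable]: "(\<lambda>x. circle_unit (g x)) \<in> borel_measurable M"
    unfolding circle_unit_def sgn_div_norm by measurable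
  have "?h \<in> borel_measurable M" by measurable
  moreover have "bundle_chart \<mu> None -` U \<in> sets borel"
    using U by (simp add: chart_open_def borel_open)
  ultimately have "?h -` (bundle_chart \<mu> None -` U) \<inter> space M \<in> sets M"
    by (rule measurable_sets)
  then show "(\<lambda>x. bundle_chart \<mu> None (?h x)) -` U \<inter> space M \<in> sets M"
    by (simp add: vimage_def)
qed (rule bundle_chart_in_circle_bundle)

lemma measurable_line_pt [measurable]:
  "(\<lambda>z. line_pt \<mu> (unit_vec (z :: complex ^ 'n::finite option)) 1) \<in> measurable borel (circle_borel \<mu>)"
proof (rule measurable_circle_borel)
  fix U :: "'n bundle_point set" assume U: "chart_open (bundle_chart \<mu>) U"
  have "{z. z \<noteq> 0 \<and> line_pt \<mu> z 1 \<in> U} \<in> sets borel"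
    using chart_open_vimage[OF U] by (rule borel_open)
  from measurable_sets[OF borel_measurable_unit_vec this]
  show "(\<lambda>z. line_pt \<mu> (unit_vec z) 1) -` U \<inter> space borel \<in> sets borel"
    by (simp add: vimage_def)
qed (simp add: line_pt_in_circle_bundle)

text \<open>The \<open>\<mu>\<close>-th tensor power multiplies the argument of \<open>s\<close> by
  \<open>\<mu>\<close>, so the angle in the fibre is that of \<open>sgn s ^ \<mu>\<close>.\<close>

lemma line_pt_unit_vec_cone:
  assumes "s \<noteq> 0"
  shows "line_pt \<mu> (unit_vec (s *s homogeneous None w)) 1 =
    bundle_chart \<mu> None (w, circle_unit (sgn s ^ \<mu>) / of_real (norm (homogeneous None w) ^ \<mu>))"
proof -
  have "unit_vec (s *s homogeneous None w) = (sgn s / of_real (norm (homogeneous None w))) *s homogeneous None w"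
    using assms by (simp add: unit_vec_def sgn_div_norm vec_eq_iff scaleR_conv_of_real[where 'a = complex]) (auto simp: field_simps homogeneous_def)
  moreover have "cmod (sgn s ^ \<mu>) = 1" using assms by (simp add: norm_power norm_sgn)
  ultimately show ?thesis
    using assms by (simp add: line_pt_smult bundle_chart_line_pt sgn_zero_iff power_divide)
qed

text \<open>Over each \<open>w\<close>, the Gaussian in cone coordinates is a rotation invariant
  weight in \<open>s\<close>. Its mass is the density of \<open>omega_power\<close>, and the phase
  \<open>sgn s ^ \<mu>\<close> is uniform with respect to it: these are the two factors of the
  product measure.\<close>

lemma circle_measure_eq:
  assumes "\<mu> \<ge> 1"
  shows "circle_measure \<mu> = distr (gauss :: (complex ^ 'n::finite option) measure) (circle_borel \<mu>) (\<lambda>z. line_pt \<mu> (unit_vec z) 1)"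
proof (rule measure_eqI)
  fix A assume "A \<in> sets (circle_measure \<mu> :: 'n bundle_point measure)"
  then have A [measurable]: "A \<in> sets (circle_borel \<mu>)" by simp
  let ?n = "CARD('n)"
  define k where "k = (\<lambda>w c. indicator A (bundle_chart \<mu> None (w :: complex ^ 'n, circle_unit c / of_real (norm (homogeneous None w) ^ \<mu>))) :: ennreal)"
  have k_meas [measurable]: "(\<lambda>p. k (fst p) (snd p)) \<in> borel_measurable (borel \<Otimes>\<^sub>M borel)"
    unfolding k_def by measurable
  have k1 [measurable]: "k w \<in> borel_measurable borel" for w unfolding k_def by measurable
  let ?q = "\<lambda>w s. ennreal (cmod s ^ (2 * ?n) * exp (- (1 + (norm (w :: complex ^ 'n))\<^sup>2) * (cmod s)\<^sup>2) / pi ^ (?n + 1))"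
  let ?d = "\<lambda>w. ennreal (fact ?n / pi ^ ?n / (1 + (norm (w :: complex ^ 'n))\<^sup>2) ^ (?n + 1))"
  let ?U = "uniform_measure lborel {0..2 * pi}"
  interpret U: prob_space ?U by (rule prob_space_uniform_measure) auto
  have F: "(\<lambda>(w, \<theta>). bundle_chart \<mu> None (w, cis \<theta> / of_real (norm (homogeneous None w) ^ \<mu>)))
      = (\<lambda>p. bundle_chart \<mu> None (fst p, circle_unit (cis (snd p)) / of_real (norm (homogeneous None (fst p)) ^ \<mu>)))"
    by auto
  have [measurable_cong]: "sets (omega_power :: (complex ^ 'n) measure) = sets borel" by (simp add: omega_power_def)
  have "emeasure (circle_measure \<mu>) A = (\<integral>\<^sup>+p. k (fst p) (cis (snd p)) \<partial>(omega_power \<Otimes>\<^sub>M ?U))"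
    unfolding circle_measure_def F k_def by (rule emeasure_distr_indicator) measurable
  also have "\<dots> = (\<integral>\<^sup>+w. (\<integral>\<^sup>+\<theta>. k w (cis \<theta>) \<partial>?U) \<partial>omega_power)"
  proof -
    have "(\<lambda>p. k (fst p) (cis (snd p))) \<in> borel_measurable (omega_power \<Otimes>\<^sub>M ?U)"
      unfolding k_def by measurable
    from U.nn_integral_fst[OF this] show ?thesis by simp
  qed
  also have "\<dots> = (\<integral>\<^sup>+w. ?d w * (\<integral>\<^sup>+\<theta>. k w (cis \<theta>) \<partial>?U) \<partial>lborel)"
    unfolding omega_power_eq k_def by (rule nn_integral_density) measurable
  also have "\<dots> = (\<integral>\<^sup>+w. (\<integral>\<^sup>+s. k w (sgn s ^ \<mu>) * ?q w s \<partial>lborel) \<partial>lborel)"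
  proof (rule nn_integral_cong)
    fix w :: "complex ^ 'n"
    \<comment> \<open>Writing the angle as 2 pi x cancels the normalization of the uniform measure;
      passing to the half-open unit interval discards one point.\<close>
    have "(\<integral>\<^sup>+\<theta>. k w (cis \<theta>) \<partial>?U) = (\<integral>\<^sup>+\<theta>. k w (cis \<theta>) * indicator {0..2 * pi} \<theta> \<partial>lborel) / ennreal (2 * pi)"
      by (subst nn_integral_uniform_measure) auto
    also have "(\<integral>\<^sup>+\<theta>. k w (cis \<theta>) * indicator {0..2 * pi} \<theta> \<partial>lborel) =
      ennreal (2 * pi) * (\<integral>\<^sup>+x. k w (cis (2 * pi * x)) * indicator {0..2 * pi} (2 * pi * x) \<partial>lborel)"
      using nn_integral_real_affine[of "\<lambda>\<theta>. k w (cis \<theta>) * indicator {0..2 * pi} \<theta>" "2 * pi" 0] by simp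
    also have "(\<integral>\<^sup>+x. k w (cis (2 * pi * x)) * indicator {0..2 * pi} (2 * pi * x) \<partial>lborel) =
      (\<integral>\<^sup>+x. k w (cis (2 * pi * x)) * indicator {0..<1} x \<partial>lborel)"
    proof (rule nn_integral_cong_AE)
      show "AE x in lborel. k w (cis (2 * pi * x)) * indicator {0..2 * pi} (2 * pi * x) = k w (cis (2 * pi * x)) * indicator {0..<1} x"
        using AE_lborel_singleton[of "1::real"]
        by eventually_elim (auto simp: zero_le_mult_iff pi_gt_zero[unfolded not_le[symmetric]] split: split_indicator)
    qed
    finally have avg: "(\<integral>\<^sup>+\<theta>. k w (cis \<theta>) \<partial>?U) = (\<integral>\<^sup>+x. k w (cis (2 * pi * x)) * indicator {0..<1} x \<partial>lborel)"
      by (simp add: ennreal_mult_divide_eq mult.commute[of "ennreal (2 * pi)"])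
    have "(\<integral>\<^sup>+s. k w (sgn s ^ \<mu>) * ?q w s \<partial>lborel) = (\<integral>\<^sup>+s. ?q w s \<partial>lborel) * (\<integral>\<^sup>+x. k w (cis (2 * pi * x)) * indicator {0..<1} x \<partial>lborel)"
      by (rule nn_integral_polar_average[OF _ _ assms]) (auto simp: norm_mult)
    then show "?d w * (\<integral>\<^sup>+\<theta>. k w (cis \<theta>) \<partial>?U) = (\<integral>\<^sup>+s. k w (sgn s ^ \<mu>) * ?q w s \<partial>lborel)"
      by (simp only: nn_integral_circle_power_gauss avg)
  qed
  also have "\<dots> = (\<integral>\<^sup>+w. (\<integral>\<^sup>+s. indicator A (line_pt \<mu> (unit_vec (s *s homogeneous None w)) 1) * ?q w s \<partial>lborel) \<partial>lborel)"
  proof (rule nn_integral_cong, rule nn_integral_cong_AE)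
    fix w :: "complex ^ 'n"
    show "AE s in lborel. k w (sgn s ^ \<mu>) * ?q w s = indicator A (line_pt \<mu> (unit_vec (s *s homogeneous None w)) 1) * ?q w s"
      using AE_lborel_singleton[of "0::complex"]
      by eventually_elim (simp add: line_pt_unit_vec_cone k_def)
  qed
  also have "\<dots> = (\<integral>\<^sup>+z. indicator A (line_pt \<mu> (unit_vec z) 1) \<partial>(gauss :: (complex ^ 'n option) measure))"
    by (rule nn_integral_gauss[symmetric]) measurable
  also have "\<dots> = emeasure (distr (gauss :: (complex ^ 'n option) measure) (circle_borel \<mu>) (\<lambda>z. line_pt \<mu> (unit_vec z) 1)) A"
    by (rule emeasure_distr_indicator[symmetric]) measurable
  finally show "emeasure (circle_measure \<mu>) A =
    emeasure (distr (gauss :: (complex ^ 'n option) measure) (circle_borel \<mu>) (\<lambda>z. line_pt \<mu> (unit_vec z) 1)) A" .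
qed simp

section \<open>Averaging over rotations\<close>

abbreviation unit_interval :: "real measure" where
  "unit_interval \<equiv> restrict_space lborel {0..1}"

lemma prob_space_unit_interval: "prob_space unit_interval"
  by (rule prob_spaceI) (simp add: space_restrict_space emeasure_restrict_space)

text \<open>Cauchy's formula for the \<open>k\<close>-th derivative on the unit circle itself, for
  which continuity up to the circle suffices; division by 2 pi i turns the contour integral into a
  Fourier coefficient.\<close>

lemma integral_circle_coefficient:
  assumes "continuous_on (cball 0 1) h" "h holomorphic_on ball 0 1"
  shows "(\<integral>x. h (cis (2 * pi * x)) * cis (- (2 * pi * k * x)) \<partial>unit_interval) = (deriv ^^ k) h 0 / fact k"
proof -
  let ?F = "\<lambda>x. h (cis (2 * pi * x)) * cis (- (2 * pi * k * x))"
  have "((\<lambda>u. h u / (u - 0) ^ Suc k) has_contour_integral (2 * pi * \<i> / fact k * (deriv ^^ k) h 0)) (circlepath 0 1)"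
    by (rule Cauchy_has_contour_integral_higher_derivative_circlepath) (use assms in auto)
  then have "((\<lambda>x. h (circlepath 0 1 x) / (circlepath 0 1 x - 0) ^ Suc k * vector_derivative (circlepath 0 1) (at x within {0..1}))
      has_integral (2 * pi * \<i> / fact k * (deriv ^^ k) h 0)) {0..1}"
    unfolding has_contour_integral_def .
  then have "((\<lambda>x. 1 / (2 * pi * \<i>) * (h (circlepath 0 1 x) / (circlepath 0 1 x - 0) ^ Suc k * vector_derivative (circlepath 0 1) (at x within {0..1})))
      has_integral (1 / (2 * pi * \<i>) * (2 * pi * \<i> / fact k * (deriv ^^ k) h 0))) {0..1}"
    by (rule has_integral_mult_right)
  then have "(?F has_integral ((deriv ^^ k) h 0 / fact k)) {0..1}"
  proof (rule has_integral_eq_rhs[OF has_integral_eq, rotated])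
    fix x :: real assume x: "x \<in> {0..1}"
    have c: "circlepath 0 1 x = cis (2 * pi * x)"
      by (simp add: circlepath cis_conv_exp mult_ac)
    have "vector_derivative (circlepath 0 1) (at x within {0..1}) = 2 * pi * \<i> * cis (2 * pi * x)"
      using x vector_derivative_circlepath01[of x 0 1] by (simp add: cis_conv_exp mult_ac)
    moreover have "1 / cis (2 * pi * x) ^ Suc k * cis (2 * pi * x) = cis (- (2 * pi * k * x))"
      by (simp add: Complex.DeMoivre cis_divide[symmetric] divide_simps cis_mult)
    ultimately show "1 / (2 * pi * \<i>) * (h (circlepath 0 1 x) / (circlepath 0 1 x - 0) ^ Suc k * vector_derivative (circlepath 0 1) (at x within {0..1})) = ?F x"
      unfolding c by (simp add: divide_simps)
  qed simp
  moreover have "continuous_on {0..1} ?F"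
    by (intro continuous_intros continuous_on_compose2[OF assms(1)]) auto
  then have "set_integrable lborel {0..1} ?F" by (rule borel_integrable_atLeastAtMost')
  then have "set_lebesgue_integral lborel {0..1} ?F = integral {0..1} ?F"
    by (rule set_borel_integral_eq_integral)
  ultimately show ?thesis
    by (simp add: integral_restrict_space set_lebesgue_integral_def integral_unique)
qed

lemma distr_gauss_isometry:
  fixes f :: "complex ^ 'n::finite option \<Rightarrow> complex ^ 'n option"
  assumes "linear f" "\<And>z. norm (f z) = norm z"
  shows "distr gauss borel f = gauss"
proof (rule measure_eqI)
  have [measurable]: "f \<in> borel_measurable borel"
    using assms(1) by (rule linear_borel_measurable)
  let ?d = "\<lambda>z :: complex ^ 'n option. ennreal (exp (- (norm z)\<^sup>2) / pi ^ (CARD('n) + 1))"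
  fix A assume "A \<in> sets (distr (gauss :: (complex ^ 'n option) measure) borel f)"
  then have [measurable]: "A \<in> sets borel" by simp
  have "emeasure (distr gauss borel f) A = (\<integral>\<^sup>+z. indicator A (f z) \<partial>gauss)"
    by (rule emeasure_distr_indicator) measurable
  also have "\<dots> = (\<integral>\<^sup>+z. ?d (f z) * indicator A (f z) \<partial>lborel)"
    unfolding gauss_def assms(2) by (rule nn_integral_density) measurable
  also have "\<dots> = (\<integral>\<^sup>+z. ?d z * indicator A z \<partial>lborel)"
    by (rule nn_integral_lborel_isometry[OF assms linear_isometry_surj[OF assms]]) measurable
  also have "\<dots> = emeasure gauss A"
    unfolding gauss_def by (rule emeasure_density[symmetric]) auto
  finally show "emeasure (distr gauss borel f) A = emeasure gauss A" .
qed simp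

lemma measurable_unit_interval: "(\<lambda>x. x) \<in> borel_measurable unit_interval"
  by (rule measurable_restrict_space1) simp

lemma borel_measurable_average:
  fixes A :: "real \<Rightarrow> complex ^ 'n::finite option \<Rightarrow> complex ^ 'n option" and H :: "_ \<Rightarrow> complex"
  assumes "H \<in> borel_measurable borel" "(\<lambda>p. A (fst p) (snd p)) \<in> borel_measurable (borel \<Otimes>\<^sub>M borel)"
  shows "(\<lambda>(x, z). H (A x z)) \<in> borel_measurable (unit_interval \<Otimes>\<^sub>M gauss)"
    and "(\<lambda>z. \<integral>x. H (A x z) \<partial>unit_interval) \<in> borel_measurable gauss"
proof -
  interpret G: prob_space "gauss :: (complex ^ 'n option) measure" by (rule prob_space_gauss)
  interpret U: prob_space unit_interval by (rule prob_space_unit_interval)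
  interpret P: pair_sigma_finite unit_interval "gauss :: (complex ^ 'n option) measure" ..
  have "(\<lambda>p. (fst p, snd p)) \<in> measurable (unit_interval \<Otimes>\<^sub>M (gauss :: (complex ^ 'n option) measure)) (borel \<Otimes>\<^sub>M borel)"
    by (intro measurable_Pair measurable_compose[OF measurable_fst measurable_unit_interval]) measurable
  from measurable_compose[OF measurable_compose[OF this assms(2)] assms(1)]
  show *: "(\<lambda>(x, z). H (A x z)) \<in> borel_measurable (unit_interval \<Otimes>\<^sub>M gauss)"
    by (simp add: case_prod_unfold)
  show "(\<lambda>z. \<integral>x. H (A x z) \<partial>unit_interval) \<in> borel_measurable gauss"
    using measurable_pair_swap[OF *] by (intro U.borel_measurable_lebesgue_integral) (simp add: case_prod_unfold)
qed

text \<open>Every \<open>A x\<close> preserves the Gaussian, so the integral equals its own mean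
  over \<open>x\<close>; boundedness on a probability space justifies the exchange of
  integrals.\<close>

lemma integral_gauss_average:
  fixes A :: "real \<Rightarrow> complex ^ 'n::finite option \<Rightarrow> complex ^ 'n option" and H :: "_ \<Rightarrow> complex"
  assumes [measurable]: "H \<in> borel_measurable borel" and bd: "\<And>z. cmod (H z) \<le> B"
    and [measurable]: "(\<lambda>p. A (fst p) (snd p)) \<in> borel_measurable (borel \<Otimes>\<^sub>M borel)"
    and A: "\<And>x. linear (A x)" "\<And>x z. norm (A x z) = norm z"
  shows "(\<integral>z. H z \<partial>gauss) = (\<integral>z. (\<integral>x. H (A x z) \<partial>unit_interval) \<partial>gauss)"
proof -
  interpret G: prob_space "gauss :: (complex ^ 'n option) measure" by (rule prob_space_gauss)
  interpret U: prob_space unit_interval by (rule prob_space_unit_interval)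
  interpret P: pair_prob_space unit_interval "gauss :: (complex ^ 'n option) measure" ..
  have [measurable]: "A x \<in> borel_measurable borel" for x
    using A(1) by (rule linear_borel_measurable)
  have meas: "(\<lambda>(x, z). H (A x z)) \<in> borel_measurable (unit_interval \<Otimes>\<^sub>M gauss)"
    by (rule borel_measurable_average) (use assms in auto)
  have int: "integrable (unit_interval \<Otimes>\<^sub>M gauss) (\<lambda>(x, z). H (A x z))"
    by (rule P.integrable_const_bound[OF _ meas, of B]) (use bd in \<open>auto simp: case_prod_unfold\<close>)
  have "(\<integral>z. H z \<partial>gauss) = (\<integral>z. H (A x z) \<partial>gauss)" for x
  proof -
    have "(\<integral>z. H z \<partial>gauss) = (\<integral>z. H z \<partial>distr gauss borel (A x))"
      by (simp add: distr_gauss_isometry[OF A])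
    also have "\<dots> = (\<integral>z. H (A x z) \<partial>gauss)"
      by (rule integral_distr) measurable
    finally show ?thesis .
  qed
  then have "(\<integral>z. H z \<partial>gauss) = (\<integral>x. (\<integral>z. H (A x z) \<partial>gauss) \<partial>unit_interval)"
    using U.prob_space by simp
  also have "\<dots> = (\<integral>z. (\<integral>x. H (A x z) \<partial>unit_interval) \<partial>gauss)"
    by (rule P.Fubini_integral[OF int, symmetric])
  finally show ?thesis .
qed

text \<open>The default value of \<open>unit_vec\<close> at 0 need not be respected by
  \<open>f\<close>; the point 0 is excluded here and dropped as a null set wherever this is
  applied.\<close>

lemma unit_vec_isometry:
  assumes "linear f" "\<And>z. norm (f z) = norm z" "z \<noteq> 0"
  shows "unit_vec (f z) = f (unit_vec z)"
  using assms by (auto simp: unit_vec_def sgn_div_norm linear_cmul) (metis norm_eq_zero)+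

lemma AE_gauss_nonzero: "AE z in (gauss :: (complex ^ 'n::finite option) measure). z \<noteq> 0"
proof -
  have *: "AE z in lborel. z \<noteq> (0 :: complex ^ 'n option)" by (rule AE_lborel_singleton)
  show ?thesis unfolding gauss_def by (subst AE_density) (use * in \<open>auto elim: eventually_mono\<close>)
qed

text \<open>Pythagoras for the splitting along \<open>v\<close>. A scalar of modulus 1 gives an
  isometry, a scalar of modulus at most 1 does not increase the norm.\<close>

lemma norm_projection:
  assumes "norm v = 1"
  shows "(norm (hprod z v *s v + c *s (z - hprod z v *s v)))\<^sup>2 =
    (cmod (hprod z v))\<^sup>2 + (cmod c)\<^sup>2 * ((norm z)\<^sup>2 - (cmod (hprod z v))\<^sup>2)"
proof -
  define q where "q = hprod z v"
  have vv: "hprod v v = 1" using assms by (simp add: hprod_self)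
  have vz: "hprod v z = cnj q" by (simp add: q_def hprod_commute[of v z])
  have zz: "hprod z z = of_real ((norm z)\<^sup>2)" by (rule hprod_self)
  have "complex_of_real ((norm (q *s v + c *s (z - q *s v)))\<^sup>2) =
      q * cnj q + c * cnj c * (of_real ((norm z)\<^sup>2) - q * cnj q)"
    unfolding hprod_self[symmetric]
    by (simp add: hprod_add_left hprod_add_right hprod_diff_left hprod_diff_right hprod_smult_left hprod_smult_right
        vv vz q_def[symmetric] algebra_simps)
  also have "\<dots> = of_real ((cmod q)\<^sup>2 + (cmod c)\<^sup>2 * ((norm z)\<^sup>2 - (cmod q)\<^sup>2))"
    by (simp only: complex_norm_square of_real_add of_real_mult of_real_diff)
  finally show ?thesis unfolding q_def of_real_eq_iff .
qed

text \<open>A complex reflection exchanges the line of \<open>v\<close> and the line of a basis vector.\<close>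

lemma exists_unitary_to_axis:
  fixes v :: "complex ^ 'n::finite option"
  assumes v: "norm v = 1"
  shows "\<exists>f :: complex ^ 'n option \<Rightarrow> complex ^ 'n option. linear f \<and> (\<forall>z. norm (f z) = norm z) \<and> (\<forall>z. cmod (hprod (f z) v) = cmod (z $ None))"
proof -
  define e :: "complex ^ 'n option" where "e = axis None 1"
  \<comment> \<open>Removing the phase of \<open>v $ None\<close> makes \<open>hprod v' e\<close>
    real; without this the reflection along \<open>v' - e\<close> would not exchange
    \<open>v'\<close> and \<open>e\<close>.\<close>
  define \<alpha> where "\<alpha> = (if v $ None = 0 then 1 else sgn (v $ None))"
  define v' where "v' = inverse \<alpha> *s v"
  define a where "a = v' - e"
  define d where "d = hprod a a"
  \<comment> \<open>For \<open>d = 0\<close> the quotient is 0 by convention and \<open>f\<close> is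
    the identity, as it should be since then \<open>v' = e\<close>.\<close>
  define f where "f = (\<lambda>z. z - (2 * hprod z a / d) *s a)"
  have \<alpha>: "cmod \<alpha> = 1" "\<alpha> \<noteq> 0" by (auto simp: \<alpha>_def norm_sgn sgn_zero_iff)
  have nv': "norm v' = 1" using v \<alpha> by (simp add: v'_def norm_inverse)
  have ne: "norm e = 1" by (simp add: e_def)
  have real: "hprod v' e = of_real (cmod (v $ None))"
    unfolding e_def hprod_axis v'_def
    by (cases "v $ None = 0") (auto simp: \<alpha>_def sgn_div_norm scaleR_conv_of_real)
  then have real': "hprod e v' = hprod v' e" by (simp add: hprod_commute[of e v'])
  have d_real: "d = of_real ((norm a)\<^sup>2)" by (simp add: d_def hprod_self)
  have d: "d = 2 - 2 * hprod v' e"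
    unfolding d_def a_def hprod_diff_left hprod_diff_right real' by (simp add: hprod_self nv' ne)
  have f_hprod: "hprod (f z) (f z) = hprod z z" for z
  proof (cases "d = 0")
    case False
    have "cnj d = d" by (simp add: d_real)
    moreover have "hprod a z = cnj (hprod z a)" by (rule hprod_commute)
    ultimately show ?thesis
      using False by (simp add: f_def hprod_diff_left hprod_diff_right hprod_smult_left hprod_smult_right d_def[symmetric] field_simps)
  qed (simp add: f_def)
  have nrm: "norm (f z) = norm z" for z
    using f_hprod[of z] by (simp add: hprod_self power2_eq_iff_nonneg flip: of_real_power)
  have lin: "linear f"
    unfolding f_def by (rule linearI) (simp_all add: hprod_add_left hprod_scaleR_left vec_eq_iff algebra_simps add_divide_distrib scaleR_conv_of_real[where 'a = complex])
  moreover have "cmod (hprod (f z) v) = cmod (z $ None)" for z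
  proof -
    have "hprod (f z) v' = hprod z e"
    proof (cases "d = 0")
      case True
      then have "a = 0" by (simp add: d_real)
      then show ?thesis by (simp add: f_def a_def)
    next
      case False
      have "2 * hprod a v' = d"
        unfolding d a_def hprod_diff_left real' by (simp add: hprod_self nv')
      then have "hprod (f z) v' = hprod z v' - hprod z a"
        using False by (simp add: f_def hprod_diff_left hprod_smult_left field_simps)
      then show ?thesis by (simp add: a_def hprod_diff_right)
    qed
    moreover have "hprod (f z) v = cnj \<alpha> * hprod (f z) v'"
      using \<alpha> by (simp add: v'_def hprod_smult_right)
    ultimately show ?thesis using \<alpha> by (simp add: norm_mult e_def hprod_axis)
  qed
  ultimately show ?thesis using lin nrm by blast
qed

lemma integral_gauss_moment:
  fixes v :: "complex ^ 'n::finite option"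
  assumes "norm v = 1"
  shows "(\<integral>z. cmod (hprod (unit_vec z) v) ^ (2 * m) \<partial>gauss) = 1 / real (CARD('n) + m choose CARD('n))"
proof -
  obtain f :: "complex ^ 'n option \<Rightarrow> complex ^ 'n option" where f: "linear f" "\<And>z. norm (f z) = norm z" "\<And>z. cmod (hprod (f z) v) = cmod (z $ None)"
    using exists_unitary_to_axis[OF assms] by blast
  have [measurable]: "f \<in> borel_measurable borel"
    using f(1) by (rule linear_borel_measurable)
  have "(\<integral>z. cmod (hprod (unit_vec z) v) ^ (2 * m) \<partial>gauss) = (\<integral>z. cmod (hprod (unit_vec z) v) ^ (2 * m) \<partial>distr gauss borel f)"
    by (simp add: distr_gauss_isometry[OF f(1,2)])
  also have "\<dots> = (\<integral>z. cmod (hprod (unit_vec (f z)) v) ^ (2 * m) \<partial>gauss)"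
    by (rule integral_distr) measurable
  also have "\<dots> = (\<integral>z. cmod (unit_vec z $ None) ^ (2 * m) \<partial>(gauss :: (complex ^ 'n option) measure))"
  proof (rule integral_cong_AE)
    show "AE z in gauss. cmod (hprod (unit_vec (f z)) v) ^ (2 * m) = cmod (unit_vec z $ None) ^ (2 * m)"
      using AE_gauss_nonzero by eventually_elim (simp add: unit_vec_isometry[OF f(1,2)] f(3))
  qed measurable
  also have "\<dots> = 1 / real (CARD('n) + m choose CARD('n))"
  proof -
    have "(\<lambda>z. cmod (unit_vec z $ None) ^ (2 * m)) \<in> borel_measurable (gauss :: (complex ^ 'n option) measure)"
      by measurable
    from integral_eq_nn_integral[OF this] show ?thesis by (simp add: nn_integral_gauss_moment)
  qed
  finally show ?thesis .
qed

section \<open>Restriction of holomorphic functions to complex lines and fibres\<close>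

lemma has_derivative_vec_lambda:
  fixes F :: "'i::finite \<Rightarrow> 'a::real_normed_vector \<Rightarrow> 'b::euclidean_space"
  assumes "\<And>k. (F k has_derivative F' k) (at x)"
  shows "((\<lambda>x. \<chi> k. F k x) has_derivative (\<lambda>h. \<chi> k. F' k h)) (at x)"
proof (subst has_derivative_componentwise_within, rule ballI)
  fix i :: "'b ^ 'i" assume "i \<in> Basis"
  then obtain k b where "i = axis k b" by (auto simp: Basis_vec_def)
  then show "((\<lambda>x. (\<chi> k. F k x) \<bullet> i) has_derivative (\<lambda>h. (\<chi> k. F' k h) \<bullet> i)) (at x)"
    by (simp add: inner_axis has_derivative_inner_left assms)
qed

text \<open>In a chart whose coordinate is nonzero at \<open>z0\<close>, the path is a tuple of
  functions with complex derivatives. The chain rule then yields a complex derivative because the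
  derivative of \<open>f\<close> is complex linear.\<close>

lemma field_differentiable_line_pt:
  fixes f :: "('n::finite) bundle_point \<Rightarrow> complex"
  assumes holo: "holomorphic_on_disc \<mu> f" and \<tau>: "\<tau> field_differentiable at z0"
    and nz: "a + z0 *s b \<noteq> 0" and disc: "line_pt \<mu> (a + z0 *s b) (\<tau> z0) \<in> disc_bundle \<mu>"
  shows "(\<lambda>z. f (line_pt \<mu> (a + z *s b) (\<tau> z))) field_differentiable at z0"
proof -
  obtain j where j: "(a + z0 *s b) $ j \<noteq> 0" using nz by (auto simp: vec_eq_iff)
  define W where "W = (\<lambda>z. affine_coord j (a + z *s b))"
  define T where "T = (\<lambda>z. \<tau> z * ((a + z *s b) $ j) ^ \<mu>)"
  have chart: "line_pt \<mu> (a + z *s b) (\<tau> z) = bundle_chart \<mu> j (W z, T z)" if "(a + z *s b) $ j \<noteq> 0" for z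
    using that by (simp only: W_def T_def line_pt_chart)
  have "\<exists>d. ((\<lambda>z. W z $ k) has_field_derivative d) (at z0)" for k
  proof -
    have "(\<lambda>z. (a $ i + z * b $ i) / (a $ j + z * b $ j)) field_differentiable at z0" for i
      using j by (intro field_differentiable_divide field_differentiable_add field_differentiable_const
          field_differentiable_mult field_differentiable_ident) auto
    then show ?thesis unfolding W_def affine_coord_def field_differentiable_def by simp
  qed
  then obtain dW where dW: "\<And>k. ((\<lambda>z. W z $ k) has_field_derivative dW k) (at z0)" by metis
  have "T field_differentiable at z0"
    unfolding T_def vector_add_component vector_smult_component
    by (intro field_differentiable_add field_differentiable_const \<tau>
        field_differentiable_mult field_differentiable_ident field_differentiable_power)
  then obtain dT where dT: "(T has_field_derivative dT) (at z0)" by (auto simp: field_differentiable_def)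
  have "bundle_chart \<mu> j (W z0, T z0) \<in> disc_bundle \<mu>" using disc chart[OF j] by simp
  then obtain A where A: "((\<lambda>y. f (bundle_chart \<mu> j y)) has_derivative A) (at (W z0, T z0))"
    "\<And>c v s. A (c *s v, c * s) = c * A (v, s)"
    using holo unfolding holomorphic_on_disc_def by blast
  have "((\<lambda>z. \<chi> k. W z $ k) has_derivative (\<lambda>h. \<chi> k. dW k * h)) (at z0)"
    using dW by (intro has_derivative_vec_lambda) (simp add: has_field_derivative_def)
  then have "((\<lambda>z. (W z, T z)) has_derivative (\<lambda>h. (\<chi> k. dW k * h, dT * h))) (at z0)"
    using dT by (intro has_derivative_Pair) (simp_all add: has_field_derivative_def)
  from has_derivative_compose[OF this A(1)]
  have "((\<lambda>z. f (bundle_chart \<mu> j (W z, T z))) has_derivative (\<lambda>h. A (\<chi> k. dW k * h, dT * h))) (at z0)" .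
  moreover have "A (\<chi> k. dW k * h, dT * h) = A (\<chi> k. dW k, dT) * h" for h
  proof -
    have "(\<chi> k. dW k * h) = h *s (\<chi> k. dW k)" by (simp add: vec_eq_iff mult.commute)
    then show ?thesis using A(2)[of h "\<chi> k. dW k" dT] by (simp add: mult.commute)
  qed
  ultimately have "((\<lambda>z. f (bundle_chart \<mu> j (W z, T z))) has_field_derivative A (\<chi> k. dW k, dT)) (at z0)"
    by (simp add: has_field_derivative_def)
  then have "((\<lambda>z. f (line_pt \<mu> (a + z *s b) (\<tau> z))) has_field_derivative A (\<chi> k. dW k, dT)) (at z0)"
  proof (rule has_field_derivative_transform_within_open)
    have "continuous_on UNIV (\<lambda>z. (a + z *s b) $ j)"
      unfolding vector_add_component vector_smult_component by (intro continuous_intros)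
    then show "open {z. (a + z *s b) $ j \<noteq> 0}"
      by (rule open_Collect_neq) (intro continuous_intros)
  qed (use j chart in simp_all)
  then show ?thesis by (auto simp: field_differentiable_def)
qed

lemma disc_algebra_continuous:
  fixes f :: "('n::finite) bundle_point \<Rightarrow> complex" and \<alpha> :: "'b::t2_space \<Rightarrow> _"
  assumes "f \<in> disc_algebra \<mu>"
    and "\<And>z. z \<in> S \<Longrightarrow> \<alpha> z \<noteq> 0 \<and> cmod (\<tau> z) * norm (\<alpha> z) ^ \<mu> \<le> 1"
    and "continuous_on S \<alpha>" "continuous_on S \<tau>"
  shows "continuous_on S (\<lambda>z. f (line_pt \<mu> (\<alpha> z) (\<tau> z)))"
  by (rule continuous_on_line_pt_compose[where A = "closed_disc_bundle \<mu>"])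
     (use assms in \<open>auto simp: disc_algebra_def closed_disc_bundle_def line_pt_in_total_space bundle_norm_line_pt\<close>)

lemma line_pt_in_disc_bundle:
  "v \<noteq> 0 \<Longrightarrow> cmod \<tau> * norm v ^ \<mu> < 1 \<Longrightarrow> line_pt \<mu> v \<tau> \<in> disc_bundle \<mu>"
  by (simp add: disc_bundle_def line_pt_in_total_space bundle_norm_line_pt)

lemma disc_algebra_fibre:
  assumes f: "f \<in> disc_algebra \<mu>" and v: "norm v = 1"
  shows "continuous_on (cball 0 1) (\<lambda>t. f (line_pt \<mu> v t))"
    and "(\<lambda>t. f (line_pt \<mu> v t)) holomorphic_on ball 0 1"
proof -
  have "v \<noteq> 0" using v by auto
  then show "continuous_on (cball 0 1) (\<lambda>t. f (line_pt \<mu> v t))"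
    by (intro disc_algebra_continuous[OF f] continuous_intros) (use v in auto)
  show "(\<lambda>t. f (line_pt \<mu> v t)) holomorphic_on ball 0 1"
    unfolding holomorphic_on_def
  proof
    fix t :: complex assume "t \<in> ball 0 1"
    then have "line_pt \<mu> v t \<in> disc_bundle \<mu>"
      using v \<open>v \<noteq> 0\<close> by (intro line_pt_in_disc_bundle) auto
    then have "(\<lambda>t. f (line_pt \<mu> (v + t *s 0) t)) field_differentiable at t"
      using f \<open>v \<noteq> 0\<close> by (intro field_differentiable_line_pt field_differentiable_ident) (auto simp: disc_algebra_def)
    then show "(\<lambda>t. f (line_pt \<mu> v t)) field_differentiable at t within ball 0 1"
      by (auto intro: field_differentiable_at_within)
  qed
qed

text \<open>Mean value property on the disc of vectors q v + c (u - q v), with q = <u, v>: for |c| =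
  1 they are unit vectors, for |c| < 1 they are shorter, and the centre q v represents the point of
  the fibre over \<open>v\<close> with coordinate q^\<mu>. Since q \<noteq> 0 the disc avoids the
  zero vector, which spans no line.\<close>

lemma integral_rotate_complement:
  fixes f :: "('n::finite) bundle_point \<Rightarrow> complex"
  assumes f: "f \<in> disc_algebra \<mu>" and \<mu>: "\<mu> \<ge> 1" and v: "norm v = 1" and u: "norm u = 1"
    and q: "hprod u v \<noteq> 0"
  shows "(\<integral>x. f (line_pt \<mu> (hprod u v *s v + cis (2 * pi * x) *s (u - hprod u v *s v)) 1) \<partial>unit_interval) =
    f (line_pt \<mu> v (hprod u v ^ \<mu>))"
proof -
  interpret U: prob_space unit_interval by (rule prob_space_unit_interval)
  let ?q = "hprod u v"
  let ?\<alpha> = "\<lambda>c. ?q *s v + c *s (u - ?q *s v)"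
  let ?h = "\<lambda>c. f (line_pt \<mu> (?\<alpha> c) 1)"
  have centre: "?h 0 = f (line_pt \<mu> v (?q ^ \<mu>))" using q by (simp add: line_pt_smult)
  have qle: "(cmod ?q)\<^sup>2 \<le> 1" using norm_hprod_le[of u v] u v by (simp add: power_le_one)
  show ?thesis
  proof (cases "u = ?q *s v")
    \<comment> \<open>In this degenerate case the disc shrinks to a point of norm 1, which never
      enters the open disc bundle, but the integrand is constant.\<close>
    case True
    then have "?h c = ?h 0" for c by simp
    then have "(\<integral>x. ?h (cis (2 * pi * x)) \<partial>unit_interval) = (\<integral>x. ?h 0 \<partial>unit_interval)"
      by (intro Bochner_Integration.integral_cong) auto
    then show ?thesis using centre U.prob_space by simp
  next
    case False
    have norm_sq: "(norm (?\<alpha> c))\<^sup>2 = (cmod ?q)\<^sup>2 + (cmod c)\<^sup>2 * (1 - (cmod ?q)\<^sup>2)" for c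
      using norm_projection[OF v, of u c] u by simp
    have "(norm (u - ?q *s v))\<^sup>2 = 1 - (cmod ?q)\<^sup>2"
    proof -
      have "hprod (u - ?q *s v) (u - ?q *s v) = of_real (1 - (cmod ?q)\<^sup>2)"
        using u v complex_norm_square[of ?q]
        by (simp add: hprod_diff_left hprod_diff_right hprod_smult_left hprod_smult_right hprod_commute[of v u])
          (simp add: hprod_self)
      then show ?thesis unfolding hprod_self of_real_eq_iff .
    qed
    then have qlt: "(cmod ?q)\<^sup>2 < 1" using False by (simp add: less_le[of _ "1::real"] qle) (metis diff_self norm_eq_zero power2_eq_iff_nonneg right_minus_eq zero_eq_power2)
    have nz: "?\<alpha> c \<noteq> 0" for c
    proof
      assume "?\<alpha> c = 0"
      then have "hprod (?\<alpha> c) v = 0" by (simp add: hprod_def)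
      moreover have "hprod (?\<alpha> c) v = ?q"
        using v by (simp add: hprod_add_left hprod_diff_left hprod_smult_left hprod_self)
      ultimately show False using q by simp
    qed
    have le: "norm (?\<alpha> c) \<le> 1" if "cmod c \<le> 1" for c
    proof -
      have "(cmod c)\<^sup>2 * (1 - (cmod ?q)\<^sup>2) \<le> 1 * (1 - (cmod ?q)\<^sup>2)"
        using that qle by (intro mult_right_mono) (auto simp: power_le_one)
      then have "(norm (?\<alpha> c))\<^sup>2 \<le> 1" unfolding norm_sq by simp
      then show ?thesis by (simp add: power_le_one_iff)
    qed
    have lt: "norm (?\<alpha> c) < 1" if "cmod c < 1" for c
    proof -
      have "(cmod c)\<^sup>2 * (1 - (cmod ?q)\<^sup>2) < 1 * (1 - (cmod ?q)\<^sup>2)"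
        using that qlt by (intro mult_strict_right_mono) (auto simp: power_less_one_iff)
      then have "(norm (?\<alpha> c))\<^sup>2 < 1" unfolding norm_sq by simp
      then show ?thesis by (simp add: power_less_one_iff)
    qed
    have "continuous_on (cball 0 1) ?h"
      by (intro disc_algebra_continuous[OF f])
        (use nz le in \<open>auto simp: power_le_one vector_scalar_mult_def intro!: continuous_intros\<close>)
    moreover have "?h holomorphic_on ball 0 1"
      unfolding holomorphic_on_def
    proof
      fix c :: complex assume c: "c \<in> ball 0 1"
      then have "norm (?\<alpha> c) ^ \<mu> < 1" using lt[of c] \<mu> by (simp add: power_less_one_iff)
      then have "line_pt \<mu> (?\<alpha> c) 1 \<in> disc_bundle \<mu>"
        by (intro line_pt_in_disc_bundle nz) simp
      then have "?h field_differentiable at c"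
        using f by (intro field_differentiable_line_pt[of \<mu> f "\<lambda>_. 1"] nz field_differentiable_const) (auto simp: disc_algebra_def)
      then show "?h field_differentiable at c within ball 0 1" by (rule field_differentiable_at_within)
    qed
    ultimately show ?thesis
      using integral_circle_coefficient[of ?h 0] centre by simp
  qed
qed

lemma disc_algebra_measurable:
  assumes "f \<in> disc_algebra \<mu>"
  shows "f \<in> borel_measurable (circle_borel \<mu>)"
proof (rule borel_measurableI)
  fix S :: "complex set" assume "open S"
  \<comment> \<open>Continuity holds relative to the closed disc bundle only, so the complement of
    the latter is thrown in. The result is open in every chart and has the required trace on the
    circle bundle.\<close>
  define U where "U = {\<xi>. \<xi> \<in> closed_disc_bundle \<mu> \<longrightarrow> f \<xi> \<in> S}"
  have closed: "closed (bundle_chart \<mu> j -` closed_disc_bundle \<mu>)" for j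
  proof -
    have "bundle_chart \<mu> j -` closed_disc_bundle \<mu> = {y. cmod (snd y) * norm (homogeneous j (fst y)) ^ \<mu> \<le> 1}"
      by (auto simp: closed_disc_bundle_def bundle_chart_line_pt bundle_norm_line_pt line_pt_in_total_space)
    moreover have "continuous_on UNIV (homogeneous j)"
      unfolding homogeneous_def
    proof (intro continuous_on_vec_lambda)
      fix i show "continuous_on UNIV (\<lambda>w. if i = j then 1 else case i of None \<Rightarrow> w $ the j | Some k \<Rightarrow> w $ k)"
        by (cases "i = j"; cases i) (auto intro!: continuous_intros)
    qed
    then have "continuous_on UNIV (\<lambda>y :: _ \<times> complex. homogeneous j (fst y))"
      by (rule continuous_on_compose2) (auto intro!: continuous_intros)
    then have "closed {y. cmod (snd y) * norm (homogeneous j (fst y)) ^ \<mu> \<le> 1}"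
      by (intro closed_Collect_le continuous_intros)
    ultimately show ?thesis by simp
  qed
  have "open (bundle_chart \<mu> j -` U)" for j
  proof -
    let ?C = "bundle_chart \<mu> j -` closed_disc_bundle \<mu>"
    have "continuous_on ?C (\<lambda>y. f (bundle_chart \<mu> j y))" using assms by (simp add: disc_algebra_def)
    then obtain V where V: "open V" "V \<inter> ?C = (\<lambda>y. f (bundle_chart \<mu> j y)) -` S \<inter> ?C"
      using \<open>open S\<close> unfolding continuous_on_open_invariant by blast
    have "bundle_chart \<mu> j -` U = V \<union> - ?C" using V(2) by (auto simp: U_def)
    then show ?thesis using V(1) closed[of j] by (simp add: open_Un open_Compl)
  qed
  then have "U \<inter> circle_bundle \<mu> \<in> sets (circle_borel \<mu>)"
    unfolding circle_borel_def by (subst sets_measure_of) (auto simp: chart_open_def intro!: sigma_sets.Basic)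
  moreover have "U \<inter> circle_bundle \<mu> = f -` S \<inter> space (circle_borel \<mu>)"
    by (auto simp: U_def circle_bundle_def closed_disc_bundle_def)
  ultimately show "f -` S \<inter> space (circle_borel \<mu>) \<in> sets (circle_borel \<mu>)" by simp
qed

lemma disc_algebra_bounded:
  fixes f :: "('n::finite) bundle_point \<Rightarrow> complex"
  assumes "f \<in> disc_algebra \<mu>" "\<mu> \<ge> 1"
  obtains B where "B \<ge> 0" "\<And>\<xi>. \<xi> \<in> circle_bundle \<mu> \<Longrightarrow> cmod (f \<xi>) \<le> B"
proof -
  have "continuous_on (sphere 0 1) (\<lambda>z. f (line_pt \<mu> z 1))"
    by (intro disc_algebra_continuous[OF assms(1)] continuous_intros) auto
  then have "bounded ((\<lambda>z. f (line_pt \<mu> z 1)) ` sphere 0 1)"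
    by (intro compact_imp_bounded compact_continuous_image) auto
  then obtain B where "\<forall>z\<in>sphere 0 1. cmod (f (line_pt \<mu> z 1)) \<le> B"
    unfolding bounded_iff by auto
  then have B: "cmod (f (line_pt \<mu> z 1)) \<le> B" if "norm z = 1" for z using that by simp
  have "cmod (f \<xi>) \<le> \<bar>B\<bar>" if "\<xi> \<in> circle_bundle \<mu>" for \<xi>
    using circle_bundle_cases[OF that assms(2)] B by (metis abs_ge_self order_trans)
  then show ?thesis using that[of "\<bar>B\<bar>"] by auto
qed

lemma norm_hprod_unit_vec_le: "norm v = 1 \<Longrightarrow> cmod (hprod (unit_vec z) v) \<le> 1"
  using norm_hprod_le[of "unit_vec z" v] by simp

text \<open>The real part of \<open>hprod z v\<close> is the real inner product with
  \<open>v\<close>, so the exceptional set lies in a real hyperplane.\<close>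

lemma AE_gauss_hprod_nonzero:
  fixes v :: "complex ^ 'n::finite option"
  assumes "norm v = 1"
  shows "AE z in gauss. hprod z v \<noteq> 0"
proof -
  let ?S = "{z. v \<bullet> z = 0}"
  have re: "Re (hprod z v) = v \<bullet> z" for z
    by (simp add: hprod_def inner_vec_def inner_complex_def mult.commute)
  have "v \<noteq> 0" using assms by auto
  then have "negligible ?S" by (intro negligible_hyperplane) simp
  moreover have S: "?S \<in> sets borel" by (intro borel_closed closed_hyperplane)
  ultimately have "emeasure lborel ?S = 0"
    by (simp add: negligible_iff_emeasure0)
  then have "?S \<in> null_sets lborel" using S by (intro null_setsI) simp_all
  then have *: "AE z in lborel. z \<notin> ?S" by (rule AE_not_in)
  have "AE z in lborel. hprod z v \<noteq> 0"
    using * by eventually_elim (metis (mono_tags) mem_Collect_eq re zero_complex.simps(1))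
  then show ?thesis
    unfolding gauss_def by (subst AE_density) (auto elim: eventually_mono)
qed

text \<open>Averaging over the rotations of the orthogonal complement of \<open>v\<close> replaces \<open>f\<close> by its
  restriction to the fibre over the line of \<open>v\<close>, by the mean value property; averaging over the
  rotations of that fibre then extracts a Taylor coefficient.\<close>

lemma integral_disc_algebra_power:
  fixes f :: "('n::finite) bundle_point \<Rightarrow> complex"
  assumes f: "f \<in> disc_algebra \<mu>" and \<mu>: "\<mu> \<ge> 1" and v: "norm v = 1"
  shows "(\<integral>z. f (line_pt \<mu> (unit_vec z) 1) * cnj (hprod (unit_vec z) v) ^ (\<mu> * k) \<partial>gauss) =
    (deriv ^^ k) (\<lambda>t. f (line_pt \<mu> v t)) 0 / fact k / of_nat (CARD('n) + \<mu> * k choose CARD('n))"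
proof -
  interpret G: prob_space "gauss :: (complex ^ 'n option) measure" by (rule prob_space_gauss)
  define g where "g = (\<lambda>t. f (line_pt \<mu> v t))"
  \<comment> \<open>Regularity of \<open>g\<close> is known on the closed disc only. The cutoff is
    Borel on the whole plane and agrees with \<open>g\<close> at the points where it will be
    evaluated.\<close>
  define g' where "g' = (\<lambda>t. indicator (cball 0 1) t *\<^sub>R g t)"
  let ?q = "\<lambda>z. hprod (unit_vec z) v"
  let ?m = "\<mu> * k"
  note cont_g = disc_algebra_fibre(1)[OF f v, folded g_def] and hol_g = disc_algebra_fibre(2)[OF f v, folded g_def]
  have [measurable]: "g' \<in> borel_measurable borel"
    unfolding g'_def by (rule borel_measurable_continuous_on_indicator[OF _ cont_g]) simp
  have q_le: "cmod (?q z) \<le> 1" for z by (rule norm_hprod_unit_vec_le[OF v])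
  have g'_eq: "g' (c * ?q z ^ \<mu>) = g (c * ?q z ^ \<mu>)" if "cmod c = 1" for c z
    using that q_le[of z] by (simp add: g'_def norm_mult norm_power power_le_one)
  obtain B where B: "B \<ge> 0" "\<And>\<xi>. \<xi> \<in> circle_bundle \<mu> \<Longrightarrow> cmod (f \<xi>) \<le> B"
    using disc_algebra_bounded[OF f \<mu>] by blast
  have "bounded (g ` cball 0 1)"
    by (intro compact_imp_bounded compact_continuous_image cont_g) auto
  then obtain B' where B': "\<And>t. cmod t \<le> 1 \<Longrightarrow> cmod (g t) \<le> B'"
    unfolding bounded_iff by fastforce
  define F where "F = (\<lambda>z. f (line_pt \<mu> (unit_vec z) 1))"
  have [measurable]: "F \<in> borel_measurable borel"
    unfolding F_def by (rule measurable_compose[OF measurable_line_pt disc_algebra_measurable[OF f]])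
  have F_bd: "cmod (F z) \<le> B" for z
    unfolding F_def by (intro B line_pt_in_circle_bundle) simp
  have "v \<noteq> 0" using v by auto
  \<comment> \<open>These rotations do not change \<open>hprod z v\<close>, so the conjugate power
    comes out of the average as a constant.\<close>
  define A where "A = (\<lambda>x z. hprod z v *s v + cis (2 * pi * x) *s (z - hprod z v *s v))"
  have A_lin: "linear (A x)" for x
    unfolding A_def
    by (rule linearI) (simp_all add: hprod_add_left hprod_scaleR_left vec_eq_iff algebra_simps scaleR_conv_of_real[where 'a = complex])
  have A_norm: "norm (A x z) = norm z" for x z
  proof -
    have "(norm (A x z))\<^sup>2 = (norm z)\<^sup>2" unfolding A_def norm_projection[OF v] by simp
    then show ?thesis by (simp add: power2_eq_iff_nonneg)
  qed
  have A_hprod: "hprod (A x z) v = hprod z v" for x z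
    using v by (simp add: A_def hprod_add_left hprod_diff_left hprod_smult_left hprod_self)
  have A_meas: "(\<lambda>p. A (fst p) (snd p)) \<in> borel_measurable (borel \<Otimes>\<^sub>M borel)"
    unfolding A_def by measurable
  \<comment> \<open>The angle is divided by \<open>\<mu>\<close> so that the fibre coordinate
    \<open>?q z ^ \<mu>\<close> turns by exactly 2 pi x.\<close>
  define R where "R = (\<lambda>x (z :: complex ^ 'n option). cis (2 * pi * x / \<mu>) *s z)"
  have R_lin: "linear (R x)" for x
    unfolding R_def by (rule linearI) (simp_all add: vec_eq_iff algebra_simps)
  have R_norm: "norm (R x z) = norm z" for x z by (simp add: R_def)
  have R_meas: "(\<lambda>p. R (fst p) (snd p)) \<in> borel_measurable (borel \<Otimes>\<^sub>M borel)"
    unfolding R_def by measurable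
  have "(\<integral>z. F z * cnj (?q z) ^ ?m \<partial>gauss) = (\<integral>z. (\<integral>x. F (A x z) * cnj (?q (A x z)) ^ ?m \<partial>unit_interval) \<partial>gauss)"
  proof (rule integral_gauss_average[OF _ _ A_meas A_lin A_norm])
    show "cmod (F z * cnj (?q z) ^ ?m) \<le> B * 1" for z
      unfolding norm_mult using F_bd[of z] B(1) q_le[of z] by (intro mult_mono) (auto simp: norm_power power_le_one)
  qed measurable
  also have "\<dots> = (\<integral>z. g' (?q z ^ \<mu>) * cnj (?q z) ^ ?m \<partial>gauss)"
  proof (rule integral_cong_AE)
    show "AE z in gauss. (\<integral>x. F (A x z) * cnj (?q (A x z)) ^ ?m \<partial>unit_interval) = g' (?q z ^ \<mu>) * cnj (?q z) ^ ?m"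
      using AE_gauss_nonzero AE_gauss_hprod_nonzero[OF v]
    proof eventually_elim
      fix z :: "complex ^ 'n option" assume z: "z \<noteq> 0" "hprod z v \<noteq> 0"
      have "?q z \<noteq> 0" using z by (simp add: unit_vec_def sgn_div_norm hprod_scaleR_left)
      have u: "unit_vec (A x z) = A x (unit_vec z)" for x
        by (rule unit_vec_isometry[OF A_lin A_norm z(1)])
      have "(\<integral>x. F (A x z) * cnj (?q (A x z)) ^ ?m \<partial>unit_interval) =
        (\<integral>x. f (line_pt \<mu> (A x (unit_vec z)) 1) \<partial>unit_interval) * cnj (?q z) ^ ?m"
        unfolding F_def u A_hprod by (rule integral_mult_left_zero)
      also have "(\<integral>x. f (line_pt \<mu> (A x (unit_vec z)) 1) \<partial>unit_interval) = g (?q z ^ \<mu>)"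
        unfolding A_def g_def using \<open>?q z \<noteq> 0\<close> by (intro integral_rotate_complement f \<mu> v) simp_all
      finally show "(\<integral>x. F (A x z) * cnj (?q (A x z)) ^ ?m \<partial>unit_interval) = g' (?q z ^ \<mu>) * cnj (?q z) ^ ?m"
        using g'_eq[of 1 z] by simp
    qed
  next
    show "(\<lambda>z. \<integral>x. F (A x z) * cnj (?q (A x z)) ^ ?m \<partial>unit_interval) \<in> borel_measurable gauss"
      by (rule borel_measurable_average(2)[OF _ A_meas]) measurable
  qed measurable
  also have "\<dots> = (\<integral>z. (\<integral>x. g' (?q (R x z) ^ \<mu>) * cnj (?q (R x z)) ^ ?m \<partial>unit_interval) \<partial>gauss)"
  proof (rule integral_gauss_average[OF _ _ R_meas R_lin R_norm])
    show "cmod (g' (?q z ^ \<mu>) * cnj (?q z) ^ ?m) \<le> B' * 1" for z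
      unfolding norm_mult using B'[of "?q z ^ \<mu>"] B'[of 0] g'_eq[of 1 z] q_le[of z]
      by (intro mult_mono) (auto simp: norm_power power_le_one intro: order_trans[OF norm_ge_zero])
  qed measurable
  also have "\<dots> = (\<integral>z. (deriv ^^ k) g 0 / fact k * of_real (cmod (?q z) ^ (2 * ?m)) \<partial>gauss)"
  proof (rule integral_cong_AE)
    show "AE z in gauss. (\<integral>x. g' (?q (R x z) ^ \<mu>) * cnj (?q (R x z)) ^ ?m \<partial>unit_interval) =
       (deriv ^^ k) g 0 / fact k * of_real (cmod (?q z) ^ (2 * ?m))"
      using AE_gauss_nonzero
    proof eventually_elim
      fix z :: "complex ^ 'n option" assume z: "z \<noteq> 0"
      let ?p = "?q z ^ \<mu>"
      have p: "cmod ?p \<le> 1" using q_le[of z] by (simp add: norm_power power_le_one)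
      have qR: "?q (R x z) = cis (2 * pi * x / \<mu>) * ?q z" for x
        using unit_vec_isometry[OF R_lin R_norm z] by (simp add: R_def hprod_smult_left)
      have pow: "cis (2 * pi * x / \<mu>) ^ \<mu> = cis (2 * pi * x)" for x
        using \<mu> by (simp add: Complex.DeMoivre)
      have pow': "cnj (cis (2 * pi * x / \<mu>)) ^ ?m = cis (- (2 * pi * k * x))" for x
        using \<mu> by (simp add: cis_cnj Complex.DeMoivre mult_ac)
      have "(\<integral>x. g' (?q (R x z) ^ \<mu>) * cnj (?q (R x z)) ^ ?m \<partial>unit_interval) =
          (\<integral>x. (g (?p * cis (2 * pi * x)) * cis (- (2 * pi * k * x))) * cnj (?q z) ^ ?m \<partial>unit_interval)"
      proof -
        have g'_cis: "g' (cis a * ?p) = g (?p * cis a)" for a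
          using g'_eq[of "cis a" z] by (simp only: norm_cis mult.commute[of ?p])
        show ?thesis
          unfolding qR complex_cnj_mult power_mult_distrib pow pow' g'_cis by (simp only: mult.assoc)
      qed
      also have "\<dots> = (\<integral>x. g (?p * cis (2 * pi * x)) * cis (- (2 * pi * k * x)) \<partial>unit_interval) * cnj (?q z) ^ ?m"
        by (rule integral_mult_left_zero)
      also have "(\<integral>x. g (?p * cis (2 * pi * x)) * cis (- (2 * pi * k * x)) \<partial>unit_interval) =
          (deriv ^^ k) (\<lambda>t. g (?p * t)) 0 / fact k"
      proof (rule integral_circle_coefficient)
        show "continuous_on (cball 0 1) (\<lambda>t. g (?p * t))"
          using p by (intro continuous_on_compose2[OF cont_g] continuous_intros) (auto simp: norm_mult mult_le_one)
        have "cmod (?p * t) < 1" if "cmod t < 1" for t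
          unfolding norm_mult using mult_right_mono[OF p norm_ge_zero[of t]] that by simp
        then show "(\<lambda>t. g (?p * t)) holomorphic_on ball 0 1"
          by (intro holomorphic_on_compose_gen[OF _ hol_g, unfolded o_def] holomorphic_intros) auto
      qed
      also have "(deriv ^^ k) (\<lambda>t. g (?p * t)) 0 = ?p ^ k * (deriv ^^ k) g (?p * 0)"
      proof (rule higher_deriv_compose_linear[OF hol_g])
        show "?p * t \<in> ball 0 1" if "t \<in> ball 0 1" for t
          using mult_right_mono[OF p norm_ge_zero[of t]] that by (simp add: norm_mult)
      qed auto
      \<comment> \<open>The powers of \<open>?q z\<close> and of its conjugate now match, so only
        the modulus to the power \<open>2 * ?m\<close> is left, and its integral is the moment with
        m = \<mu> k.\<close>
      also have "?p ^ k * (deriv ^^ k) g (?p * 0) / fact k * cnj (?q z) ^ ?m =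
          (deriv ^^ k) g 0 / fact k * (?q z * cnj (?q z)) ^ ?m"
        by (simp add: power_mult_distrib power_mult)
      also have "?q z * cnj (?q z) = of_real ((cmod (?q z))\<^sup>2)"
        by (simp only: complex_norm_square)
      finally show "(\<integral>x. g' (?q (R x z) ^ \<mu>) * cnj (?q (R x z)) ^ ?m \<partial>unit_interval) =
         (deriv ^^ k) g 0 / fact k * of_real (cmod (?q z) ^ (2 * ?m))"
        by (simp add: power_mult)
    qed
  next
    show "(\<lambda>z. \<integral>x. g' (?q (R x z) ^ \<mu>) * cnj (?q (R x z)) ^ ?m \<partial>unit_interval) \<in> borel_measurable gauss"
      by (rule borel_measurable_average(2)[OF _ R_meas]) measurable
  qed measurable
  also have "\<dots> = (deriv ^^ k) g 0 / fact k * of_real (\<integral>z. cmod (?q z) ^ (2 * ?m) \<partial>gauss)"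
    by (simp only: integral_mult_right_zero integral_complex_of_real)
  also have "\<dots> = (deriv ^^ k) g 0 / fact k / of_nat (CARD('n) + \<mu> * k choose CARD('n))"
    unfolding integral_gauss_moment[OF v] by simp
  finally show ?thesis unfolding F_def g_def .
qed

section \<open>The Szegoe kernel\<close>

lemma prod_eq_fact_binomial:
  "(\<Prod>i=1..d. real (N + i)) = fact d * real (d + N choose d)"
proof -
  have "fact (d + N) = (\<Prod>i=1..d. real (N + i)) * fact N"
    by (induction d) (simp_all add: mult_ac add.commute)
  then show ?thesis by (simp add: binomial_fact)
qed

text \<open>Going from \<open>d\<close> to \<open>Suc d\<close> multiplies the \<open>k\<close>-th
  coefficient by \<mu> k + d + 1, so it applies the operator \<mu> t d/dt + (d + 1) to the sum. This
  operator keeps the sum rational with 1 as its only possible pole, and raises the order of that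
  pole by at most one.\<close>

lemma sums_polynomial_coefficients:
  "\<exists>P :: real poly. \<forall>t. \<bar>t\<bar> < 1 \<longrightarrow> (\<lambda>k. (\<Prod>i=1..d. real (\<mu> * k + i)) * t ^ k) sums (poly P t / (1 - t) ^ (d + 1))"
proof (induction d)
  case 0
  show ?case using geometric_sums[where 'a = real] by (intro exI[of _ 1]) auto
next
  case (Suc d)
  define c where "c = (\<lambda>k. \<Prod>i=1..d. real (\<mu> * k + i))"
  obtain P where P: "\<And>t. \<bar>t\<bar> < 1 \<Longrightarrow> (\<lambda>k. c k * t ^ k) sums (poly P t / (1 - t) ^ (d + 1))"
    using Suc unfolding c_def by blast
  \<comment> \<open>The numerator after applying the operator, over the common denominator (1 -
    t)^(d+2); \<open>[:1, -1:]\<close> is the polynomial 1 - t.\<close>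
  define Q where "Q = smult (of_nat \<mu>) ([:0, 1:] * (pderiv P * [:1, -1:] + smult (of_nat (d + 1)) P)) + smult (of_nat (d + 1)) (P * [:1, -1:])"
  show ?case
  proof (intro exI[of _ Q] allI impI)
    fix t :: real assume t: "\<bar>t\<bar> < 1"
    define S where "S = (\<Sum>k. diffs c k * t ^ k)"
    have sm: "summable (\<lambda>k. c k * x ^ k)" if "norm x < 1" for x using P[of x] that by (auto dest: sums_summable)
    have dsm: "summable (\<lambda>k. diffs c k * t ^ k)"
      by (rule termdiff_converges[of _ 1]) (use t sm in auto)
    have "((\<lambda>x. \<Sum>k. c k * x ^ k) has_field_derivative S) (at t)"
      unfolding S_def by (rule termdiffs_strong[of c "(1 + \<bar>t\<bar>) / 2"]) (use t sm in auto)
    then have "((\<lambda>x. poly P x / (1 - x) ^ (d + 1)) has_field_derivative S) (at t)"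
      by (rule has_field_derivative_transform_within_open[of _ _ _ "{-1<..<1}"])
        (use t P in \<open>auto simp: sums_iff\<close>)
    moreover have "((\<lambda>x. poly P x / (1 - x) ^ (d + 1)) has_field_derivative
        (poly (pderiv P) t * (1 - t) + real (d + 1) * poly P t) / (1 - t) ^ (d + 2)) (at t)"
    proof -
      have "((\<lambda>x. poly P x / (1 - x) ^ (d + 1)) has_field_derivative
        (poly (pderiv P) t * (1 - t) ^ (d + 1) - poly P t * (real (d + 1) * (1 - t) ^ d * (- 1))) / ((1 - t) ^ (d + 1) * (1 - t) ^ (d + 1))) (at t)"
      proof (rule DERIV_divide[OF poly_DERIV])
        show "((\<lambda>x. (1 - x) ^ (d + 1)) has_field_derivative real (d + 1) * (1 - t) ^ d * (- 1)) (at t)"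
          by (rule DERIV_cong[OF DERIV_power[OF DERIV_diff[OF DERIV_const DERIV_ident]]]) simp
      qed (use t in simp)
      moreover have "(p' * u ^ (d + 1) - p * (real (d + 1) * u ^ d * (- 1))) / (u ^ (d + 1) * u ^ (d + 1)) = (p' * u + real (d + 1) * p) / u ^ (d + 2)"
        if "u \<noteq> 0" for p p' u :: real
        using that by (simp add: divide_simps) (simp add: algebra_simps)
      ultimately show ?thesis using t by simp
    qed
    ultimately have S: "S = (poly (pderiv P) t * (1 - t) + real (d + 1) * poly P t) / (1 - t) ^ (d + 2)"
      by (rule DERIV_unique)
    have "(\<lambda>k. t * (diffs c k * t ^ k)) sums (t * S)"
      unfolding S_def using dsm by (intro sums_mult summable_sums)
    then have "(\<lambda>k. real (Suc k) * c (Suc k) * t ^ Suc k) sums (t * S)"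
      by (simp add: diffs_def mult_ac)
    then have "(\<lambda>k. real k * c k * t ^ k) sums (t * S)"
      by (subst (asm) sums_Suc_iff[where f = "\<lambda>k. real k * c k * t ^ k"]) simp
    then have "(\<lambda>k. real \<mu> * (real k * c k * t ^ k) + real (d + 1) * (c k * t ^ k)) sums
        (real \<mu> * (t * S) + real (d + 1) * (poly P t / (1 - t) ^ (d + 1)))"
      by (intro sums_add sums_mult P t)
    moreover have "real \<mu> * (real k * c k * t ^ k) + real (d + 1) * (c k * t ^ k) = (\<Prod>i=1..Suc d. real (\<mu> * k + i)) * t ^ k" for k
      by (simp add: c_def algebra_simps)
    moreover have "real \<mu> * (t * S) + real (d + 1) * (poly P t / (1 - t) ^ (d + 1)) = poly Q t / (1 - t) ^ (Suc d + 1)"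
    proof -
      have alg: "m * (t * ((a * u + e * p) / u ^ (d + 2))) + e * (p / u ^ (d + 1)) = (m * (t * (a * u + e * p)) + e * (p * u)) / u ^ (d + 2)"
        if "u \<noteq> 0" for m a e p u :: real
        using that by (simp add: divide_simps)
      have nz: "1 - t \<noteq> 0" using t by auto
      have "poly Q t = real \<mu> * (t * (poly (pderiv P) t * (1 - t) + real (d + 1) * poly P t)) + real (d + 1) * (poly P t * (1 - t))"
        by (simp add: Q_def algebra_simps)
      then show ?thesis unfolding S alg[OF nz] by simp
    qed
    ultimately show "(\<lambda>k. (\<Prod>i=1..Suc d. real (\<mu> * k + i)) * t ^ k) sums (poly Q t / (1 - t) ^ (Suc d + 1))"
      by simp
  qed
qed

lemma sums_binomial_coefficients:
  "\<exists>P :: real poly. \<forall>t. \<bar>t\<bar> < 1 \<longrightarrow> (\<lambda>k. real (d + \<mu> * k choose d) * t ^ k) sums (poly P t / (1 - t) ^ (d + 1))"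
proof -
  obtain P where P: "\<And>t. \<bar>t\<bar> < 1 \<Longrightarrow> (\<lambda>k. (\<Prod>i=1..d. real (\<mu> * k + i)) * t ^ k) sums (poly P t / (1 - t) ^ (d + 1))"
    using sums_polynomial_coefficients by blast
  show ?thesis
  proof (intro exI[of _ "smult (1 / fact d) P"] allI impI)
    fix t :: real assume "\<bar>t\<bar> < 1"
    from sums_mult[OF P[OF this], of "1 / fact d"]
    show "(\<lambda>k. real (d + \<mu> * k choose d) * t ^ k) sums (poly (smult (1 / fact d) P) t / (1 - t) ^ (d + 1))"
      unfolding prod_eq_fact_binomial by (simp add: add.commute mult.assoc)
  qed
qed

text \<open>The generating function of the reciprocal moments; for d = n its value at the pairing of
  two points is the kernel.\<close>

definition kappa :: "nat \<Rightarrow> nat \<Rightarrow> complex \<Rightarrow> complex" where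
  "kappa d \<mu> t = (\<Sum>k. of_nat (d + \<mu> * k choose d) * t ^ k)"

lemma summable_binomial: "\<bar>t\<bar> < 1 \<Longrightarrow> summable (\<lambda>k. real (d + \<mu> * k choose d) * t ^ k)"
  using sums_binomial_coefficients[of d \<mu>] by (auto dest: sums_summable)

lemma kappa_sums: "cmod t < 1 \<Longrightarrow> (\<lambda>k. of_nat (d + \<mu> * k choose d) * t ^ k) sums kappa d \<mu> t"
proof -
  assume "cmod t < 1"
  then have "summable (\<lambda>k. real (d + \<mu> * k choose d) * cmod t ^ k)" by (intro summable_binomial) simp
  then have "summable (\<lambda>k. norm (of_nat (d + \<mu> * k choose d) * t ^ k))"
    unfolding norm_mult norm_power norm_of_nat .
  then show ?thesis unfolding kappa_def by (rule summable_sums[OF summable_norm_cancel])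
qed

lemma kappa_cnj: "cmod t < 1 \<Longrightarrow> cnj (kappa d \<mu> t) = kappa d \<mu> (cnj t)"
proof -
  assume t: "cmod t < 1"
  from kappa_sums[OF this, of d \<mu>]
  have "(\<lambda>k. cnj (of_nat (d + \<mu> * k choose d) * t ^ k)) sums cnj (kappa d \<mu> t)" by (subst sums_cnj)
  moreover have "(\<lambda>k. of_nat (d + \<mu> * k choose d) * cnj t ^ k) sums kappa d \<mu> (cnj t)"
    using t by (intro kappa_sums) simp
  ultimately show ?thesis by (simp add: sums_unique2)
qed

lemma kappa_holomorphic: "kappa d \<mu> holomorphic_on ball 0 1"
  by (rule power_series_holomorphic[of 0 1 "\<lambda>k. of_nat (d + \<mu> * k choose d)"]) (use kappa_sums in auto)

lemma kappa_real:
  "\<exists>P :: real poly. \<forall>r. 0 \<le> r \<and> r < 1 \<longrightarrow> kappa d \<mu> (of_real r) = of_real (poly P r / (1 - r) ^ (d + 1))"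
proof -
  obtain P where P: "\<And>t. \<bar>t\<bar> < 1 \<Longrightarrow> (\<lambda>k. real (d + \<mu> * k choose d) * t ^ k) sums (poly P t / (1 - t) ^ (d + 1))"
    using sums_binomial_coefficients by blast
  have "kappa d \<mu> (of_real r) = of_real (poly P r / (1 - r) ^ (d + 1))" if "0 \<le> r" "r < 1" for r
  proof -
    have "(\<lambda>k. complex_of_real (real (d + \<mu> * k choose d) * r ^ k)) sums of_real (poly P r / (1 - r) ^ (d + 1))"
      using P[of r] that by (intro sums_of_real) auto
    then have "(\<lambda>k. of_nat (d + \<mu> * k choose d) * complex_of_real r ^ k) sums of_real (poly P r / (1 - r) ^ (d + 1))"
      by simp
    then show ?thesis using kappa_sums[of "of_real r" d \<mu>] that sums_unique2 by fastforce
  qed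
  then show ?thesis by blast
qed

text \<open>The pointwise condition inside \<open>holomorphic_on_disc\<close>, isolated so that it
  has its own rules for sums, products and compositions.\<close>

definition complex_diff_at :: "((complex ^ 'n::finite) \<times> complex \<Rightarrow> complex) \<Rightarrow> (complex ^ 'n) \<times> complex \<Rightarrow> bool" where
  "complex_diff_at F x \<longleftrightarrow> (\<exists>A. (F has_derivative A) (at x) \<and> (\<forall>a v s. A (a *s v, a * s) = a * A (v, s)))"

lemma complex_diff_at_const: "complex_diff_at (\<lambda>y. c) x"
  unfolding complex_diff_at_def by (intro exI[of _ "\<lambda>_. 0"]) auto

lemma complex_diff_at_snd: "complex_diff_at snd x"
  unfolding complex_diff_at_def by (intro exI[of _ snd]) (auto intro!: derivative_eq_intros)

lemma complex_diff_at_fst_nth: "complex_diff_at (\<lambda>y. fst y $ k) x"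
  unfolding complex_diff_at_def
  by (intro exI[of _ "\<lambda>h. fst h $ k"]) (auto intro!: bounded_linear.has_derivative[OF bounded_linear_vec_nth] derivative_eq_intros)

lemma complex_diff_at_add:
  assumes "complex_diff_at F x" "complex_diff_at G x"
  shows "complex_diff_at (\<lambda>y. F y + G y) x"
proof -
  obtain A B where "(F has_derivative A) (at x)" "\<forall>a v s. A (a *s v, a * s) = a * A (v, s)"
    "(G has_derivative B) (at x)" "\<forall>a v s. B (a *s v, a * s) = a * B (v, s)"
    using assms unfolding complex_diff_at_def by blast
  then show ?thesis unfolding complex_diff_at_def
    by (intro exI[of _ "\<lambda>h. A h + B h"]) (auto intro: has_derivative_add simp: distrib_left)
qed

lemma complex_diff_at_mult:
  assumes "complex_diff_at F x" "complex_diff_at G x"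
  shows "complex_diff_at (\<lambda>y. F y * G y) x"
proof -
  obtain A B where "(F has_derivative A) (at x)" "\<forall>a v s. A (a *s v, a * s) = a * A (v, s)"
    "(G has_derivative B) (at x)" "\<forall>a v s. B (a *s v, a * s) = a * B (v, s)"
    using assms unfolding complex_diff_at_def by blast
  then show ?thesis unfolding complex_diff_at_def
    by (intro exI[of _ "\<lambda>h. F x * B h + A h * G x"] conjI has_derivative_mult) (auto simp: algebra_simps)
qed

lemma complex_diff_at_power: "complex_diff_at F x \<Longrightarrow> complex_diff_at (\<lambda>y. F y ^ m) x"
  by (induction m) (simp_all add: complex_diff_at_const complex_diff_at_mult)

lemma complex_diff_at_sum:
  "(\<And>i. i \<in> I \<Longrightarrow> complex_diff_at (F i) x) \<Longrightarrow> complex_diff_at (\<lambda>y. \<Sum>i\<in>I. F i y) x"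
  by (induction I rule: infinite_finite_induct) (simp_all add: complex_diff_at_const complex_diff_at_add)

lemma complex_diff_at_compose:
  assumes "complex_diff_at F x" "g field_differentiable at (F x)"
  shows "complex_diff_at (\<lambda>y. g (F y)) x"
proof -
  obtain A where A: "(F has_derivative A) (at x)" "\<forall>a v s. A (a *s v, a * s) = a * A (v, s)"
    using assms(1) unfolding complex_diff_at_def by blast
  obtain d where "(g has_derivative (*) d) (at (F x))"
    using assms(2) unfolding field_differentiable_def has_field_derivative_def by blast
  from has_derivative_compose[OF A(1) this] A(2) show ?thesis
    unfolding complex_diff_at_def by (intro exI[of _ "\<lambda>h. d * A h"]) auto
qed

lemma complex_diff_at_homogeneous: "complex_diff_at (\<lambda>y. homogeneous j (fst y) $ i) x"
  by (cases "i = j"; cases i) (simp_all add: homogeneous_def complex_diff_at_const complex_diff_at_fst_nth)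

text \<open>With the antilinear argument frozen, the pairing in a chart is the fibre coordinate
  times a polynomial in the base coordinates.\<close>

lemma complex_diff_at_tpair: "complex_diff_at (\<lambda>y. tpair \<mu> (bundle_chart \<mu> j y) (line_pt \<mu> v \<tau>)) x"
proof -
  have "tpair \<mu> (bundle_chart \<mu> j y) (line_pt \<mu> v \<tau>) =
      snd y * (cnj \<tau> * (\<Sum>i\<in>UNIV. homogeneous j (fst y) $ i * cnj (v $ i)) ^ \<mu>)" for y
    by (cases y) (simp add: bundle_chart_line_pt tpair_line_pt hprod_def)
  then have eq: "(\<lambda>y. tpair \<mu> (bundle_chart \<mu> j y) (line_pt \<mu> v \<tau>)) =
      (\<lambda>y. snd y * (cnj \<tau> * (\<Sum>i\<in>UNIV. homogeneous j (fst y) $ i * cnj (v $ i)) ^ \<mu>))"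
    by (rule ext)
  show ?thesis
    unfolding eq by (rule complex_diff_at_mult[OF complex_diff_at_snd complex_diff_at_mult[OF complex_diff_at_const
        complex_diff_at_power[OF complex_diff_at_sum[OF complex_diff_at_mult[OF complex_diff_at_homogeneous complex_diff_at_const]]]]])
qed

lemma continuous_on_tpair_chart:
  "continuous_on UNIV (\<lambda>y. tpair \<mu> (bundle_chart \<mu> j y) (line_pt \<mu> v \<tau>))"
proof (rule continuous_at_imp_continuous_on, rule ballI)
  fix x
  obtain A where "((\<lambda>y. tpair \<mu> (bundle_chart \<mu> j y) (line_pt \<mu> v \<tau>)) has_derivative A) (at x)"
    using complex_diff_at_tpair unfolding complex_diff_at_def by blast
  then show "continuous (at x) (\<lambda>y. tpair \<mu> (bundle_chart \<mu> j y) (line_pt \<mu> v \<tau>))"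
    by (rule has_derivative_continuous)
qed

lemma norm_tpair_less_one:
  assumes "bundle_norm \<mu> \<eta> \<le> 1" "bundle_norm \<mu> \<xi> < 1"
  shows "cmod (tpair \<mu> \<eta> \<xi>) < 1"
  using norm_tpair_le[of \<mu> \<eta> \<xi>] mult_right_mono[OF assms(1) bundle_norm_nonneg[of \<mu> \<xi>]] assms(2) by linarith

lemma disc_bundle_cases:
  assumes "\<xi> \<in> disc_bundle \<mu>"
  obtains v \<tau> where "norm v = 1" "\<xi> = line_pt \<mu> v \<tau>" "cmod \<tau> < 1"
proof -
  have "\<xi> \<in> total_space \<mu>" "bundle_norm \<mu> \<xi> < 1" using assms by (auto simp: disc_bundle_def)
  then obtain v \<tau> where v: "norm v = 1" "\<xi> = line_pt \<mu> v \<tau>"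
    using total_space_cases[of \<xi> \<mu>] by blast
  with \<open>bundle_norm \<mu> \<xi> < 1\<close> have "cmod \<tau> < 1" by (simp add: bundle_norm_line_pt)
  with v that show ?thesis by blast
qed

text \<open>Not cut off at the boundary: for \<open>\<xi>\<close> in the open disc bundle the series
  still converges for \<open>\<eta>\<close> on the circle bundle, as the pairing has modulus below
  1. It thus supplies boundary values of the kernel.\<close>

definition szego_boundary :: "nat \<Rightarrow> ('n::finite) bundle_point \<Rightarrow> 'n bundle_point \<Rightarrow> complex" where
  "szego_boundary \<mu> \<xi> \<eta> = kappa CARD('n) \<mu> (tpair \<mu> \<eta> \<xi>)"

lemma szego_boundary_disc_algebra:
  fixes \<xi> :: "('n::finite) bundle_point"
  assumes "\<xi> \<in> disc_bundle \<mu>"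
  shows "szego_boundary \<mu> \<xi> \<in> disc_algebra \<mu>"
proof -
  obtain v \<tau> where \<xi>: "norm v = 1" "\<xi> = line_pt \<mu> v \<tau>"
    using disc_bundle_cases[OF assms] by blast
  have nxi: "bundle_norm \<mu> \<xi> < 1" using assms by (simp add: disc_bundle_def)
  have "holomorphic_on_disc \<mu> (szego_boundary \<mu> \<xi>)"
    unfolding holomorphic_on_disc_def complex_diff_at_def[symmetric] szego_boundary_def
  proof (intro allI impI, rule complex_diff_at_compose[where g = "kappa CARD('n) \<mu>"])
    fix j :: "'n option" and x assume x: "bundle_chart \<mu> j x \<in> disc_bundle \<mu>"
    show "complex_diff_at (\<lambda>y. tpair \<mu> (bundle_chart \<mu> j y) \<xi>) x"
      unfolding \<xi>(2) by (rule complex_diff_at_tpair)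
    have "tpair \<mu> (bundle_chart \<mu> j x) \<xi> \<in> ball 0 1"
      using x norm_tpair_less_one[OF _ nxi] by (simp add: disc_bundle_def)
    then show "kappa CARD('n) \<mu> field_differentiable at (tpair \<mu> (bundle_chart \<mu> j x) \<xi>)"
      using kappa_holomorphic holomorphic_on_imp_differentiable_at open_ball by blast
  qed
  moreover have "continuous_on (bundle_chart \<mu> j -` closed_disc_bundle \<mu>) (\<lambda>y. szego_boundary \<mu> \<xi> (bundle_chart \<mu> j y))" for j :: "'n option"
    unfolding szego_boundary_def
  proof (rule continuous_on_compose2[OF holomorphic_on_imp_continuous_on[OF kappa_holomorphic]])
    show "continuous_on (bundle_chart \<mu> j -` closed_disc_bundle \<mu>) (\<lambda>y. tpair \<mu> (bundle_chart \<mu> j y) \<xi>)"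
      unfolding \<xi>(2) using continuous_on_tpair_chart by (rule continuous_on_subset) simp
    show "(\<lambda>y. tpair \<mu> (bundle_chart \<mu> j y) \<xi>) ` (bundle_chart \<mu> j -` closed_disc_bundle \<mu>) \<subseteq> ball 0 1"
      by (intro image_subsetI) (simp add: closed_disc_bundle_def norm_tpair_less_one[OF _ nxi])
  qed
  ultimately show ?thesis by (simp add: disc_algebra_def)
qed

section \<open>The reproducing property and uniqueness of the kernel\<close>

lemma prob_space_circle_measure:
  assumes "\<mu> \<ge> 1"
  shows "prob_space (circle_measure \<mu> :: ('n::finite) bundle_point measure)"
  unfolding circle_measure_eq[OF assms]
  by (rule prob_space.prob_space_distr[OF prob_space_gauss]) measurable

lemma integral_circle_measure:
  fixes h :: "('n::finite) bundle_point \<Rightarrow> complex"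
  assumes "\<mu> \<ge> 1" "h \<in> borel_measurable (circle_borel \<mu>)"
  shows "(\<integral>\<eta>. h \<eta> \<partial>circle_measure \<mu>) = (\<integral>z. h (line_pt \<mu> (unit_vec z) 1) \<partial>gauss)"
  unfolding circle_measure_eq[OF assms(1)] using assms(2) by (intro integral_distr) measurable

text \<open>As |\<tau>| < 1, the kernel series on the boundary is dominated by a convergent
  numerical series and may be integrated term by term. The binomial coefficient in each term cancels
  the one produced by the moment, and the Taylor series of the fibre restriction at
  \<open>\<tau>\<close> remains.\<close>

lemma szego_boundary_reproducing:
  fixes f :: "('n::finite) bundle_point \<Rightarrow> complex"
  assumes f: "f \<in> disc_algebra \<mu>" and \<mu>: "\<mu> \<ge> 1" and \<xi>: "\<xi> \<in> disc_bundle \<mu>"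
  shows "(\<integral>\<eta>. f \<eta> * cnj (szego_boundary \<mu> \<xi> \<eta>) \<partial>circle_measure \<mu>) = f \<xi>"
proof -
  interpret G: prob_space "gauss :: (complex ^ 'n option) measure" by (rule prob_space_gauss)
  let ?n = "CARD('n)"
  obtain v \<tau> where v: "norm v = 1" "\<xi> = line_pt \<mu> v \<tau>" "cmod \<tau> < 1"
    using disc_bundle_cases[OF \<xi>] by blast
  define g where "g = (\<lambda>t. f (line_pt \<mu> v t))"
  define F where "F = (\<lambda>z. f (line_pt \<mu> (unit_vec z) 1))"
  let ?q = "\<lambda>z. hprod (unit_vec z) v"
  let ?C = "\<lambda>k. of_nat (?n + \<mu> * k choose ?n) :: complex"
  have [measurable]: "F \<in> borel_measurable borel"
    unfolding F_def by (rule measurable_compose[OF measurable_line_pt disc_algebra_measurable[OF f]])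
  obtain B where B: "B \<ge> 0" "\<And>\<xi>. \<xi> \<in> circle_bundle \<mu> \<Longrightarrow> cmod (f \<xi>) \<le> B"
    using disc_algebra_bounded[OF f \<mu>] by blast
  have F_bd: "cmod (F z) \<le> B" for z
    unfolding F_def by (intro B line_pt_in_circle_bundle) simp
  have q_le: "cmod (?q z) \<le> 1" for z by (rule norm_hprod_unit_vec_le[OF v(1)])
  define T where "T = (\<lambda>k z. F z * (?C k * (\<tau> * cnj (?q z) ^ \<mu>) ^ k))"
  have [measurable]: "T k \<in> borel_measurable borel" for k unfolding T_def by measurable
  have T_bd: "norm (T k z) \<le> B * (real (?n + \<mu> * k choose ?n) * cmod \<tau> ^ k)" for k z
  proof -
    have "cmod (?q z) ^ (\<mu> * k) \<le> 1" using q_le by (simp add: power_le_one)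
    then have "cmod \<tau> ^ k * cmod (?q z) ^ (\<mu> * k) \<le> cmod \<tau> ^ k * 1"
      by (intro mult_left_mono) auto
    then have "real (?n + \<mu> * k choose ?n) * (cmod \<tau> ^ k * cmod (?q z) ^ (\<mu> * k)) \<le> real (?n + \<mu> * k choose ?n) * cmod \<tau> ^ k"
      by (intro mult_left_mono) auto
    then show ?thesis
      unfolding T_def norm_mult norm_power complex_mod_cnj norm_of_nat power_mult_distrib power_mult[symmetric]
      using F_bd[of z] B(1) by (intro mult_mono) auto
  qed
  have sm: "summable (\<lambda>k. B * (real (?n + \<mu> * k choose ?n) * cmod \<tau> ^ k))"
    using v(3) by (intro summable_mult summable_binomial) simp
  have int: "integrable gauss (T k)" for k
    by (rule G.integrable_const_bound[of _ "B * (real (?n + \<mu> * k choose ?n) * cmod \<tau> ^ k)"]) (use T_bd in auto)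
  have "(\<lambda>k. \<integral>z. T k z \<partial>gauss) sums (\<integral>z. (\<Sum>k. T k z) \<partial>gauss)"
  proof (rule sums_integral[OF int])
    show "AE z in gauss. summable (\<lambda>k. norm (T k z))"
      by (intro always_eventually allI, rule summable_comparison_test'[OF sm, of 0]) (simp add: T_bd)
    show "summable (\<lambda>k. \<integral>z. norm (T k z) \<partial>gauss)"
    proof (rule summable_comparison_test'[OF sm, of 0])
      fix k
      have "(\<integral>z. norm (T k z) \<partial>gauss) \<le> (\<integral>z. B * (real (?n + \<mu> * k choose ?n) * cmod \<tau> ^ k) \<partial>(gauss :: (complex ^ 'n option) measure))"
        by (intro integral_mono integrable_norm int T_bd) simp
      then have "(\<integral>z. norm (T k z) \<partial>gauss) \<le> B * (real (?n + \<mu> * k choose ?n) * cmod \<tau> ^ k)"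
        using G.prob_space by simp
      then show "norm (\<integral>z. norm (T k z) \<partial>gauss) \<le> B * (real (?n + \<mu> * k choose ?n) * cmod \<tau> ^ k)"
        by (subst real_norm_def, subst abs_of_nonneg) (auto intro: integral_nonneg_AE)
    qed
  qed
  moreover have "(\<integral>z. T k z \<partial>gauss) = (deriv ^^ k) g 0 / fact k * (\<tau> - 0) ^ k" for k
  proof -
    have "(\<integral>z. T k z \<partial>gauss) = (\<integral>z. ?C k * \<tau> ^ k * (F z * cnj (?q z) ^ (\<mu> * k)) \<partial>gauss)"
      unfolding T_def by (simp add: power_mult_distrib power_mult mult_ac)
    also have "\<dots> = ?C k * \<tau> ^ k * ((deriv ^^ k) g 0 / fact k / ?C k)"
      unfolding integral_mult_right_zero F_def integral_disc_algebra_power[OF f \<mu> v(1)] g_def ..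
    finally show ?thesis by simp
  qed
  moreover have "(\<Sum>k. T k z) = F z * cnj (szego_boundary \<mu> \<xi> (line_pt \<mu> (unit_vec z) 1))" for z
  proof -
    define s where "s = tpair \<mu> (line_pt \<mu> (unit_vec z) 1) \<xi>"
    have s: "cnj s = \<tau> * cnj (?q z) ^ \<mu>" by (simp add: s_def v(2) tpair_line_pt)
    have "cmod s < 1"
      unfolding s_def using \<xi> by (intro norm_tpair_less_one) (auto simp: bundle_norm_line_pt disc_bundle_def)
    then have "(\<lambda>k. F z * (?C k * cnj s ^ k)) sums (F z * kappa ?n \<mu> (cnj s))"
      by (intro sums_mult kappa_sums) simp
    moreover have "kappa ?n \<mu> (cnj s) = cnj (szego_boundary \<mu> \<xi> (line_pt \<mu> (unit_vec z) 1))"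
      unfolding szego_boundary_def s_def[symmetric] using \<open>cmod s < 1\<close> by (simp add: kappa_cnj)
    ultimately show ?thesis unfolding T_def s by (simp add: sums_iff)
  qed
  ultimately have "(\<lambda>k. (deriv ^^ k) g 0 / fact k * (\<tau> - 0) ^ k) sums
      (\<integral>z. F z * cnj (szego_boundary \<mu> \<xi> (line_pt \<mu> (unit_vec z) 1)) \<partial>gauss)"
    by simp
  moreover have "(\<lambda>k. (deriv ^^ k) g 0 / fact k * (\<tau> - 0) ^ k) sums g \<tau>"
    by (rule holomorphic_power_series[of _ _ 1]) (use disc_algebra_fibre(2)[OF f v(1)] v(3) in \<open>auto simp: g_def\<close>)
  ultimately have "(\<integral>z. F z * cnj (szego_boundary \<mu> \<xi> (line_pt \<mu> (unit_vec z) 1)) \<partial>gauss) = g \<tau>"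
    by (rule sums_unique2)
  moreover have "(\<lambda>\<eta>. f \<eta> * cnj (szego_boundary \<mu> \<xi> \<eta>)) \<in> borel_measurable (circle_borel \<mu>)"
    by (intro borel_measurable_times borel_measurable_cnj disc_algebra_measurable f szego_boundary_disc_algebra \<xi>)
  ultimately show ?thesis
    by (simp add: integral_circle_measure[OF \<mu>] F_def g_def v(2))
qed

text \<open>The kernel section is bounded on the circle bundle, so pairing with it is continuous in
  L^2. The values at \<open>\<xi>\<close> converge as well, since \<open>\<xi>\<close> lies in the
  region of norm at most its own, where convergence is uniform.\<close>

lemma hardy_reproducing:
  fixes F :: "('n::finite) bundle_point \<Rightarrow> complex"
  assumes \<mu>: "\<mu> \<ge> 1" and \<xi>: "\<xi> \<in> disc_bundle \<mu>" and hardy: "hardy \<mu> F g"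
  shows "F \<xi> = (\<integral>\<eta>. g \<eta> * cnj (szego_boundary \<mu> \<xi> \<eta>) \<partial>circle_measure \<mu>)"
proof -
  interpret C: prob_space "circle_measure \<mu> :: 'n bundle_point measure" by (rule prob_space_circle_measure[OF \<mu>])
  let ?M = "circle_measure \<mu> :: 'n bundle_point measure"
  let ?b = "szego_boundary \<mu> \<xi>"
  have g [measurable]: "g \<in> borel_measurable (circle_borel \<mu>)"
    and g2: "integrable ?M (\<lambda>\<eta>. (cmod (g \<eta>))\<^sup>2)"
    using hardy by (auto simp: hardy_def cong: measurable_cong_sets)
  obtain f where f: "\<And>k. f k \<in> disc_algebra \<mu>"
    and f_lim: "(\<lambda>k. \<integral>\<^sup>+\<eta>. ennreal ((cmod (f k \<eta> - g \<eta>))\<^sup>2) \<partial>?M) \<longlonglongrightarrow> 0"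
    and f_unif: "\<And>r. r < 1 \<Longrightarrow> uniform_limit {\<xi> \<in> total_space \<mu>. bundle_norm \<mu> \<xi> \<le> r} f F sequentially"
    using hardy unfolding hardy_def by blast
  have [measurable]: "f k \<in> borel_measurable (circle_borel \<mu>)" for k by (rule disc_algebra_measurable[OF f])
  have b_alg: "?b \<in> disc_algebra \<mu>" by (rule szego_boundary_disc_algebra[OF \<xi>])
  have [measurable]: "?b \<in> borel_measurable (circle_borel \<mu>)" by (rule disc_algebra_measurable[OF b_alg])
  obtain B where B: "B \<ge> 0" "\<And>\<eta>. \<eta> \<in> circle_bundle \<mu> \<Longrightarrow> cmod (?b \<eta>) \<le> B"
    using disc_algebra_bounded[OF b_alg \<mu>] by blast
  have space: "space ?M = circle_bundle \<mu>" by (simp add: circle_measure_def)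
  have sq_int: "integrable ?M h" if "integrable ?M (\<lambda>\<eta>. (cmod (h \<eta>))\<^sup>2)" "h \<in> borel_measurable (circle_borel \<mu>)" for h
  proof (rule Bochner_Integration.integrable_bound)
    show "integrable ?M (\<lambda>\<eta>. 1 + (cmod (h \<eta>))\<^sup>2)" using that(1) by simp
    show "AE \<eta> in ?M. norm (h \<eta>) \<le> norm (1 + (cmod (h \<eta>))\<^sup>2)"
    proof (rule AE_I2)
      fix \<eta>
      have "0 \<le> (cmod (h \<eta>) - 1)\<^sup>2" by simp
      then have "2 * cmod (h \<eta>) \<le> 1 + (cmod (h \<eta>))\<^sup>2" by (simp add: power2_diff)
      then have "cmod (h \<eta>) \<le> 1 + (cmod (h \<eta>))\<^sup>2" using norm_ge_zero[of "h \<eta>"] by linarith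
      then show "norm (h \<eta>) \<le> norm (1 + (cmod (h \<eta>))\<^sup>2)" by simp
    qed
  qed (use that(2) in measurable)
  have f2: "integrable ?M (\<lambda>\<eta>. (cmod (f k \<eta>))\<^sup>2)" for k
  proof -
    obtain B' where "B' \<ge> 0" "\<And>\<eta>. \<eta> \<in> circle_bundle \<mu> \<Longrightarrow> cmod (f k \<eta>) \<le> B'"
      using disc_algebra_bounded[OF f \<mu>] by blast
    then show ?thesis
      by (intro C.integrable_const_bound[of _ "B'\<^sup>2"]) (auto simp: space intro!: AE_I2 power_mono)
  qed
  have d2: "integrable ?M (\<lambda>\<eta>. (cmod (f k \<eta> - g \<eta>))\<^sup>2)" for k
  proof (rule Bochner_Integration.integrable_bound)
    show "integrable ?M (\<lambda>\<eta>. 2 * (cmod (f k \<eta>))\<^sup>2 + 2 * (cmod (g \<eta>))\<^sup>2)" using f2[of k] g2 by simp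
    show "AE \<eta> in ?M. norm ((cmod (f k \<eta> - g \<eta>))\<^sup>2) \<le> norm (2 * (cmod (f k \<eta>))\<^sup>2 + 2 * (cmod (g \<eta>))\<^sup>2)"
    proof (rule AE_I2)
      fix \<eta>
      have "(cmod (f k \<eta> - g \<eta>))\<^sup>2 \<le> (cmod (f k \<eta>) + cmod (g \<eta>))\<^sup>2"
        by (intro power_mono norm_triangle_ineq4) simp
      also have "\<dots> \<le> 2 * (cmod (f k \<eta>))\<^sup>2 + 2 * (cmod (g \<eta>))\<^sup>2"
        using zero_le_power2[of "cmod (f k \<eta>) - cmod (g \<eta>)"] by (simp add: power2_eq_square algebra_simps)
      finally show "norm ((cmod (f k \<eta> - g \<eta>))\<^sup>2) \<le> norm (2 * (cmod (f k \<eta>))\<^sup>2 + 2 * (cmod (g \<eta>))\<^sup>2)" by simp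
    qed
  qed measurable
  define a where "a = (\<lambda>k. \<integral>\<eta>. (cmod (f k \<eta> - g \<eta>))\<^sup>2 \<partial>?M)"
  have a_nonneg: "a k \<ge> 0" for k unfolding a_def by (intro integral_nonneg_AE) simp
  have "(\<lambda>k. ennreal (a k)) \<longlonglongrightarrow> ennreal 0"
    using f_lim unfolding a_def nn_integral_eq_integral[OF d2 AE_I2[OF zero_le_power2]] by simp
  then have "a \<longlonglongrightarrow> 0"
    using a_nonneg by (subst (asm) tendsto_ennreal_iff) auto
  then have sqrt_lim: "(\<lambda>k. B * sqrt (a k)) \<longlonglongrightarrow> 0"
    using tendsto_mult_right_zero[OF tendsto_real_sqrt[of a 0 sequentially, simplified]] by blast
  let ?I = "\<lambda>h. \<integral>\<eta>. h \<eta> * cnj (?b \<eta>) \<partial>?M"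
  have mult_int: "integrable ?M (\<lambda>\<eta>. h \<eta> * cnj (?b \<eta>))" if "integrable ?M h" for h :: "'n bundle_point \<Rightarrow> complex"
  proof (rule Bochner_Integration.integrable_bound)
    show "integrable ?M (\<lambda>\<eta>. B * cmod (h \<eta>))" using that by simp
    show "AE \<eta> in ?M. norm (h \<eta> * cnj (?b \<eta>)) \<le> norm (B * cmod (h \<eta>))"
    proof (rule AE_I2)
      fix \<eta> assume "\<eta> \<in> space ?M"
      then have "cmod (?b \<eta>) \<le> B" by (intro B) (simp add: space)
      then show "norm (h \<eta> * cnj (?b \<eta>)) \<le> norm (B * cmod (h \<eta>))"
        using B(1) by (simp add: norm_mult mult.commute[of B] mult_left_mono)
    qed
    have [measurable]: "h \<in> borel_measurable (circle_borel \<mu>)"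
      using borel_measurable_integrable[OF that] by (simp cong: measurable_cong_sets)
    show "(\<lambda>\<eta>. h \<eta> * cnj (?b \<eta>)) \<in> borel_measurable ?M" by measurable
  qed
  have bound: "cmod (?I (f k) - ?I g) \<le> B * sqrt (a k)" for k
  proof -
    let ?d = "\<lambda>\<eta>. f k \<eta> - g \<eta>"
    have d_int: "integrable ?M ?d" by (rule sq_int[OF d2]) measurable
    have "?I (f k) - ?I g = ?I ?d"
      unfolding left_diff_distrib
      by (intro Bochner_Integration.integral_diff[symmetric] mult_int sq_int f2 g2) measurable
    also have "cmod (?I ?d) \<le> (\<integral>\<eta>. norm (?d \<eta> * cnj (?b \<eta>)) \<partial>?M)"
      by (rule integral_norm_bound)
    also have "\<dots> \<le> (\<integral>\<eta>. B * cmod (?d \<eta>) \<partial>?M)"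
    proof (rule integral_mono[OF integrable_norm[OF mult_int[OF d_int]]])
      show "norm (?d \<eta> * cnj (?b \<eta>)) \<le> B * cmod (?d \<eta>)" if "\<eta> \<in> space ?M" for \<eta>
      proof -
        have "cmod (?b \<eta>) \<le> B" using that by (intro B) (simp add: space)
        then show ?thesis
          unfolding norm_mult complex_mod_cnj mult.commute[of B] by (intro mult_left_mono) simp_all
      qed
    qed (use d_int in simp)
    also have "\<dots> = B * (\<integral>\<eta>. cmod (?d \<eta>) \<partial>?M)" by simp
    also have "\<dots> \<le> B * sqrt (a k)"
    proof (intro mult_left_mono real_le_rsqrt B(1))
      \<comment> \<open>Nonnegativity of the variance plays the part of the Cauchy-Schwarz
        inequality: on a probability space the L^1 norm is at most the L^2 norm.\<close>
      have "0 \<le> C.variance (\<lambda>\<eta>. cmod (?d \<eta>))" by (rule C.variance_positive)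
      also have "\<dots> = a k - (\<integral>\<eta>. cmod (?d \<eta>) \<partial>?M)\<^sup>2"
        unfolding a_def by (rule C.variance_eq) (use d_int d2 in auto)
      finally show "(\<integral>\<eta>. cmod (?d \<eta>) \<partial>?M)\<^sup>2 \<le> a k" by simp
    qed
    finally show ?thesis .
  qed
  have "(\<lambda>k. ?I (f k) - ?I g) \<longlonglongrightarrow> 0"
    by (rule Lim_null_comparison[OF _ sqrt_lim]) (use bound in auto)
  moreover have "?I (f k) = f k \<xi>" for k by (rule szego_boundary_reproducing[OF f \<mu> \<xi>])
  ultimately have "(\<lambda>k. f k \<xi>) \<longlonglongrightarrow> ?I g" by (simp add: LIM_zero_iff)
  moreover have "(\<lambda>k. f k \<xi>) \<longlonglongrightarrow> F \<xi>"
  proof (rule tendsto_uniform_limitI[OF f_unif])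
    show "bundle_norm \<mu> \<xi> < 1" using \<xi> by (simp add: disc_bundle_def)
    show "\<xi> \<in> {\<xi>' \<in> total_space \<mu>. bundle_norm \<mu> \<xi>' \<le> bundle_norm \<mu> \<xi>}" using \<xi> by (simp add: disc_bundle_def)
  qed
  ultimately show ?thesis by (rule LIMSEQ_unique[symmetric])
qed

text \<open>The extension by 0 is the one prescribed in \<open>is_szego_kernel\<close>; it fixes the
  values that the reproducing property leaves undetermined.\<close>

definition szego :: "nat \<Rightarrow> ('n::finite) bundle_point \<Rightarrow> 'n bundle_point \<Rightarrow> complex" where
  "szego \<mu> \<eta> \<xi> = (if \<eta> \<in> disc_bundle \<mu> \<and> \<xi> \<in> disc_bundle \<mu> then szego_boundary \<mu> \<xi> \<eta> else 0)"

lemma hardy_szego: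
  fixes \<xi> :: "('n::finite) bundle_point"
  assumes \<mu>: "\<mu> \<ge> 1" and \<xi>: "\<xi> \<in> disc_bundle \<mu>"
  shows "hardy \<mu> (\<lambda>\<eta>. szego \<mu> \<eta> \<xi>) (szego_boundary \<mu> \<xi>)"
proof -
  interpret C: prob_space "circle_measure \<mu> :: 'n bundle_point measure" by (rule prob_space_circle_measure[OF \<mu>])
  let ?b = "szego_boundary \<mu> \<xi>"
  have b_alg: "?b \<in> disc_algebra \<mu>" by (rule szego_boundary_disc_algebra[OF \<xi>])
  have m [measurable]: "?b \<in> borel_measurable (circle_borel \<mu>)" by (rule disc_algebra_measurable[OF b_alg])
  obtain B where "B \<ge> 0" "\<And>\<eta>. \<eta> \<in> circle_bundle \<mu> \<Longrightarrow> cmod (?b \<eta>) \<le> B"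
    using disc_algebra_bounded[OF b_alg \<mu>] by blast
  then have "integrable (circle_measure \<mu>) (\<lambda>\<eta>. (cmod (?b \<eta>))\<^sup>2)"
    by (intro C.integrable_const_bound[of _ "B\<^sup>2"]) (auto simp: circle_measure_def intro!: AE_I2 power_mono)
  moreover have "uniform_limit {\<eta> \<in> total_space \<mu>. bundle_norm \<mu> \<eta> \<le> r} (\<lambda>_. ?b) (\<lambda>\<eta>. szego \<mu> \<eta> \<xi>) sequentially"
    if "r < 1" for r
    using that \<xi> by (intro uniform_limitI always_eventually) (auto simp: szego_def disc_bundle_def)
  ultimately show ?thesis
    unfolding hardy_def using m b_alg by (auto intro!: exI[of _ "\<lambda>_. ?b"] cong: measurable_cong_sets)
qed

lemma szego_hermitian: "szego \<mu> \<eta> \<xi> = cnj (szego \<mu> \<xi> \<eta>)"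
proof (cases "\<eta> \<in> disc_bundle \<mu> \<and> \<xi> \<in> disc_bundle \<mu>")
  case True
  then have "cmod (tpair \<mu> \<xi> \<eta>) < 1"
    by (intro norm_tpair_less_one) (auto simp: disc_bundle_def)
  then show ?thesis using True
    by (simp add: szego_def szego_boundary_def kappa_cnj tpair_commute[of \<mu> \<eta> \<xi>])
qed (auto simp: szego_def)

text \<open>For uniqueness, a section of \<open>K\<close> is paired with a section of
  \<open>szego\<close>: reproducing one way gives \<open>K \<eta> \<xi>\<close>, reproducing the
  other way and conjugating gives \<open>szego \<mu> \<eta> \<xi>\<close>.\<close>

lemma szego_kernel_eq:
  assumes \<mu>: "\<mu> \<ge> 1"
  shows "szego_kernel \<mu> = (szego \<mu> :: ('n::finite) bundle_point \<Rightarrow> _)"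
  unfolding szego_kernel_def
proof (rule the_equality)
  show "is_szego_kernel \<mu> (szego \<mu> :: 'n bundle_point \<Rightarrow> _)"
    unfolding is_szego_kernel_def
  proof (intro conjI ballI allI impI)
    fix \<xi> :: "'n bundle_point" assume \<xi>: "\<xi> \<in> disc_bundle \<mu>"
    show "\<exists>b. hardy \<mu> (\<lambda>\<eta>. szego \<mu> \<eta> \<xi>) b \<and>
        (\<forall>F g. hardy \<mu> F g \<longrightarrow> F \<xi> = (\<integral>\<eta>. g \<eta> * cnj (b \<eta>) \<partial>circle_measure \<mu>))"
      using hardy_szego[OF \<mu> \<xi>] hardy_reproducing[OF \<mu> \<xi>] by blast
  qed (auto simp: szego_def)
next
  fix K :: "'n bundle_point \<Rightarrow> 'n bundle_point \<Rightarrow> complex" assume K: "is_szego_kernel \<mu> K"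
  show "K = szego \<mu>"
  proof (intro ext)
    fix \<eta> \<xi>
    show "K \<eta> \<xi> = szego \<mu> \<eta> \<xi>"
    proof (cases "\<eta> \<in> disc_bundle \<mu> \<and> \<xi> \<in> disc_bundle \<mu>")
      case True
      then obtain b where b: "hardy \<mu> (\<lambda>\<eta>. K \<eta> \<xi>) b"
        "\<And>F g. hardy \<mu> F g \<Longrightarrow> F \<xi> = (\<integral>\<eta>. g \<eta> * cnj (b \<eta>) \<partial>circle_measure \<mu>)"
        using K unfolding is_szego_kernel_def by blast
      have "K \<eta> \<xi> = (\<integral>\<zeta>. b \<zeta> * cnj (szego_boundary \<mu> \<eta> \<zeta>) \<partial>circle_measure \<mu>)"
        using hardy_reproducing[OF \<mu> _ b(1)] True by blast
      also have "\<dots> = (\<integral>\<zeta>. cnj (szego_boundary \<mu> \<eta> \<zeta> * cnj (b \<zeta>)) \<partial>circle_measure \<mu>)"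
        by (simp only: complex_cnj_mult complex_cnj_cnj mult.commute)
      also have "\<dots> = cnj (\<integral>\<zeta>. szego_boundary \<mu> \<eta> \<zeta> * cnj (b \<zeta>) \<partial>circle_measure \<mu>)"
        by (rule Bochner_Integration.integral_cnj)
      also have "(\<integral>\<zeta>. szego_boundary \<mu> \<eta> \<zeta> * cnj (b \<zeta>) \<partial>circle_measure \<mu>) = szego \<mu> \<xi> \<eta>"
      proof -
        have "hardy \<mu> (\<lambda>\<zeta>. szego \<mu> \<zeta> \<eta>) (szego_boundary \<mu> \<eta>)"
          using True by (intro hardy_szego \<mu>) simp
        from b(2)[OF this] show ?thesis by simp
      qed
      also have "cnj (szego \<mu> \<xi> \<eta>) = szego \<mu> \<eta> \<xi>" by (rule szego_hermitian[symmetric])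
      finally show ?thesis .
    next
      case False
      then have "K \<eta> \<xi> = 0" using K unfolding is_szego_kernel_def by blast
      then show ?thesis using False by (auto simp: szego_def)
    qed
  qed
qed

lemma szego_diagonal:
  "\<exists>P :: real poly. \<forall>\<xi> \<in> disc_bundle \<mu>. szego \<mu> \<xi> (\<xi> :: ('n::finite) bundle_point) =
    of_real (poly P ((bundle_norm \<mu> \<xi>)\<^sup>2) / (1 - (bundle_norm \<mu> \<xi>)\<^sup>2) ^ (CARD('n) + 1))"
proof -
  obtain P :: "real poly" where P: "\<And>r. 0 \<le> r \<Longrightarrow> r < 1 \<Longrightarrow> kappa CARD('n) \<mu> (of_real r) = of_real (poly P r / (1 - r) ^ (CARD('n) + 1))"
    using kappa_real[of "CARD('n)" \<mu>] by blast
  show ?thesis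
  proof (intro exI[of _ P] ballI)
    fix \<xi> :: "'n bundle_point" assume "\<xi> \<in> disc_bundle \<mu>"
    then show "szego \<mu> \<xi> \<xi> = of_real (poly P ((bundle_norm \<mu> \<xi>)\<^sup>2) / (1 - (bundle_norm \<mu> \<xi>)\<^sup>2) ^ (CARD('n) + 1))"
      unfolding szego_def szego_boundary_def tpair_self
      by (subst P) (auto simp: disc_bundle_def power_less_one_iff)
  qed
qed

section \<open>The log-term\<close>

text \<open>The squared bundle norm in a chart, written with inner products instead of norms so that
  the rules for \<open>Ck_on\<close> apply directly, also on the zero section.\<close>

definition chart_norm_sq :: "nat \<Rightarrow> 'n option \<Rightarrow> (complex ^ 'n::finite) \<times> complex \<Rightarrow> real" where
  "chart_norm_sq \<mu> j y = (snd y \<bullet> snd y) * (\<Sum>i\<in>UNIV. homogeneous j (fst y) $ i \<bullet> homogeneous j (fst y) $ i) ^ \<mu>"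

lemma chart_norm_sq: "chart_norm_sq \<mu> j y = (bundle_norm \<mu> (bundle_chart \<mu> j y))\<^sup>2"
  by (cases y) (simp add: chart_norm_sq_def bundle_chart_line_pt bundle_norm_line_pt power_mult_distrib
      power2_norm_vec[symmetric] power_mult[symmetric] mult.commute[of 2] dot_square_norm power2_norm_eq_inner[symmetric]
      del: power_mult)

lemma Ck_on_homogeneous: "open S \<Longrightarrow> Ck_on k S (\<lambda>y :: (complex ^ 'n::finite) \<times> complex. homogeneous j (fst y) $ i)"
proof -
  assume S: "open S"
  have "Ck_on k S (\<lambda>y :: (complex ^ 'n) \<times> complex. fst y $ l)" for l
    by (rule Ck_on_linear[OF S]) (intro bounded_linear_compose[OF bounded_linear_vec_nth] bounded_linear_fst)
  then show ?thesis
    by (cases "i = j"; cases i) (simp_all add: homogeneous_def Ck_on_const)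
qed

lemma Ck_on_chart_norm_sq: "open S \<Longrightarrow> Ck_on k S (chart_norm_sq \<mu> j)"
  unfolding chart_norm_sq_def[abs_def]
  by (intro Ck_on_mult Ck_on_inner Ck_on_power Ck_on_sum Ck_on_homogeneous Ck_on_linear bounded_linear_snd)

lemma chart_norm_sq_pos: "snd y \<noteq> 0 \<Longrightarrow> chart_norm_sq \<mu> j y > 0"
  by (cases y) (simp add: chart_norm_sq bundle_chart_line_pt bundle_norm_line_pt)

lemma chart_norm_sq_scale: "chart_norm_sq \<mu> j (w, c *\<^sub>R t) = c\<^sup>2 * chart_norm_sq \<mu> j (w, t)"
  by (simp add: chart_norm_sq_def power2_eq_square)

lemma Ck_on_poly:
  assumes "open S" "Ck_on k S f"
  shows "Ck_on k S (\<lambda>x. poly P (f x :: real))"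
  unfolding poly_altdef by (intro Ck_on_sum Ck_on_mult Ck_on_const Ck_on_power assms)

lemma Ck_on_sqrt:
  assumes "open S" "Ck_on k S f" "\<And>x. x \<in> S \<Longrightarrow> f x > 0"
  shows "Ck_on k S (\<lambda>x. sqrt (f x))"
  by (rule Ck_on_compose[OF assms(1) open_greaterThan _ assms(2) Ck_on_sqrt_pos]) (use assms(3) in auto)

lemma Ck_on_inverse:
  assumes "open S" "Ck_on k S f" "\<And>x. x \<in> S \<Longrightarrow> f x > (0::real)"
  shows "Ck_on k S (\<lambda>x. inverse (f x))"
  by (rule Ck_on_compose[OF assms(1) open_greaterThan _ assms(2) Ck_on_inverse_pos]) (use assms(3) in auto)

text \<open>Hadamard's lemma along the fibres: the segment from \<open>y\<close> to its radial projection onto the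
  unit circle stays in a ball around \<open>x0\<close>, and the quotient is an integral over that segment.\<close>

lemma divide_by_one_minus_norm_sq:
  fixes R :: "(complex ^ 'n::finite) \<times> complex \<Rightarrow> real"
  assumes Or: "open Or" and R: "\<And>k. Ck_on k Or R" and x0: "x0 \<in> Or" "chart_norm_sq \<mu> j x0 = 1"
    and zero: "\<And>y. y \<in> Or \<Longrightarrow> chart_norm_sq \<mu> j y = 1 \<Longrightarrow> R y = 0"
  obtains V q where "open V" "x0 \<in> V" "V \<subseteq> Or" "smooth_on V q"
    "\<And>y. y \<in> V \<Longrightarrow> snd y \<noteq> 0 \<and> R y = (1 - chart_norm_sq \<mu> j y) * q y"
proof -
  let ?E = "{y :: (complex ^ 'n) \<times> complex. snd y \<noteq> 0}"
  define N where "N = (\<lambda>y. sqrt (chart_norm_sq \<mu> j y))"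
  define s where "s = (\<lambda>y. inverse (N y))"
  \<comment> \<open>The segment inside a fibre from the radial projection onto the unit circle, at
    parameter 0, to \<open>y\<close> itself, at parameter 1; \<open>s y\<close> is the scaling
    factor of the projection.\<close>
  define m where "m = (\<lambda>p :: ((complex ^ 'n) \<times> complex) \<times> real.
     (fst (fst p), (s (fst p) + snd p * (1 - s (fst p))) *\<^sub>R snd (fst p)))"
  have E: "open ?E" by (intro open_Collect_neq continuous_intros)
  have N_pos: "N y > 0" if "y \<in> ?E" for y using that chart_norm_sq_pos[of y \<mu> j] by (simp add: N_def)
  have N_Ck: "Ck_on k ?E N" for k
    unfolding N_def by (intro Ck_on_sqrt Ck_on_chart_norm_sq E) (simp add: chart_norm_sq_pos)
  have s_Ck: "Ck_on k ?E s" for k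
    unfolding s_def by (intro Ck_on_inverse N_Ck E N_pos)
  have "chart_norm_sq \<mu> j x0 \<noteq> 0" using x0 by simp
  then have x0E: "x0 \<in> ?E" by (auto simp: chart_norm_sq_def)
  obtain \<delta> where \<delta>: "\<delta> > 0" "ball x0 \<delta> \<subseteq> Or" using Or x0 by (meson openE)
  define B where "B = ball x0 \<delta>"
  have "open B" and "x0 \<in> B" using \<delta> by (auto simp: B_def)
  have ER: "open (?E \<times> (UNIV :: real set))" using E by (intro open_Times) auto
  have fst_Ck: "Ck_on k (?E \<times> (UNIV :: real set)) (\<lambda>p. s (fst p))" for k
    by (rule Ck_on_compose[OF ER E _ Ck_on_linear[OF ER bounded_linear_fst] s_Ck]) auto
  have m_Ck: "Ck_on k (?E \<times> (UNIV :: real set)) m" for k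
  proof -
    have "Ck_on k (?E \<times> (UNIV :: real set)) (\<lambda>p. 1 + (- 1) *\<^sub>R s (fst p))"
      by (intro Ck_on_add Ck_on_const Ck_on_scaleR fst_Ck ER)
    then have minus: "Ck_on k (?E \<times> (UNIV :: real set)) (\<lambda>p. 1 - s (fst p))" by simp
    note lin = Ck_on_linear[OF ER bounded_linear_snd] Ck_on_linear[OF ER bounded_linear_compose[OF bounded_linear_fst bounded_linear_fst]]
      Ck_on_linear[OF ER bounded_linear_compose[OF bounded_linear_snd bounded_linear_fst]]
    show ?thesis
      unfolding m_def
      by (rule Ck_on_Pair[OF ER lin(2) Ck_on_scaleR[OF ER Ck_on_add[OF ER fst_Ck Ck_on_mult[OF ER lin(1) minus]] lin(3)]])
  qed
  define W where "W = (?E \<times> (UNIV :: real set)) \<inter> m -` B"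
  have W: "open W"
    unfolding W_def by (rule continuous_open_preimage[OF Ck_on_continuous[OF m_Ck] ER \<open>open B\<close>])
  \<comment> \<open>Both ends of the segment lie in the ball \<open>B\<close>, so by convexity the
    whole segment does.\<close>
  define V where "V = ?E \<inter> B \<inter> (\<lambda>y. m (y, 0)) -` B"
  have "continuous_on ?E (\<lambda>y. m (y, 0))"
    by (rule continuous_on_compose2[OF Ck_on_continuous[OF m_Ck]]) (auto intro!: continuous_intros)
  then have V: "open V"
  proof -
    have "open (?E \<inter> (\<lambda>y. m (y, 0)) -` B)"
      using \<open>continuous_on ?E (\<lambda>y. m (y, 0))\<close> E \<open>open B\<close> by (rule continuous_open_preimage)
    then have "open (B \<inter> (?E \<inter> (\<lambda>y. m (y, 0)) -` B))" using \<open>open B\<close> by (rule open_Int[rotated])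
    moreover have "V = B \<inter> (?E \<inter> (\<lambda>y. m (y, 0)) -` B)" by (auto simp: V_def)
    ultimately show ?thesis by simp
  qed
  have "m (x0, 0) = x0" using x0 by (simp add: m_def s_def N_def)
  then have x0V: "x0 \<in> V" using x0E \<open>x0 \<in> B\<close> by (simp add: V_def)
  have m_seg: "m (y, \<tau>) = (1 - \<tau>) *\<^sub>R m (y, 0) + \<tau> *\<^sub>R y" for y \<tau>
    by (simp add: m_def prod_eq_iff scaleR_left_diff_distrib scaleR_add_left right_diff_distrib left_diff_distrib)
  have mB: "m (y, \<tau>) \<in> B" if "y \<in> V" "\<tau> \<in> {0..1}" for y \<tau>
  proof -
    have "convex B" by (simp add: B_def)
    then have "(1 - \<tau>) *\<^sub>R m (y, 0) + \<tau> *\<^sub>R y \<in> B"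
      using that by (intro convexD) (auto simp: V_def)
    then show ?thesis by (simp only: m_seg[of y \<tau>])
  qed
  then have VW: "V \<times> {0..1} \<subseteq> W" by (auto simp: W_def V_def)
  \<comment> \<open>The derivative of \<open>R\<close> along the fibre in the direction
    \<open>snd y\<close>, taken at a point of the segment and expanded in a basis because that
    direction varies with \<open>y\<close>.\<close>
  define G where "G = (\<lambda>p. \<Sum>b\<in>Basis. (snd (fst p) \<bullet> b) *\<^sub>R frechet_derivative R (at (m p)) (0, b))"
  have D_Ck: "Ck_on k W (\<lambda>p. frechet_derivative R (at (m p)) (0, b))" for k b
  proof -
    have "Ck_on k Or (\<lambda>x. frechet_derivative R (at x) (0, b))" using R[of "Suc k"] by simp
    then have "Ck_on k B (\<lambda>x. frechet_derivative R (at x) (0, b))"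
      by (rule Ck_on_subset) (use \<delta> in \<open>simp add: B_def\<close>)
    moreover have "m ` W \<subseteq> B" "W \<subseteq> ?E \<times> UNIV" by (auto simp: W_def)
    ultimately show ?thesis using Ck_on_compose[OF W \<open>open B\<close> _ Ck_on_subset[OF m_Ck]] by blast
  qed
  have G_Ck: "Ck_on k W G" for k
    unfolding G_def
    by (rule Ck_on_sum[OF W], rule Ck_on_scaleR[OF W Ck_on_inner[OF W Ck_on_linear[OF W
          bounded_linear_compose[OF bounded_linear_snd bounded_linear_fst]] Ck_on_const] D_Ck])
  define I where "I = (\<lambda>y. integral {0..1} (\<lambda>\<tau>. G (y, \<tau>)))"
  have I_Ck: "Ck_on k V I" for k
    unfolding I_def by (rule Ck_on_parametric_integral[OF W V VW G_Ck])
  \<comment> \<open>Integrating along the segment gives R = (1 - 1/N) I, and 1 - 1/N = -(1 - N^2) /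
    (N (1 + N)), where N^2 is \<open>chart_norm_sq\<close>.\<close>
  define q where "q = (\<lambda>y. (- 1) *\<^sub>R (I y * (s y * inverse (1 + N y))))"
  have VE: "V \<subseteq> ?E" by (auto simp: V_def)
  have "Ck_on k V q" for k
  proof -
    have "1 + N y > 0" if "y \<in> V" for y
      using N_pos[of y] that VE by (auto intro: add_pos_pos)
    then have inv: "Ck_on k V (\<lambda>y. inverse (1 + N y))"
      by (rule Ck_on_inverse[OF V Ck_on_add[OF V Ck_on_const Ck_on_subset[OF N_Ck VE]]])
    show ?thesis
      unfolding q_def
      by (rule Ck_on_scaleR[OF V Ck_on_const Ck_on_mult[OF V I_Ck Ck_on_mult[OF V Ck_on_subset[OF s_Ck VE] inv]]])
  qed
  then have "smooth_on V q" by (simp add: smooth_on_def)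
  moreover have "snd y \<noteq> 0 \<and> R y = (1 - chart_norm_sq \<mu> j y) * q y" if y: "y \<in> V" for y
  proof
    show "snd y \<noteq> 0" using y by (simp add: V_def)
    have Npos: "N y > 0" using y VE N_pos by blast
    have "((\<lambda>\<tau>. R (m (y, \<tau>))) has_vector_derivative (1 - s y) * G (y, \<tau>)) (at \<tau> within {0..1})" if "\<tau> \<in> {0..1}" for \<tau>
    proof -
      have "m (y, \<tau>) \<in> Or" using mB[OF y that] \<delta> by (auto simp: B_def)
      then have DR: "(R has_derivative frechet_derivative R (at (m (y, \<tau>)))) (at (m (y, \<tau>)))"
        by (rule Ck_on_Suc_has_derivative[OF R])
      interpret D: bounded_linear "frechet_derivative R (at (m (y, \<tau>)))"
        using DR by (rule has_derivative_bounded_linear)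
      have "((\<lambda>\<tau>. m (y, \<tau>)) has_derivative (\<lambda>h. h *\<^sub>R (0, (1 - s y) *\<^sub>R snd y))) (at \<tau>)"
        unfolding m_def by (auto intro!: derivative_eq_intros)
      from has_derivative_compose[OF this DR]
      have "((\<lambda>\<tau>. R (m (y, \<tau>))) has_derivative (\<lambda>h. h *\<^sub>R frechet_derivative R (at (m (y, \<tau>))) (0, (1 - s y) *\<^sub>R snd y))) (at \<tau>)"
        by (simp only: D.scaleR)
      moreover have "frechet_derivative R (at (m (y, \<tau>))) (0, (1 - s y) *\<^sub>R snd y) = (1 - s y) * G (y, \<tau>)"
      proof -
        have "(0 :: complex ^ 'n, (1 - s y) *\<^sub>R snd y) = (1 - s y) *\<^sub>R (\<Sum>b\<in>Basis. (snd y \<bullet> b) *\<^sub>R (0, b))"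
          by (simp add: prod_eq_iff fst_sum snd_sum euclidean_representation)
        then show ?thesis by (simp only: D.scaleR D.sum G_def fst_conv snd_conv) simp
      qed
      ultimately show ?thesis
        by (auto simp: has_vector_derivative_def intro: has_derivative_at_withinI)
    qed
    from fundamental_theorem_of_calculus[OF zero_le_one this]
    have "((\<lambda>\<tau>. (1 - s y) * G (y, \<tau>)) has_integral (R (m (y, 1)) - R (m (y, 0)))) {0..1}" .
    from integral_unique[OF this]
    have "R (m (y, 1)) - R (m (y, 0)) = integral {0..1} (\<lambda>\<tau>. (1 - s y) * G (y, \<tau>))" by (rule sym)
    also have "\<dots> = (1 - s y) * I y" by (simp add: I_def)
    finally have "R (m (y, 1)) - R (m (y, 0)) = (1 - s y) * I y" .
    moreover have "m (y, 1) = y" by (simp add: m_def)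
    moreover have "R (m (y, 0)) = 0"
    proof (rule zero)
      show "m (y, 0) \<in> Or" using mB[OF y, of 0] \<delta> by (auto simp: B_def)
      have "chart_norm_sq \<mu> j (m (y, 0)) = (s y)\<^sup>2 * (N y)\<^sup>2"
        using chart_norm_sq_scale[of \<mu> j "fst y" "s y" "snd y"] Npos by (simp add: m_def N_def)
      then show "chart_norm_sq \<mu> j (m (y, 0)) = 1"
        using Npos by (simp add: s_def power_mult_distrib[symmetric])
    qed
    ultimately have "R y = (1 - s y) * I y" by simp
    moreover have "chart_norm_sq \<mu> j y = (N y)\<^sup>2" using Npos by (simp add: N_def)
    moreover have "(1 - inverse u) * i = (1 - u\<^sup>2) * (- 1 * (i * (inverse u * inverse (1 + u))))" if "u > 0" for u i :: real
      using that by (simp add: divide_simps inverse_eq_divide) (simp add: algebra_simps power2_eq_square)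
    ultimately show "R y = (1 - chart_norm_sq \<mu> j y) * q y"
      using Npos by (simp only: q_def s_def real_scaleR_def)
  qed
  moreover have "V \<subseteq> Or" using \<delta> by (auto simp: V_def B_def)
  ultimately show ?thesis using that V x0V by blast
qed

text \<open>Hadamard's lemma yields one quotient per chart, but a single function on the bundle is
  required. The radial limit at the boundary refers to no chart and agrees with each of the local
  quotients.\<close>

definition boundary_quotient :: "nat \<Rightarrow> (('n::finite) bundle_point \<Rightarrow> real) \<Rightarrow> 'n bundle_point \<Rightarrow> real" where
  "boundary_quotient \<mu> \<rho> \<xi> = (if bundle_norm \<mu> \<xi> = 1
     then Lim (at_left 1) (\<lambda>r. \<rho> (fst \<xi>, \<lambda>ix. of_real r * snd \<xi> ix) / (1 - r\<^sup>2))
     else \<rho> \<xi> / (1 - (bundle_norm \<mu> \<xi>)\<^sup>2))"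

lemma bundle_chart_scale:
  "(fst (bundle_chart \<mu> j (w, t)), \<lambda>ix. of_real r * snd (bundle_chart \<mu> j (w, t)) ix) = bundle_chart \<mu> j (w, r *\<^sub>R t)"
  by (simp add: bundle_chart_def scaleR_conv_of_real mult.assoc)

text \<open>At a boundary point the radial path stays in \<open>V\<close> for \<open>r\<close> near
  1, where the factor \<open>1 - r\<^sup>2\<close> cancels; continuity of \<open>q\<close> then
  identifies the limit.\<close>

lemma boundary_quotient_eq:
  fixes \<rho> :: "('n::finite) bundle_point \<Rightarrow> real"
  assumes V: "open V" and q: "smooth_on V q"
    and eq: "\<And>y. y \<in> V \<Longrightarrow> \<rho> (bundle_chart \<mu> j y) = (1 - chart_norm_sq \<mu> j y) * q y" and y: "y \<in> V"
  shows "boundary_quotient \<mu> \<rho> (bundle_chart \<mu> j y) = q y"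
proof (cases "bundle_norm \<mu> (bundle_chart \<mu> j y) = 1")
  case True
  obtain w t where wt: "y = (w, t)" by fastforce
  have "continuous_on V q" using q Ck_on_continuous by (auto simp: smooth_on_def)
  then have "isCont q y" using V y by (simp add: continuous_on_eq_continuous_at)
  have path: "((\<lambda>r::real. (w, r *\<^sub>R t)) \<longlongrightarrow> y) (at_left 1)"
    unfolding wt by (rule tendsto_eq_intros refl tendsto_ident_at)+ simp
  have "((\<lambda>r. q (w, r *\<^sub>R t)) \<longlongrightarrow> q y) (at_left 1)"
    using \<open>isCont q y\<close> path by (rule isCont_tendsto_compose)
  moreover have "\<forall>\<^sub>F r in at_left 1. q (w, r *\<^sub>R t) = \<rho> (bundle_chart \<mu> j (w, r *\<^sub>R t)) / (1 - r\<^sup>2)"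
  proof -
    have "\<forall>\<^sub>F r in at_left 1. (w, r *\<^sub>R t) \<in> V" using topological_tendstoD[OF path V y] .
    moreover have "\<forall>\<^sub>F r in at_left (1::real). r \<in> {0<..<1}" by (rule eventually_at_left_real) simp
    ultimately show ?thesis
    proof eventually_elim
      fix r :: real assume r: "(w, r *\<^sub>R t) \<in> V" "r \<in> {0<..<1}"
      have "chart_norm_sq \<mu> j (w, t) = 1" using True by (simp add: chart_norm_sq wt)
      then have "\<rho> (bundle_chart \<mu> j (w, r *\<^sub>R t)) = (1 - r\<^sup>2) * q (w, r *\<^sub>R t)"
        using eq[OF r(1)] by (simp add: chart_norm_sq_scale)
      moreover have "r\<^sup>2 < 1" using r(2) by (simp add: power_less_one_iff)
      ultimately show "q (w, r *\<^sub>R t) = \<rho> (bundle_chart \<mu> j (w, r *\<^sub>R t)) / (1 - r\<^sup>2)" by simp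
    qed
  qed
  ultimately have "((\<lambda>r. \<rho> (bundle_chart \<mu> j (w, r *\<^sub>R t)) / (1 - r\<^sup>2)) \<longlongrightarrow> q y) (at_left 1)"
    by (rule Lim_transform_eventually)
  then have "Lim (at_left 1) (\<lambda>r. \<rho> (bundle_chart \<mu> j (w, r *\<^sub>R t)) / (1 - r\<^sup>2)) = q y"
    by (intro tendsto_Lim) auto
  then show ?thesis
    using True unfolding boundary_quotient_def wt bundle_chart_scale by simp
next
  case False
  moreover have "bundle_norm \<mu> (bundle_chart \<mu> j y) \<noteq> - 1"
    using bundle_norm_nonneg[of \<mu> "bundle_chart \<mu> j y"] by linarith
  ultimately have "(bundle_norm \<mu> (bundle_chart \<mu> j y))\<^sup>2 \<noteq> 1"
    by (simp add: power2_eq_1_iff)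
  then show ?thesis using False eq[OF y] by (simp add: boundary_quotient_def chart_norm_sq)
qed

lemma log_term_vanishes_szego:
  "log_term_vanishes \<mu> (szego \<mu> :: ('n::finite) bundle_point \<Rightarrow> 'n bundle_point \<Rightarrow> complex)"
  unfolding log_term_vanishes_def
proof (intro allI impI)
  fix \<rho> :: "'n bundle_point \<Rightarrow> real" assume \<rho>: "defining_function \<mu> \<rho>"
  let ?n = "CARD('n)"
  obtain U where U: "chart_open (bundle_chart \<mu>) U" "closed_disc_bundle \<mu> \<subseteq> U"
    "smooth_map (bundle_chart \<mu>) U euclidean_chart \<rho>"
    and neg: "\<And>\<xi>. \<xi> \<in> disc_bundle \<mu> \<Longrightarrow> \<rho> \<xi> < 0" and zero: "\<And>\<xi>. \<xi> \<in> circle_bundle \<mu> \<Longrightarrow> \<rho> \<xi> = 0"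
    using \<rho> unfolding defining_function_def by blast
  obtain P :: "real poly" where P: "\<And>\<xi> :: 'n bundle_point. \<xi> \<in> disc_bundle \<mu> \<Longrightarrow>
      szego \<mu> \<xi> \<xi> = of_real (poly P ((bundle_norm \<mu> \<xi>)\<^sup>2) / (1 - (bundle_norm \<mu> \<xi>)\<^sup>2) ^ (?n + 1))"
    using szego_diagonal[of \<mu>, where 'n = 'n] by blast
  \<comment> \<open>Off the boundary 1 / (1 - r) is the boundary quotient divided by
    \<open>\<rho>\<close>, so P(r) / (1 - r)^(n+1) becomes this function divided by
    \<open>\<rho> \<xi> ^ (?n + 1)\<close>, and nothing is left for the logarithm.\<close>
  define \<phi> where "\<phi> = (\<lambda>\<xi>. poly P ((bundle_norm \<mu> \<xi>)\<^sup>2) * boundary_quotient \<mu> \<rho> \<xi> ^ (?n + 1))"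
  have \<rho>_Ck: "Ck_on k (bundle_chart \<mu> j -` U) (\<lambda>y. \<rho> (bundle_chart \<mu> j y))" for k j
  proof (rule Ck_on_local)
    fix x assume x: "x \<in> bundle_chart \<mu> j -` U"
    then obtain V h where V: "open V" "x \<in> V" "smooth_on V h"
      "\<And>y. y \<in> V \<Longrightarrow> bundle_chart \<mu> j y \<in> U \<Longrightarrow> \<rho> (bundle_chart \<mu> j y) = h y"
      using U(3)[unfolded smooth_map_def euclidean_chart_def, rule_format, of j x] by auto
    have op: "open (V \<inter> bundle_chart \<mu> j -` U)"
      using V(1) U(1) by (auto simp: chart_open_def intro: open_Int)
    have "Ck_on k (V \<inter> bundle_chart \<mu> j -` U) (\<lambda>y. \<rho> (bundle_chart \<mu> j y))"
    proof (rule Ck_on_cong[OF op])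
      show "Ck_on k (V \<inter> bundle_chart \<mu> j -` U) h"
        using V(3) by (auto simp: smooth_on_def intro: Ck_on_subset)
    qed (use V(4) in auto)
    then show "\<exists>V. open V \<and> x \<in> V \<and> Ck_on k V (\<lambda>y. \<rho> (bundle_chart \<mu> j y))"
      using op x V(2) by blast
  qed
  have smooth: "smooth_map (bundle_chart \<mu>) (closed_disc_bundle \<mu> \<inter> U) euclidean_chart \<phi>"
    unfolding smooth_map_def euclidean_chart_def
  proof (intro allI impI)
    fix j :: "'n option" and x assume x: "bundle_chart \<mu> j x \<in> closed_disc_bundle \<mu> \<inter> U"
    let ?R = "\<lambda>y. \<rho> (bundle_chart \<mu> j y)" and ?O = "bundle_chart \<mu> j -` U"
    have Op: "open ?O" using U(1) by (simp add: chart_open_def)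
    have "\<exists>V q. open V \<and> x \<in> V \<and> smooth_on V q \<and> (\<forall>y\<in>V. boundary_quotient \<mu> \<rho> (bundle_chart \<mu> j y) = q y)"
    proof (cases "bundle_norm \<mu> (bundle_chart \<mu> j x) = 1")
      case True
      obtain V q where V: "open V" "x \<in> V" "V \<subseteq> ?O" "smooth_on V q"
        "\<And>y. y \<in> V \<Longrightarrow> snd y \<noteq> 0 \<and> ?R y = (1 - chart_norm_sq \<mu> j y) * q y"
      proof (rule divide_by_one_minus_norm_sq[OF Op \<rho>_Ck, of x \<mu> j])
        show "chart_norm_sq \<mu> j x = 1" using True by (simp add: chart_norm_sq)
        show "?R y = 0" if "y \<in> ?O" "chart_norm_sq \<mu> j y = 1" for y
        proof (rule zero)
          have "bundle_norm \<mu> (bundle_chart \<mu> j y) \<noteq> - 1"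
            using bundle_norm_nonneg[of \<mu> "bundle_chart \<mu> j y"] by linarith
          then have "bundle_norm \<mu> (bundle_chart \<mu> j y) = 1"
            using that(2) by (simp add: chart_norm_sq power2_eq_1_iff)
          then show "bundle_chart \<mu> j y \<in> circle_bundle \<mu>"
            using bundle_chart_in_total_space[of \<mu> j y] by (simp add: circle_bundle_def)
        qed
      qed (use x in auto)
      have "boundary_quotient \<mu> \<rho> (bundle_chart \<mu> j y) = q y" if "y \<in> V" for y
        by (rule boundary_quotient_eq[OF V(1,4) _ that]) (use V(5) in blast)
      then show ?thesis using V(1,2,4) by blast
    next
      case False
      then have lt: "chart_norm_sq \<mu> j x < 1"
        using x by (simp add: closed_disc_bundle_def chart_norm_sq power_less_one_iff)
      define V where "V = ?O \<inter> {y. chart_norm_sq \<mu> j y < 1}"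
      have "continuous_on UNIV (chart_norm_sq \<mu> j)" using Ck_on_chart_norm_sq[OF open_UNIV] by (rule Ck_on_continuous)
      then have V: "open V"
        unfolding V_def by (intro open_Int Op open_Collect_less continuous_on_const)
      have "Ck_on k V (\<lambda>y. 1 + (- 1) *\<^sub>R chart_norm_sq \<mu> j y)" for k
        by (intro Ck_on_add Ck_on_const Ck_on_scaleR Ck_on_chart_norm_sq V)
      then have minus: "Ck_on k V (\<lambda>y. 1 - chart_norm_sq \<mu> j y)" for k by simp
      have "V \<subseteq> ?O" by (auto simp: V_def)
      have inv: "Ck_on k V (\<lambda>y. inverse (1 - chart_norm_sq \<mu> j y))" for k
        by (rule Ck_on_inverse[OF V minus]) (simp add: V_def)
      have "smooth_on V (\<lambda>y. ?R y * inverse (1 - chart_norm_sq \<mu> j y))"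
        unfolding smooth_on_def by (rule allI, rule Ck_on_mult[OF V Ck_on_subset[OF \<rho>_Ck \<open>V \<subseteq> ?O\<close>] inv])
      moreover have "boundary_quotient \<mu> \<rho> (bundle_chart \<mu> j y) = ?R y * inverse (1 - chart_norm_sq \<mu> j y)" if "y \<in> V" for y
        using that by (auto simp: V_def boundary_quotient_def chart_norm_sq divide_inverse)
      moreover have "x \<in> V" using x lt by (simp add: V_def)
      ultimately show ?thesis using V by blast
    qed
    then obtain V q where V: "open V" "x \<in> V" "smooth_on V q"
      "\<And>y. y \<in> V \<Longrightarrow> boundary_quotient \<mu> \<rho> (bundle_chart \<mu> j y) = q y"
      by blast
    show "\<exists>(i::unit) V h. open V \<and> x \<in> V \<and> smooth_on V h \<and>
        (\<forall>y\<in>V. bundle_chart \<mu> j y \<in> closed_disc_bundle \<mu> \<inter> U \<longrightarrow> \<phi> (bundle_chart \<mu> j y) = h y)"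
    proof (intro exI conjI ballI impI)
      show "smooth_on V (\<lambda>y. poly P (chart_norm_sq \<mu> j y) * q y ^ (?n + 1))"
      proof -
        have q_Ck: "Ck_on k V q" for k using V(3) by (simp add: smooth_on_def)
        show ?thesis
          unfolding smooth_on_def
          by (rule allI, rule Ck_on_mult[OF V(1) Ck_on_poly[OF V(1) Ck_on_chart_norm_sq[OF V(1)]] Ck_on_power[OF V(1) q_Ck]])
      qed
    qed (use V in \<open>auto simp: \<phi>_def chart_norm_sq\<close>)
  qed
  have const: "smooth_map (bundle_chart \<mu>) (closed_disc_bundle \<mu> \<inter> U) euclidean_chart (\<lambda>_ :: 'n bundle_point. 0 :: real)"
    unfolding smooth_map_def euclidean_chart_def smooth_on_def
    by (auto intro!: exI[of _ UNIV] exI[of _ "\<lambda>_. 0"] Ck_on_const)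
  have diag: "szego \<mu> \<xi> \<xi> = of_real (\<phi> \<xi> / \<rho> \<xi> ^ (?n + 1) + 0 * ln (- \<rho> \<xi>))" if \<xi>: "\<xi> \<in> disc_bundle \<mu>" for \<xi> :: "'n bundle_point"
  proof -
    have "\<rho> \<xi> \<noteq> 0" using neg[OF \<xi>] by simp
    moreover have "bundle_norm \<mu> \<xi> \<noteq> 1" using \<xi> by (auto simp: disc_bundle_def)
    ultimately show ?thesis unfolding P[OF \<xi>] \<phi>_def boundary_quotient_def
      by (simp add: power_divide del: power_Suc)
  qed
  have vanish: "vanishes_to_infinite_order \<mu> \<rho> (\<lambda>_. 0)"
    unfolding vanishes_to_infinite_order_def
    by (intro allI exI[of _ 0] exI[of _ UNIV]) (auto simp: chart_open_def)
  have "circle_bundle \<mu> \<subseteq> U" using U(2) by (auto simp: circle_bundle_def closed_disc_bundle_def)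
  then show "\<exists>V \<phi> \<psi>. chart_open (bundle_chart \<mu>) V \<and> circle_bundle \<mu> \<subseteq> V \<and>
      smooth_map (bundle_chart \<mu>) (closed_disc_bundle \<mu> \<inter> V) euclidean_chart \<phi> \<and>
      smooth_map (bundle_chart \<mu>) (closed_disc_bundle \<mu> \<inter> V) euclidean_chart \<psi> \<and>
      (\<forall>\<xi>\<in>disc_bundle \<mu> \<inter> V. szego \<mu> \<xi> \<xi> = of_real (\<phi> \<xi> / \<rho> \<xi> ^ (?n + 1) + \<psi> \<xi> * ln (- \<rho> \<xi>))) \<and>
      vanishes_to_infinite_order \<mu> \<rho> \<psi>"
    using U(1) smooth const vanish
    by (intro exI[of _ U] exI[of _ \<phi>] exI[of _ "\<lambda>_. 0"] conjI ballI diag) auto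
qed

theorem corollary3p6:
  fixes \<mu> :: nat
  assumes "\<mu> \<ge> 1"
  shows "log_term_vanishes \<mu>
           (szego_kernel \<mu> :: ('n::finite) bundle_point \<Rightarrow> 'n bundle_point \<Rightarrow> complex) \<and>
         (\<mu> > 1 \<longrightarrow>
           \<not> diffeomorphic (bundle_chart \<mu>) (circle_bundle \<mu> :: 'n bundle_point set)
               euclidean_chart (sphere 0 1 :: (complex ^ 'n option) set))"
  unfolding szego_kernel_eq[OF assms]
  using log_term_vanishes_szego circle_bundle_not_diffeomorphic_sphere by blast


end
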